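(* For every integer $n\ge3$, $$\left(\frac{\operatorname{Vol}\widetilde{\mathrm{Sos}}^{(n)}_{\mathcal Q}}{\operatorname{Vol}\widetilde{\mathrm{Pos}}^{(n)}_{\mathcal Q}}\right)^{1/D_{\mathcal M}}\le\frac{2^{5}\cdot2^{1/2}\cdot5^2\cdot10^{2/9}}{3^{3/2}\cdot\sqrt n}.$$
   Context: Let $x=(x_1,\dots,x_n)$, $y=(y_1,\dots,y_n)$ be tuples of commuting variables, $\mathbb R[x,y]_{k_1,k_2}$ the space of polynomials homogeneous of degree $k_1$ in $x$ and of degree $k_2$ in $y$, $I\subseteq\mathbb R[x,y]$ the ideal generated by $\sum_{i=1}^n x_iy_i$, and $V(I)=\{(x,y)\in\mathbb R^n\times\mathbb R^n: y^Tx=0\}$. Put $\mathcal Q=\mathbb R[x,y]_{2,2}/(I\cap\mathbb R[x,y]_{2,2})$; elements of $\mathcal Q$ are functions on $V(I)$. $\mathrm{Pos}^{(n)}_{\mathcal Q}=\{p\in\mathcal Q: p(x,y)\ge 0 \text{ for all }(x,y)\in V(I)\}$ and $\mathrm{Sos}^{(n)}_{\mathcal Q}=\{p\in\mathcal Q: p-\sum_{i=1}^k p_i^2\in I\text{ for some }k\in\mathbb N,\ p_i\in\mathbb R[x,y]_{1,1}\}$. Let $T=(\mathbb S^{n-1}\times \mathbb S^{n-1})\cap V(I)$ be the set of pairs of orthonormal vectors in $\mathbb R^n$, and let $\sigma$ be the unique normalized (total mass $1$) Borel measure on $T$ invariant under the action $g(x,y)=(gx,gy)$ of $SO(n)$.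 Let $\mathcal H=\{f\in\mathcal Q:\int_T f\,d\sigma=1\}$ and $\mathcal M=\{f\in\mathcal Q:\int_T f\,d\sigma=0\}$. Set $\widetilde{\mathrm{Pos}}^{(n)}_{\mathcal Q}=\{f\in\mathcal Q: f+(\sum_i x_i^2)(\sum_i y_i^2)\in \mathrm{Pos}^{(n)}_{\mathcal Q}\cap\mathcal H\}$ and $\widetilde{\mathrm{Sos}}^{(n)}_{\mathcal Q}=\{f\in\mathcal Q: f+(\sum_i x_i^2)(\sum_i y_i^2)\in \mathrm{Sos}^{(n)}_{\mathcal Q}\cap\mathcal H\}$; both are subsets of $\mathcal M$. $\mathcal M$ carries the inner product $\langle f,g\rangle=\int_T fg\,d\sigma$ and has dimension $D_{\mathcal M}=\binom{n+1}{2}^2-n^2-1$. $\operatorname{Vol}$ denotes the pushforward to $\mathcal M$ of Lebesgue measure on $\mathbb R^{D_{\mathcal M}}$ under any linear isometry $\mathbb R^{D_{\mathcal M}}\to\mathcal M$ (independent of the choice). *)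

theory Defs
  imports "HOL-Analysis.Analysis" "HOL-Library.Poly_Mapping"
begin

section \<open>The polynomial ring in two groups of variables\<close>

text \<open>
  \<open>\<real>[x,y]\<close> is the monoid ring over \<open>\<real>\<close> of the free commutative monoid of monomials; a monomial
  is a finitely supported exponent function on the variables, \<open>Inl i\<close> standing for \<open>x\<^sub>i\<close> and
  \<open>Inr i\<close> for \<open>y\<^sub>i\<close>. The ring structure is that of the library type \<open>poly_mapping\<close>.
\<close>

type_synonym 'n monom_xy = "('n + 'n) \<Rightarrow>\<^sub>0 nat"
type_synonym 'n poly_xy = "'n monom_xy \<Rightarrow>\<^sub>0 real"

definition varX :: "'n \<Rightarrow> 'n poly_xy" where
  "varX i = Poly_Mapping.single (Poly_Mapping.single (Inl i) 1) 1"

definition varY :: "'n \<Rightarrow> 'n poly_xy" where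
  "varY i = Poly_Mapping.single (Poly_Mapping.single (Inr i) 1) 1"

definition smult_xy :: "real \<Rightarrow> 'n poly_xy \<Rightarrow> 'n poly_xy" where
  "smult_xy c p = Poly_Mapping.single 0 c * p"

definition eval_monom :: "'n::finite monom_xy \<Rightarrow> real^'n \<Rightarrow> real^'n \<Rightarrow> real" where
  "eval_monom m x y =
     (\<Prod>i\<in>UNIV. (x $ i) ^ Poly_Mapping.lookup m (Inl i)) *
     (\<Prod>i\<in>UNIV. (y $ i) ^ Poly_Mapping.lookup m (Inr i))"

definition eval_xy :: "'n::finite poly_xy \<Rightarrow> real^'n \<Rightarrow> real^'n \<Rightarrow> real" where
  "eval_xy p x y =
     (\<Sum>m\<in>Poly_Mapping.keys p. Poly_Mapping.lookup p m * eval_monom m x y)"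

definition bihom :: "nat \<Rightarrow> nat \<Rightarrow> 'n::finite poly_xy set" where
  "bihom k1 k2 = {p. \<forall>m\<in>Poly_Mapping.keys p.
     (\<Sum>i\<in>UNIV. Poly_Mapping.lookup m (Inl i)) = k1 \<and>
     (\<Sum>i\<in>UNIV. Poly_Mapping.lookup m (Inr i)) = k2}"

definition idealI :: "'n::finite poly_xy set" where
  "idealI = {r * (\<Sum>i\<in>UNIV. varX i * varY i) | r. True}"

definition varietyI :: "((real^'n) \<times> (real^'n)) set" where
  "varietyI = {(x, y). y \<bullet> x = 0}"


subsection \<open>Evaluation is a ring homomorphism; closure properties\<close>

lemma eval_xy_superset:
  assumes "finite S" "Poly_Mapping.keys p \<subseteq> S"
  shows "eval_xy p x y = (\<Sum>m\<in>S. Poly_Mapping.lookup p m * eval_monom m x y)"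
  unfolding eval_xy_def
  by (rule sum.mono_neutral_left) (use assms in \<open>auto simp: in_keys_iff\<close>)

lemma eval_xy_zero [simp]: "eval_xy 0 x y = 0"
  by (simp add: eval_xy_def)

lemma eval_xy_add: "eval_xy (p + q) x y = eval_xy p x y + eval_xy q x y"
proof -
  let ?S = "Poly_Mapping.keys p \<union> Poly_Mapping.keys q"
  have "Poly_Mapping.keys (p + q) \<subseteq> ?S" by (rule Poly_Mapping.keys_add)
  then show ?thesis
    by (simp add: eval_xy_superset[of ?S] lookup_add sum.distrib algebra_simps)
qed

lemma eval_xy_uminus: "eval_xy (- p) x y = - eval_xy p x y"
  using eval_xy_add[of p "- p" x y] by simp

lemma eval_xy_diff: "eval_xy (p - q) x y = eval_xy p x y - eval_xy q x y"
  using eval_xy_add[of p "- q" x y] by (simp add: eval_xy_uminus)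

lemma eval_xy_sum: "eval_xy (sum f S) x y = (\<Sum>a\<in>S. eval_xy (f a) x y)"
  by (induction S rule: infinite_finite_induct) (auto simp: eval_xy_add)

lemma eval_xy_single: "eval_xy (Poly_Mapping.single m c) x y = c * eval_monom m x y"
  by (subst eval_xy_superset[of "{m}"]) auto

lemma eval_monom_add: "eval_monom (m + m') x y = eval_monom m x y * eval_monom m' x y"
  by (simp add: eval_monom_def lookup_add power_add prod.distrib)

lemma eval_xy_single_mult:
  "eval_xy (Poly_Mapping.single m c * q) x y = c * eval_monom m x y * eval_xy q x y"
proof (induction q rule: update_induct)
  case const
  then show ?case by simp
next
  case (update f a b)
  have "Poly_Mapping.update a b f = f + Poly_Mapping.single a b"
    by (rule poly_mapping_eqI)
       (use update.hyps in \<open>auto simp: lookup_update lookup_add lookup_single when_def in_keys_iff\<close>)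
  then show ?case
    using update.IH
    by (simp add: eval_xy_add distrib_left mult_single eval_xy_single eval_monom_add algebra_simps)
qed

lemma eval_xy_mult: "eval_xy (p * q) x y = eval_xy p x y * eval_xy q x y"
proof (induction p rule: update_induct)
  case const
  then show ?case by simp
next
  case (update f a b)
  have "Poly_Mapping.update a b f = f + Poly_Mapping.single a b"
    by (rule poly_mapping_eqI)
       (use update.hyps in \<open>auto simp: lookup_update lookup_add lookup_single when_def in_keys_iff\<close>)
  then show ?case
    using update.IH
    by (simp add: eval_xy_add distrib_right eval_xy_single_mult eval_xy_single)
qed

lemma eval_varX [simp]: "eval_xy (varX i) x y = x $ i"
proof -
  have "(\<Prod>j\<in>UNIV. (x $ j) ^ Poly_Mapping.lookup (Poly_Mapping.single (Inl i :: 'a + 'a) (1::nat)) (Inl j))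
        = (\<Prod>j\<in>UNIV. if j = i then x $ i else 1)"
    by (rule prod.cong) (auto simp: lookup_single when_def)
  then show ?thesis
    by (simp add: varX_def eval_xy_single eval_monom_def lookup_single)
qed

lemma eval_varY [simp]: "eval_xy (varY i) x y = y $ i"
proof -
  have "(\<Prod>j\<in>UNIV. (y $ j) ^ Poly_Mapping.lookup (Poly_Mapping.single (Inr i :: 'a + 'a) (1::nat)) (Inr j))
        = (\<Prod>j\<in>UNIV. if j = i then y $ i else 1)"
    by (rule prod.cong) (auto simp: lookup_single when_def)
  then show ?thesis
    by (simp add: varY_def eval_xy_single eval_monom_def lookup_single)
qed

lemma eval_smult_xy: "eval_xy (smult_xy c p) x y = c * eval_xy p x y"
  by (simp add: smult_xy_def eval_xy_single_mult eval_monom_def)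

lemma eval_idealI:
  assumes "p \<in> idealI" "(x, y) \<in> varietyI"
  shows "eval_xy p x y = 0"
  using assms
  by (auto simp: idealI_def varietyI_def eval_xy_mult eval_xy_sum inner_vec_def mult.commute)

lemma bihom_zero: "0 \<in> bihom j k"
  by (simp add: bihom_def)

lemma bihom_add: "p \<in> bihom j k \<Longrightarrow> q \<in> bihom j k \<Longrightarrow> p + q \<in> bihom j k"
  using Poly_Mapping.keys_add[of p q] by (auto simp: bihom_def)

lemma bihom_uminus: "p \<in> bihom j k \<Longrightarrow> - p \<in> bihom j k"
  by (auto simp: bihom_def in_keys_iff)

lemma bihom_diff: "p \<in> bihom j k \<Longrightarrow> q \<in> bihom j k \<Longrightarrow> p - q \<in> bihom j k"
  using bihom_add[of p j k "- q"] bihom_uminus by auto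

lemma bihom_smult: "p \<in> bihom j k \<Longrightarrow> smult_xy c p \<in> bihom j k"
  using keys_mult[of "Poly_Mapping.single 0 c" p]
  by (auto simp: bihom_def smult_xy_def split: if_splits)

lemma bihom_mult:
  assumes "p \<in> bihom j k" "q \<in> bihom j' k'"
  shows "p * q \<in> bihom (j + j') (k + k')"
  using keys_mult[of p q] assms
  by (fastforce simp: bihom_def lookup_add sum.distrib)

lemma bihom_sum: "(\<And>a. a \<in> S \<Longrightarrow> f a \<in> bihom j k) \<Longrightarrow> sum f S \<in> bihom j k"
  by (induction S rule: infinite_finite_induct) (auto simp: bihom_zero bihom_add)

lemma varX_bihom: "varX i \<in> bihom 1 0"
  by (auto simp: bihom_def varX_def lookup_single when_def)

lemma varY_bihom: "varY i \<in> bihom 0 1"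
  by (auto simp: bihom_def varY_def lookup_single when_def)

lemma normsq_bihom: "(\<Sum>i\<in>UNIV. (varX i)\<^sup>2) * (\<Sum>i\<in>UNIV. (varY i)\<^sup>2) \<in> bihom 2 2"
proof -
  have "(varX i)\<^sup>2 \<in> bihom 2 0" "(varY i)\<^sup>2 \<in> bihom 0 2" for i :: 'a
    using bihom_mult[OF varX_bihom varX_bihom, of i i] bihom_mult[OF varY_bihom varY_bihom, of i i]
    by (simp_all add: power2_eq_square numeral_2_eq_2)
  then have "(\<Sum>i\<in>UNIV. (varX i)\<^sup>2) * (\<Sum>i\<in>UNIV. (varY i :: 'a poly_xy)\<^sup>2) \<in> bihom (2 + 0) (0 + 2)"
    by (intro bihom_mult bihom_sum)
  then show ?thesis
    by (simp only: add_0 add_0_right)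
qed

lemma idealI_zero: "0 \<in> idealI"
  unfolding idealI_def by (auto intro: exI[of _ 0])

lemma idealI_add: "p \<in> idealI \<Longrightarrow> q \<in> idealI \<Longrightarrow> p + q \<in> idealI"
  unfolding idealI_def by (auto simp flip: distrib_right)

lemma idealI_mult: "p \<in> idealI \<Longrightarrow> r * p \<in> idealI"
  unfolding idealI_def by (auto simp flip: mult.assoc)

lemma idealI_uminus: "p \<in> idealI \<Longrightarrow> - p \<in> idealI"
  using idealI_mult[of p "-1"] by simp


section \<open>The quotient space\<close>

text \<open>
  The type \<open>'n quotQ\<close> is \<open>\<real>[x,y]\<^sub>2\<^sub>,\<^sub>2 / (I \<inter> \<real>[x,y]\<^sub>2\<^sub>,\<^sub>2)\<close> with \<open>n = CARD('n)\<close>. The relation is partial: only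
  forms of bidegree \<open>(2,2)\<close> represent elements, and \<open>abs_quotQ p\<close> is the class of \<open>p\<close> only for
  \<open>p \<in> bihom 2 2\<close>.
\<close>

definition equivQ :: "'n::finite poly_xy \<Rightarrow> 'n poly_xy \<Rightarrow> bool" where
  "equivQ p q \<longleftrightarrow> p \<in> bihom 2 2 \<and> q \<in> bihom 2 2 \<and> p - q \<in> idealI"

quotient_type (overloaded) 'n quotQ = "'n::finite poly_xy" / partial: equivQ
proof (rule part_equivpI)
  show "\<exists>p::'n poly_xy. equivQ p p"
    by (rule exI[of _ 0]) (simp add: equivQ_def bihom_zero idealI_zero)
  show "symp (equivQ :: 'n poly_xy \<Rightarrow> _)"
    by (rule sympI) (use idealI_uminus in \<open>force simp: equivQ_def\<close>)
  show "transp (equivQ :: 'n poly_xy \<Rightarrow> _)"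
  proof (rule transpI)
    fix p q r :: "'n poly_xy"
    assume "equivQ p q" "equivQ q r"
    then show "equivQ p r"
      using idealI_add[of "p - q" "q - r"] by (simp add: equivQ_def)
  qed
qed

lemma equivQ_refl: "p \<in> bihom 2 2 \<Longrightarrow> equivQ p p"
  by (simp add: equivQ_def idealI_zero)

instantiation quotQ :: (finite) real_vector
begin

lift_definition zero_quotQ :: "'a quotQ" is 0
  by (simp add: equivQ_refl bihom_zero)

lift_definition plus_quotQ :: "'a quotQ \<Rightarrow> 'a quotQ \<Rightarrow> 'a quotQ" is "(+)"
  unfolding equivQ_def by (metis add_diff_add bihom_add idealI_add)

lift_definition uminus_quotQ :: "'a quotQ \<Rightarrow> 'a quotQ" is "uminus"
  unfolding equivQ_def by (metis minus_diff_minus bihom_uminus idealI_uminus)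

lift_definition minus_quotQ :: "'a quotQ \<Rightarrow> 'a quotQ \<Rightarrow> 'a quotQ" is "(-)"
proof -
  fix a b c d :: "'a poly_xy"
  assume "equivQ a b" "equivQ c d"
  moreover have "a - c - (b - d) = (a - b) + - (c - d)" by simp
  ultimately show "equivQ (a - c) (b - d)"
    unfolding equivQ_def by (metis bihom_diff idealI_add idealI_uminus)
qed

lift_definition scaleR_quotQ :: "real \<Rightarrow> 'a quotQ \<Rightarrow> 'a quotQ" is smult_xy
  unfolding equivQ_def
  by (metis bihom_smult idealI_mult smult_xy_def right_diff_distrib)

instance
proof
  fix a b c :: "'a quotQ" and r s :: real
  show "a + b + c = a + (b + c)"
    by transfer (auto simp: equivQ_def add.assoc bihom_add idealI_zero)
  show "a + b = b + a"
    by transfer (auto simp: equivQ_def add.commute bihom_add idealI_zero)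
  show "0 + a = a"
    by transfer (auto simp: equivQ_def idealI_zero)
  show "- a + a = 0"
    by transfer (auto simp: equivQ_def idealI_zero bihom_zero)
  show "a - b = a + - b"
    by transfer (auto simp: equivQ_def idealI_zero bihom_diff)
  show "r *\<^sub>R (a + b) = r *\<^sub>R a + r *\<^sub>R b"
    by transfer
      (auto simp: equivQ_def idealI_zero bihom_add bihom_smult smult_xy_def distrib_left
            intro!: bihom_add bihom_smult[unfolded smult_xy_def])
  show "(r + s) *\<^sub>R a = r *\<^sub>R a + s *\<^sub>R a"
    by transfer
      (auto simp: equivQ_def idealI_zero smult_xy_def distrib_right single_add
            intro!: bihom_add bihom_smult[unfolded smult_xy_def])
  show "r *\<^sub>R s *\<^sub>R a = (r * s) *\<^sub>R a"
  proof transfer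
    fix r s :: real and p :: "'a poly_xy"
    assume "equivQ p p"
    moreover have "smult_xy r (smult_xy s p) = smult_xy (r * s) p"
      by (simp add: smult_xy_def mult_single flip: mult.assoc)
    ultimately show "equivQ (smult_xy r (smult_xy s p)) (smult_xy (r * s) p)"
      by (simp add: equivQ_def idealI_zero bihom_smult)
  qed
  show "1 *\<^sub>R a = a"
    by transfer (auto simp: equivQ_def idealI_zero smult_xy_def)
qed

end

text \<open>
  Elements of the quotient are functions on \<open>V(I)\<close>; the value outside \<open>V(I)\<close> is the dummy \<open>0\<close>.
\<close>

lift_definition evalQ :: "'n::finite quotQ \<Rightarrow> (real^'n) \<times> (real^'n) \<Rightarrow> real"
  is "\<lambda>p (x, y). if (x, y) \<in> varietyI then eval_xy p x y else 0"
proof (rule ext)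
  fix p q :: "'n poly_xy" and z :: "(real^'n) \<times> (real^'n)"
  assume "equivQ p q"
  then have "eval_xy p x y = eval_xy q x y" if "(x, y) \<in> varietyI" for x y
    using eval_idealI[of "p - q" x y] that by (simp add: equivQ_def eval_xy_diff)
  then show "(case z of (x, y) \<Rightarrow> if (x, y) \<in> varietyI then eval_xy p x y else 0) =
             (case z of (x, y) \<Rightarrow> if (x, y) \<in> varietyI then eval_xy q x y else 0)"
    by (auto split: prod.splits)
qed


section \<open>The cones and their normalised sections\<close>

definition PosQ :: "'n::finite quotQ set" where
  "PosQ = {f. \<forall>z\<in>varietyI. evalQ f z \<ge> 0}"

definition SosQ :: "'n::finite quotQ set" where
  "SosQ = {abs_quotQ p | p. p \<in> bihom 2 2 \<and>
     (\<exists>(k::nat) q. (\<forall>i<k. q i \<in> bihom 1 1) \<and> p - (\<Sum>i<k. (q i)\<^sup>2) \<in> idealI)}"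

definition normsqQ :: "'n::finite quotQ" where
  "normsqQ = abs_quotQ ((\<Sum>i\<in>UNIV. (varX i)\<^sup>2) * (\<Sum>i\<in>UNIV. (varY i)\<^sup>2))"

definition setT :: "((real^'n) \<times> (real^'n)) set" where
  "setT = (sphere 0 1 \<times> sphere 0 1) \<inter> varietyI"

text \<open>The defining property of \<open>\<sigma>\<close>, the normalised \<open>SO(n)\<close>-invariant Borel measure on \<open>T\<close>.\<close>

definition invariant_measure_T :: "((real^'n) \<times> (real^'n)) measure \<Rightarrow> bool" where
  "invariant_measure_T \<sigma> \<longleftrightarrow>
     space \<sigma> = setT \<and> sets \<sigma> = sets (restrict_space borel setT) \<and>
     emeasure \<sigma> setT = 1 \<and>
     (\<forall>g :: real^'n^'n. rotation_matrix g \<longrightarrow>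
        distr \<sigma> \<sigma> (\<lambda>(x, y). (g *v x, g *v y)) = \<sigma>)"

context
  fixes \<sigma> :: "((real^'n::finite) \<times> (real^'n)) measure"
begin

definition hyperH :: "'n quotQ set" where
  "hyperH = {f. (\<integral>z. evalQ f z \<partial>\<sigma>) = 1}"

definition spaceM :: "'n quotQ set" where
  "spaceM = {f. (\<integral>z. evalQ f z \<partial>\<sigma>) = 0}"

definition innerM :: "'n quotQ \<Rightarrow> 'n quotQ \<Rightarrow> real" where
  "innerM f g = (\<integral>z. evalQ f z * evalQ g z \<partial>\<sigma>)"

definition PosTilde :: "'n quotQ set" where
  "PosTilde = {f. f + normsqQ \<in> PosQ \<inter> hyperH}"

definition SosTilde :: "'n quotQ set" where
  "SosTilde = {f. f + normsqQ \<in> SosQ \<inter> hyperH}"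

definition isometry_onto_M :: "(real^'d::finite \<Rightarrow> 'n quotQ) \<Rightarrow> bool" where
  "isometry_onto_M \<phi> \<longleftrightarrow>
     linear \<phi> \<and> range \<phi> = spaceM \<and> (\<forall>u v. innerM (\<phi> u) (\<phi> v) = u \<bullet> v)"

end

text \<open>The dimension \<open>D\<^sub>M\<close>; no truncation occurs for \<open>n \<ge> 2\<close>.\<close>

definition dimM :: "nat \<Rightarrow> nat" where
  "dimM n = ((n + 1) choose 2)\<^sup>2 - n\<^sup>2 - 1"

text \<open>
  The pushforward of Lebesgue measure along \<open>\<phi>\<close>, meant for \<open>\<phi>\<close> an isometry onto \<open>M\<close> and \<open>S \<subseteq> M\<close>.
\<close>

definition volM :: "(real^'d::finite \<Rightarrow> 'n::finite quotQ) \<Rightarrow> 'n quotQ set \<Rightarrow> real" where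
  "volM \<phi> S = measure lebesgue (\<phi> -` S)"

end

theory Submission
  imports Defs
begin

text \<open>
  Both bodies are compared with Euclidean balls of the space \<open>M\<close>, whose dimension \<open>D\<close> is at least
  \<open>n\<^sup>4 / 4\<close>. Only the invariance of \<open>\<sigma>\<close> is used, through the kernels of finite-dimensional
  invariant spaces of functions on the set \<open>T\<close> of orthonormal pairs. On such a space \<open>V\<close> the kernel
  \<open>K(w, z) = (\<Sum>i. e\<^sub>i(w) e\<^sub>i(z))\<close> of an orthonormal basis is invariant (\<open>kernel_invariant\<close>), so by
  transitivity \<open>K(z, z) = dim V\<close>. Hence the square of the supremum of a function in \<open>V\<close> is at most
  \<open>dim V\<close> times its mean square (\<open>sup_norm_le\<close>), and an invariant functional on \<open>V\<close> is a multiple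
  of the integral (\<open>invariant_functional_unique\<close>).
  
  \<^emph>\<open>Nonnegative forms.\<close> The value at a point of \<open>T\<close> is, on \<open>M\<close>, the inner product with a vector of
  length \<open>sqrt D\<close>. In the ball of radius \<open>r\<close> it therefore exceeds \<open>t r\<close> in absolute value for a
  proportion of at most \<open>2 exp(- t\<^sup>2 / 2)\<close> of the forms, because a spherical cap lies in a small ball.
  By Fubini, half of the forms \<open>f\<close> in the ball exceed \<open>t r\<close> only on a set of points of measure
  \<open>4 exp(- t\<^sup>2 / 2)\<close> (\<open>typical_tail\<close>). For \<open>t\<^sup>2 = 20 n\<close> this measure is smaller than the inverse of the
  dimension of the space of forms that contains \<open>f\<^sup>1\<^sup>6\<^sup>n\<close>, so the bound of the supremum by the mean
  square, applied to \<open>f\<^sup>1\<^sup>6\<^sup>n\<close>, shows that such an exceptional set is harmless, and \<open>\<bar>f\<bar> \<le> 6 sqrt n r\<close>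
  everywhere on \<open>T\<close> (\<open>typical_sup\<close>). Half of the ball of radius \<open>1 / (6 sqrt n)\<close> thus consists of
  forms bounded by \<open>1\<close> on \<open>T\<close>, which become nonnegative when \<open>1\<close> is added.
  
  \<^emph>\<open>Sums of squares.\<close> A form in the second body is a convex combination of \<open>q\<^sup>2 - 1\<close> for bilinear
  \<open>q\<close> of mean square \<open>1\<close>, given by traceless matrices. The fourth moment of \<open>q\<close> is at most \<open>9\<close>, up to
  normalization by the matrix norm (\<open>bilin_second_moment\<close>, \<open>bilin_fourth_moment\<close>); both moments are
  computed by replacing the second vector \<open>y\<close> by the component orthogonal to \<open>x\<close> of an independent
  unit vector, which changes the integral of a form only by a constant factor since the result is an
  invariant functional. So all products of two such \<open>q\<close> have bounded length in \<open>M\<close>. Restricting the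
  matrices to a net, which has at most \<open>exp(c n\<^sup>2)\<close> points because they form a space of dimension
  \<open>n\<^sup>2\<close>, encloses the body in the convex hull of \<open>exp(2 c n\<^sup>2)\<close> points of bounded length
  (\<open>Sos_subset_hull\<close>). Every point of a convex hull is within \<open>C / sqrt m\<close> of the average of some \<open>m\<close>
  of the spanning points, when these have length at most \<open>C\<close> (\<open>empirical_approximation\<close>). With \<open>m\<close>
  about \<open>n\<^sup>2 / 40\<close> the number of averages is only exponential in \<open>D\<close> with a small base, and their
  radius is of order \<open>1 / n\<close> (\<open>Sos_volume\<close>).
  
  The two estimates differ by a factor of order \<open>1 / sqrt n\<close>, and the constants multiply to less than
  \<open>344\<close>, a lower bound for the constant that is claimed. For small \<open>n\<close> the right-hand side exceeds
  \<open>1\<close> and it suffices that sums of squares are nonnegative.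
\<close>

section \<open>Bihomogeneous polynomial functions\<close>

text \<open>
  Functions on all pairs of vectors rather than classes modulo the ideal: products, powers and the
  action of matrices are then pointwise operations.
\<close>

definition biform :: "nat \<Rightarrow> ((real^'n::finite) \<times> (real^'n) \<Rightarrow> real) set" where
  "biform k = {\<lambda>z. eval_xy p (fst z) (snd z) | p. p \<in> bihom k k}"

definition act :: "real^'n^'n \<Rightarrow> (real^'n) \<times> (real^'n) \<Rightarrow> (real^'n) \<times> (real^'n::finite)" where
  "act g z = (g *v fst z, g *v snd z)"

lemma biformI: "p \<in> bihom k k \<Longrightarrow> (\<And>z. F z = eval_xy p (fst z) (snd z)) \<Longrightarrow> F \<in> biform k"
  unfolding biform_def by (auto simp: fun_eq_iff)

lemma biformE:
  assumes "F \<in> biform k"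
  obtains p where "p \<in> bihom k k" "F = (\<lambda>z. eval_xy p (fst z) (snd z))"
  using assms by (auto simp: biform_def)

lemma biform_zero: "(\<lambda>z. 0) \<in> biform k"
  by (rule biformI[OF bihom_zero]) simp

lemma biform_add: "F \<in> biform k \<Longrightarrow> G \<in> biform k \<Longrightarrow> (\<lambda>z. F z + G z) \<in> biform k"
  by (elim biformE, rule biformI[OF bihom_add]) (auto simp: eval_xy_add)

lemma biform_scale: "F \<in> biform k \<Longrightarrow> (\<lambda>z. c * F z) \<in> biform k"
  by (elim biformE, rule biformI[OF bihom_smult]) (auto simp: eval_smult_xy)

lemma biform_sum: "(\<And>a. a \<in> S \<Longrightarrow> F a \<in> biform k) \<Longrightarrow> (\<lambda>z. \<Sum>a\<in>S. F a z) \<in> biform k"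
  by (induction S rule: infinite_finite_induct) (auto simp: biform_zero biform_add)

lemma biform_mult: "F \<in> biform j \<Longrightarrow> G \<in> biform k \<Longrightarrow> (\<lambda>z. F z * G z) \<in> biform (j + k)"
  by (elim biformE, rule biformI[OF bihom_mult]) (auto simp: eval_xy_mult)

lemma eval_xy_one: "eval_xy 1 x y = 1"
  using eval_xy_single[of 0 1 x y] by (simp add: eval_monom_def)

lemma biform_one: "(\<lambda>z. 1) \<in> biform 0"
  by (rule biformI[of 1]) (auto simp: bihom_def eval_xy_one)

lemma biform_power: "F \<in> biform j \<Longrightarrow> (\<lambda>z. F z ^ p) \<in> biform (p * j)"
  by (induction p) (auto simp: biform_one dest: biform_mult[of F j])

lemma continuous_on_biform:
  assumes "F \<in> biform k" shows "continuous_on S F"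
proof -
  obtain p where p: "F = (\<lambda>z. eval_xy p (fst z) (snd z))"
    using assms by (auto simp: biform_def)
  show ?thesis
    unfolding p eval_xy_def eval_monom_def by (intro continuous_intros)
qed

lemma eval_monom_scale:
  "eval_monom m (a *\<^sub>R x) (b *\<^sub>R y) = a ^ (\<Sum>i\<in>UNIV. Poly_Mapping.lookup m (Inl i)) *
     b ^ (\<Sum>i\<in>UNIV. Poly_Mapping.lookup m (Inr i)) * eval_monom m x y"
  unfolding eval_monom_def
  by (simp add: power_mult_distrib prod.distrib power_sum algebra_simps)

lemma biform_scaleR:
  assumes "F \<in> biform k"
  shows "F (a *\<^sub>R x, b *\<^sub>R y) = a ^ k * b ^ k * F (x, y)"
proof -
  obtain p where p: "p \<in> bihom k k" "F = (\<lambda>z. eval_xy p (fst z) (snd z))"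
    using assms by (auto simp: biform_def)
  then have "Poly_Mapping.lookup p m * eval_monom m (a *\<^sub>R x) (b *\<^sub>R y) =
      a ^ k * b ^ k * (Poly_Mapping.lookup p m * eval_monom m x y)" if "m \<in> Poly_Mapping.keys p" for m
    using that by (auto simp: eval_monom_scale bihom_def)
  from sum.cong[OF refl this] show ?thesis
    unfolding p(2) eval_xy_def by (simp add: sum_distrib_left )
qed

definition bimonoms :: "nat \<Rightarrow> 'n::finite monom_xy set" where
  "bimonoms k = {m. (\<Sum>i\<in>UNIV. Poly_Mapping.lookup m (Inl i)) = k \<and>
     (\<Sum>i\<in>UNIV. Poly_Mapping.lookup m (Inr i)) = k}"

lemma bihom_power:
  assumes "p \<in> bihom a b" shows "p ^ r \<in> bihom (r * a) (r * b)"
proof (induction r)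
  case 0
  show ?case by (auto simp: bihom_def)
next
  case (Suc r)
  then show ?case using bihom_mult[OF assms Suc] by simp
qed

lemma bihom_prod:
  assumes "finite S" "\<And>i. i \<in> S \<Longrightarrow> p i \<in> bihom (a i) (b i)"
  shows "prod p S \<in> bihom (sum a S) (sum b S)"
  using assms by (induction S rule: finite_induct) (auto intro!: bihom_mult simp: bihom_def[of 0 0])

lemma eval_xy_power: "eval_xy (p ^ r) x y = eval_xy p x y ^ r"
  by (induction r) (auto simp: eval_xy_mult eval_xy_one)

lemma eval_xy_prod: "eval_xy (prod p S) x y = (\<Prod>i\<in>S. eval_xy (p i) x y)"
  by (induction S rule: infinite_finite_induct) (auto simp: eval_xy_mult eval_xy_one)

text \<open>
  Substituting linear forms for the variables in a monomial gives a product of linear forms in \<open>x\<close> and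
  of linear forms in \<open>y\<close>, so the bidegree is preserved.
\<close>

lemma biform_act:
  fixes F :: "(real^'n::finite) \<times> (real^'n) \<Rightarrow> real"
  assumes "F \<in> biform k"
  shows "(\<lambda>z. F (act g z)) \<in> biform k"
proof -
  obtain p where p: "p \<in> bihom k k" "F = (\<lambda>z. eval_xy p (fst z) (snd z))"
    using assms by (auto simp: biform_def)
  have "(\<lambda>z. eval_monom m (g *v fst z) (g *v snd z)) \<in> biform k"
    if "m \<in> Poly_Mapping.keys p" for m
  proof (rule biformI)
    define lx where "lx i = (\<Sum>j\<in>UNIV. smult_xy (g $ i $ j) (varX j))" for i
    define ly where "ly i = (\<Sum>j\<in>UNIV. smult_xy (g $ i $ j) (varY j))" for i
    let ?q = "(\<Prod>i\<in>UNIV. lx i ^ Poly_Mapping.lookup m (Inl i)) * (\<Prod>i\<in>UNIV. ly i ^ Poly_Mapping.lookup m (Inr i))"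
    have "lx i \<in> bihom 1 0" "ly i \<in> bihom 0 1" for i
      unfolding lx_def ly_def by (intro bihom_sum bihom_smult varX_bihom varY_bihom)+
    then have "lx i ^ r \<in> bihom r 0" "ly i ^ r \<in> bihom 0 r" for i r
      using bihom_power[of "lx i" 1 0 r] bihom_power[of "ly i" 0 1 r] by simp_all
    then have "(\<Prod>i\<in>UNIV. lx i ^ Poly_Mapping.lookup m (Inl i)) \<in>
          bihom (\<Sum>i\<in>UNIV. Poly_Mapping.lookup m (Inl i)) (\<Sum>i\<in>(UNIV :: 'n set). 0)"
      "(\<Prod>i\<in>UNIV. ly i ^ Poly_Mapping.lookup m (Inr i)) \<in>
          bihom (\<Sum>i\<in>(UNIV :: 'n set). 0) (\<Sum>i\<in>UNIV. Poly_Mapping.lookup m (Inr i))"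
      by (intro bihom_prod; simp)+
    then have "?q \<in> bihom (k + 0) (0 + k)"
      using p(1) that by (intro bihom_mult) (auto simp: bihom_def)
    then show "?q \<in> bihom k k" by simp
    show "eval_monom m (g *v fst z) (g *v snd z) = eval_xy ?q (fst z) (snd z)" for z
      unfolding eval_monom_def lx_def ly_def
      by (simp add: eval_xy_mult eval_xy_prod eval_xy_power eval_xy_sum eval_smult_xy
          matrix_vector_mult_def)
  qed
  then show ?thesis
    unfolding p(2) act_def eval_xy_def by (auto intro!: biform_sum biform_scale)
qed

lemma biform_monom: "m \<in> bimonoms k \<Longrightarrow> (\<lambda>z. eval_monom m (fst z) (snd z)) \<in> biform k"
  by (rule biformI[of "Poly_Mapping.single m 1"]) (auto simp: bihom_def bimonoms_def eval_xy_single)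

lemma bimonoms_exponents:
  fixes k :: nat
  defines "E \<equiv> {f :: 'n::finite \<Rightarrow> nat. sum f UNIV = k}"
  shows "inj_on (\<lambda>m. (\<lambda>i. Poly_Mapping.lookup m (Inl i), \<lambda>i. Poly_Mapping.lookup m (Inr i)))
           (bimonoms k :: 'n monom_xy set)"
    and "(\<lambda>m. (\<lambda>i. Poly_Mapping.lookup m (Inl i), \<lambda>i. Poly_Mapping.lookup m (Inr i))) `
           (bimonoms k :: 'n monom_xy set) \<subseteq> E \<times> E"
proof -
  show "inj_on (\<lambda>m. (\<lambda>i. Poly_Mapping.lookup m (Inl i), \<lambda>i. Poly_Mapping.lookup m (Inr i)))
           (bimonoms k :: 'n monom_xy set)"
  proof (rule inj_onI, rule poly_mapping_eqI)
    fix m m' :: "'n monom_xy" and v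
    assume "(\<lambda>i. Poly_Mapping.lookup m (Inl i), \<lambda>i. Poly_Mapping.lookup m (Inr i)) =
       (\<lambda>i. Poly_Mapping.lookup m' (Inl i), \<lambda>i. Poly_Mapping.lookup m' (Inr i))"
    then show "Poly_Mapping.lookup m v = Poly_Mapping.lookup m' v"
      by (cases v) (auto simp: fun_eq_iff)
  qed
qed (auto simp: bimonoms_def E_def)

lemma exponents_bounded: "{f :: 'n::finite \<Rightarrow> nat. sum f UNIV = k} \<subseteq> Pi\<^sub>E UNIV (\<lambda>_. {..k})"
  by (auto intro: member_le_sum)

text \<open>
  The generating function bound: the number of monomials of degree \<open>k\<close> is the coefficient of \<open>t\<^sup>k\<close> in
  the power series \<open>(1 - t)\<^sup>-\<^sup>n\<close>, hence at most \<open>t\<^sup>-\<^sup>k (1 - t)\<^sup>-\<^sup>n\<close>. A suitable \<open>t\<close> gives the correct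
  exponential order.
\<close>

lemma card_exponents_le:
  fixes t :: real
  assumes t: "0 < t" "t < 1"
  shows "real (card {f :: 'n::finite \<Rightarrow> nat. sum f UNIV = k}) \<le> (1 / t) ^ k * (1 / (1 - t)) ^ CARD('n)"
proof -
  let ?E = "{f :: 'n \<Rightarrow> nat. sum f UNIV = k}"
  have fin: "finite (Pi\<^sub>E UNIV (\<lambda>_. {..k}) :: ('n \<Rightarrow> nat) set)"
    by (intro finite_PiE) auto
  have "real (card ?E) * t ^ k = (\<Sum>f\<in>?E. \<Prod>i\<in>UNIV. t ^ f i)"
    by (simp flip: power_sum)
  also have "\<dots> \<le> (\<Sum>f\<in>Pi\<^sub>E UNIV (\<lambda>_. {..k}). \<Prod>i\<in>(UNIV :: 'n set). t ^ f i)"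
  proof (rule sum_mono2[OF fin])
    show "?E \<subseteq> Pi\<^sub>E UNIV (\<lambda>_. {..k})" by (rule exponents_bounded)
    show "0 \<le> (\<Prod>i\<in>UNIV. t ^ f i)" for f :: "'n \<Rightarrow> nat"
      using t by (simp add: prod_nonneg)
  qed
  also have "\<dots> = (\<Prod>i\<in>(UNIV :: 'n set). \<Sum>j\<le>k. t ^ j)"
    by (rule prod_sum_PiE[symmetric]) auto
  also have "\<dots> \<le> (\<Prod>i\<in>(UNIV :: 'n set). 1 / (1 - t))"
  proof (intro prod_mono conjI sum_nonneg)
    have "(\<Sum>j\<le>k. t ^ j) = (1 - t ^ Suc k) / (1 - t)"
      using t by (simp add: sum_gp0)
    also have "\<dots> \<le> 1 / (1 - t)" using t by (intro divide_right_mono) auto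
    finally show "(\<Sum>j\<le>k. t ^ j) \<le> 1 / (1 - t)" .
  qed (use t in auto)
  finally have "real (card ?E) * t ^ k \<le> (1 / (1 - t)) ^ CARD('n)" by simp
  then show ?thesis
    using t by (simp add: field_simps)
qed

lemma bimonoms_finite_card:
  fixes t :: real
  shows "finite (bimonoms k :: 'n::finite monom_xy set)"
    and "0 < t \<Longrightarrow> t < 1 \<Longrightarrow>
      real (card (bimonoms k :: 'n::finite monom_xy set)) \<le> ((1 / t) ^ k * (1 / (1 - t)) ^ CARD('n))\<^sup>2"
proof -
  let ?E = "{f :: 'n::finite \<Rightarrow> nat. sum f UNIV = k}"
  have finE: "finite ?E"
    by (rule finite_subset[OF exponents_bounded]) (auto intro: finite_PiE)
  show "finite (bimonoms k :: 'n::finite monom_xy set)"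
    using inj_on_finite[OF bimonoms_exponents] finE by blast
  assume t: "0 < t" "t < 1"
  have "card (bimonoms k :: 'n::finite monom_xy set) \<le> card (?E \<times> ?E)"
    using card_inj_on_le[OF bimonoms_exponents] finE by blast
  then have "real (card (bimonoms k :: 'n::finite monom_xy set)) \<le> real (card ?E) ^ 2"
    by (simp add: card_cartesian_product power2_eq_square flip: of_nat_mult)
  also have "\<dots> \<le> ((1 / t) ^ k * (1 / (1 - t)) ^ CARD('n))\<^sup>2"
    by (intro power_mono card_exponents_le t) auto
  finally show "real (card (bimonoms k :: 'n monom_xy set)) \<le> ((1 / t) ^ k * (1 / (1 - t)) ^ CARD('n))\<^sup>2" .
qed

lemma biform_expand:
  assumes "F \<in> biform k"
  obtains c where "\<And>z. F z = (\<Sum>m\<in>bimonoms k. c m * eval_monom m (fst z) (snd z))"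
proof -
  obtain p where p: "p \<in> bihom k k" "F = (\<lambda>z. eval_xy p (fst z) (snd z))"
    using assms by (auto simp: biform_def)
  then have "Poly_Mapping.keys p \<subseteq> bimonoms k"
    by (auto simp: bihom_def bimonoms_def)
  then show thesis
    using p(2) eval_xy_superset[OF bimonoms_finite_card(1), of p k]
    by (intro that[of "Poly_Mapping.lookup p"]) auto
qed

definition bilin :: "real^'n^'n \<Rightarrow> (real^'n) \<times> (real^'n::finite) \<Rightarrow> real" where
  "bilin A z = fst z \<bullet> (A *v snd z)"

lemma bilin_add: "bilin (A + B) z = bilin A z + bilin B z"
  by (simp add: bilin_def matrix_vector_mult_add_rdistrib inner_right_distrib)

lemma bilin_scaleR: "bilin (c *\<^sub>R A) z = c * bilin A z"
  by (simp add: bilin_def scaleR_matrix_vector_assoc[symmetric])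

lemma bilin_sum: "bilin (sum B S) z = (\<Sum>m\<in>S. bilin (B m) z)"
  by (induction S rule: infinite_finite_induct) (auto simp: bilin_add, simp_all add: bilin_def)

lemma bilin_axis: "bilin (axis i (axis j 1)) z = fst z $ i * snd z $ j"
proof -
  have "axis i (axis j 1) *v snd z = axis i (snd z $ j)"
    unfolding vec_eq_iff matrix_vector_mul_component
    by (auto simp: axis_def[of i] inner_axis')
  then show ?thesis by (simp add: bilin_def inner_axis)
qed

lemma biform_bilin: "bilin A \<in> biform 1"
proof (rule biformI)
  have "varX i * varY j \<in> bihom 1 1" for i j :: 'a
    using bihom_mult[OF varX_bihom varY_bihom, of i j] by simp
  then show "(\<Sum>i\<in>UNIV. \<Sum>j\<in>UNIV. smult_xy (A $ i $ j) (varX i * varY j)) \<in> bihom 1 1"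
    by (intro bihom_sum bihom_smult)
  show "bilin A z = eval_xy (\<Sum>i\<in>UNIV. \<Sum>j\<in>UNIV. smult_xy (A $ i $ j) (varX i * varY j)) (fst z) (snd z)" for z
    by (simp add: bilin_def eval_xy_sum eval_smult_xy eval_xy_mult inner_vec_def
        matrix_vector_mult_def sum_distrib_left mult_ac)
qed

lemma biform_normsq: "(\<lambda>z. (norm (fst z))\<^sup>2 * (norm (snd z))\<^sup>2) \<in> biform 2"
  by (rule biformI[OF normsq_bihom])
     (simp add: eval_xy_mult eval_xy_sum eval_xy_power power2_norm_eq_inner inner_vec_def flip: power2_eq_square)

lemma sum_nat_eq_1:
  fixes f :: "'a \<Rightarrow> nat"
  assumes "finite S" "sum f S = 1"
  obtains i where "i \<in> S" "f i = 1" "\<And>j. j \<in> S \<Longrightarrow> j \<noteq> i \<Longrightarrow> f j = 0"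
proof -
  obtain i where i: "i \<in> S" "f i \<noteq> 0"
    using assms by (metis sum.neutral zero_neq_one)
  have *: "sum f S = f i + sum f (S - {i})"
    using assms(1) i(1) by (rule sum.remove)
  then have "f i = 1" "sum f (S - {i}) = 0" using i assms(2) by auto
  then show thesis using that i(1) assms(1) by auto
qed

lemma prod_power_indicator:
  fixes x :: "real^'n::finite"
  assumes "f i = 1" "\<And>j. j \<noteq> i \<Longrightarrow> f j = (0::nat)"
  shows "(\<Prod>j\<in>UNIV. (x $ j) ^ f j) = x $ i"
proof -
  have "(\<Prod>j\<in>UNIV. (x $ j) ^ f j) = (\<Prod>j\<in>UNIV. if j = i then x $ i else 1)"
    by (rule prod.cong) (use assms in auto)
  then show ?thesis by simp
qed

lemma biform_1_bilin:
  assumes "F \<in> biform 1"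
  obtains A where "F = bilin A"
proof -
  obtain p where p: "p \<in> bihom 1 1" "F = (\<lambda>z. eval_xy p (fst z) (snd z))"
    using assms by (auto simp: biform_def)
  have "\<exists>A. (\<lambda>z. eval_monom m (fst z) (snd z)) = bilin A" if "m \<in> Poly_Mapping.keys p" for m
  proof -
    have m: "(\<Sum>i\<in>UNIV. Poly_Mapping.lookup m (Inl i)) = 1" "(\<Sum>i\<in>UNIV. Poly_Mapping.lookup m (Inr i)) = 1"
      using p(1) that by (auto simp: bihom_def)
    obtain i where i: "Poly_Mapping.lookup m (Inl i) = 1" "\<And>j. j \<noteq> i \<Longrightarrow> Poly_Mapping.lookup m (Inl j) = 0"
      using sum_nat_eq_1[OF finite_class.finite_UNIV m(1)] by auto
    obtain j where j: "Poly_Mapping.lookup m (Inr j) = 1" "\<And>i. i \<noteq> j \<Longrightarrow> Poly_Mapping.lookup m (Inr i) = 0"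
      using sum_nat_eq_1[OF finite_class.finite_UNIV m(2)] by auto
    have "eval_monom m (fst z) (snd z) = bilin (axis i (axis j 1)) z" for z
      unfolding eval_monom_def bilin_axis
      by (intro arg_cong2[of _ _ _ _ "(*)"] prod_power_indicator i j)
    then show ?thesis by blast
  qed
  then obtain B where B: "\<And>m. m \<in> Poly_Mapping.keys p \<Longrightarrow> (\<lambda>z. eval_monom m (fst z) (snd z)) = bilin (B m)"
    by metis
  have "F = bilin (\<Sum>m\<in>Poly_Mapping.keys p. Poly_Mapping.lookup p m *\<^sub>R B m)"
  proof
    fix z
    have "F z = (\<Sum>m\<in>Poly_Mapping.keys p. Poly_Mapping.lookup p m * bilin (B m) z)"
      unfolding p(2) eval_xy_def by (rule sum.cong) (auto dest: B fun_cong[of _ _ z])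
    also have "\<dots> = bilin (\<Sum>m\<in>Poly_Mapping.keys p. Poly_Mapping.lookup p m *\<^sub>R B m) z"
      by (simp add: bilin_sum bilin_scaleR)
    finally show "F z = bilin (\<Sum>m\<in>Poly_Mapping.keys p. Poly_Mapping.lookup p m *\<^sub>R B m) z" .
  qed
  then show thesis by (rule that)
qed

section \<open>Rotations of orthonormal pairs\<close>

text \<open>
  The diagonal reflection of one coordinate, conjugated by a rotation that carries this coordinate
  axis to \<open>w\<close>; conjugation does not change the determinant.
\<close>

lemma reflection_exists:
  fixes w :: "real^'n::finite"
  assumes w: "norm w = 1" and n: "2 \<le> CARD('n)"
  obtains S :: "real^'n^'n" where "orthogonal_matrix S" "det S = -1"
    "\<And>x. S *v x = x - (2 * (w \<bullet> x)) *\<^sub>R w"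
proof -
  fix k :: 'n
  obtain Q :: "real^'n^'n" where Q: "rotation_matrix Q" "Q *v axis k 1 = w"
    using rotation_matrix_exists_basis[OF n w] by metis
  have oQ: "orthogonal_matrix Q" and dQ: "det Q = 1" 
    using Q by (auto simp: rotation_matrix_def)
  define E :: "real^'n^'n" where "E = (\<chi> i j. if i = j then (if i = k then -1 else 1) else 0)"
  have dE: "det E = -1"
  proof -
    have "det E = (\<Prod>i\<in>UNIV. E $ i $ i)"
      by (rule det_diagonal) (auto simp: E_def)
    also have "\<dots> = (\<Prod>i\<in>UNIV. if i = k then -1 else 1)"
      by (auto simp: E_def)
    finally show ?thesis by simp
  qed
  have Ex: "E *v x = x - (2 * x $ k) *\<^sub>R axis k 1" for x
  proof -
    have "(\<Sum>j\<in>UNIV. E $ i $ j * x $ j) = (\<Sum>j\<in>UNIV. if j = i then (if i = k then -1 else 1) * x $ i else 0)" for i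
      by (rule sum.cong) (auto simp: E_def)
    then show ?thesis
      by (auto simp: vec_eq_iff matrix_vector_mult_def axis_def)
  qed
  have "transpose E = E" by (auto simp: transpose_def E_def vec_eq_iff)
  moreover have "E ** E = mat 1"
    unfolding matrix_eq by (simp add: Ex vec_eq_iff axis_def flip: matrix_vector_mul_assoc)
  ultimately have oE: "orthogonal_matrix E" by (simp add: orthogonal_matrix)
  let ?S = "Q ** E ** transpose Q"
  show thesis
  proof (rule that)
    show "orthogonal_matrix ?S"
      using oQ oE by (auto intro!: orthogonal_matrix_mul simp: orthogonal_matrix_transpose)
    show "det ?S = -1" using dQ dE by (simp add: det_mul)
    fix x
    have "(transpose Q *v x) $ k = w \<bullet> x"
      using Q(2) by (metis dot_lmul_matrix inner_axis inner_commute inner_real_def mult.right_neutral transpose_matrix_vector)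
    moreover have "Q *v (transpose Q *v x) = x"
      using oQ unfolding matrix_vector_mul_assoc by (simp add: orthogonal_matrix_def)
    ultimately show "?S *v x = x - (2 * (w \<bullet> x)) *\<^sub>R w"
      using Q(2) by (simp add: Ex matrix_vector_mult_diff_distrib matrix_vector_mult_scaleR flip: matrix_vector_mul_assoc)
  qed
qed

text \<open>
  Two vectors of equal length are exchanged by the reflection along their difference, which fixes
  everything orthogonal to both.
\<close>

lemma orthogonal_matrix_swap:
  fixes a b :: "real^'n::finite"
  assumes ab: "norm a = norm b" and n: "2 \<le> CARD('n)"
  obtains S :: "real^'n^'n" where "orthogonal_matrix S" "S *v a = b"
    "\<And>c. c \<bullet> a = 0 \<Longrightarrow> c \<bullet> b = 0 \<Longrightarrow> S *v c = c"
proof (cases "a = b")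
  case True
  then show thesis by (intro that[of "mat 1"]) (auto simp: orthogonal_matrix_id)
next
  case False
  define w where "w = (a - b) /\<^sub>R norm (a - b)"
  have w: "norm w = 1" using False by (simp add: w_def)
  obtain S where S: "orthogonal_matrix S" "\<And>x. S *v x = x - (2 * (w \<bullet> x)) *\<^sub>R w"
    using reflection_exists[OF w n] by metis
  have "a \<bullet> a = b \<bullet> b" using ab by (simp add: dot_square_norm)
  then have "2 * ((a - b) \<bullet> a) = (norm (a - b))\<^sup>2"
    by (simp add: power2_norm_eq_inner inner_diff_left inner_diff_right inner_commute)
  moreover have "(2 * (w \<bullet> a)) *\<^sub>R w = (2 * ((a - b) \<bullet> a) / (norm (a - b))\<^sup>2) *\<^sub>R (a - b)"
    by (simp add: w_def divide_inverse power2_eq_square mult_ac)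
  ultimately have "(2 * (w \<bullet> a)) *\<^sub>R w = a - b"
    using False by simp
  moreover have "w \<bullet> c = 0" if "c \<bullet> a = 0" "c \<bullet> b = 0" for c
    using that by (simp add: w_def inner_diff_right inner_commute[of _ c])
  ultimately show thesis
    using S by (intro that[of S]) auto
qed

lemma unit_orthogonal_to_pair:
  fixes x y :: "real^'n::finite"
  assumes "CARD('n) \<ge> 3"
  obtains w where "norm w = 1" "w \<bullet> x = 0" "w \<bullet> y = 0"
proof -
  have "dim {x, y} \<le> card {x, y}" by (rule dim_le_card) (auto intro: span_base)
  also have "\<dots> \<le> 2" by (rule card_insert_le_m1) auto
  finally have "dim (span {x, y}) < DIM(real^'n)" using assms by (simp add: dim_span)
  then have "span {x, y} \<noteq> UNIV" by (metis dim_UNIV less_irrefl)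
  then have "span {x, y} < UNIV" by blast
  then obtain a where a: "a \<noteq> 0" "\<And>c. c \<in> span {x, y} \<Longrightarrow> orthogonal a c"
    using orthogonal_to_subspace_exists_gen[of "{x, y}" UNIV] by (auto simp: dim_span)
  show thesis
    using a by (intro that[of "a /\<^sub>R norm a"]) (auto simp: orthogonal_def span_base)
qed

lemma setT_iff: "z \<in> setT \<longleftrightarrow> norm (fst z) = 1 \<and> norm (snd z) = 1 \<and> fst z \<bullet> snd z = 0"
  by (cases z) (auto simp: setT_def varietyI_def inner_commute)

lemma rotation_norm_inner:
  fixes g :: "real^'n^'n::finite"
  assumes "orthogonal_matrix g"
  shows "norm (g *v x) = norm x" "(g *v x) \<bullet> (g *v y) = x \<bullet> y"
proof -
  show "(g *v x) \<bullet> (g *v y) = x \<bullet> y" for x y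
  proof -
    have "transpose g ** g = mat 1" using assms by (simp add: orthogonal_matrix_def)
    then have "transpose g *v (g *v x) = x"
      by (simp only: matrix_vector_mul_assoc matrix_vector_mul_lid)
    then show ?thesis
      using dot_lmul_matrix[of "g *v x" g y] by simp
  qed
  then show "norm (g *v x) = norm x" by (simp add: norm_eq_sqrt_inner)
qed

lemma act_setT: "orthogonal_matrix g \<Longrightarrow> act g z \<in> setT \<longleftrightarrow> z \<in> setT"
  by (simp add: setT_iff act_def rotation_norm_inner)

text \<open>
  Two reflections match first the vectors \<open>x\<close> and then the vectors \<open>y\<close>. If the composition reverses
  the orientation, a further reflection along a direction orthogonal to the target pair corrects it;
  such a direction needs \<open>n \<ge> 3\<close>.
\<close>

lemma rotation_transitive:
  fixes z z' :: "(real^'n::finite) \<times> (real^'n)"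
  assumes n: "CARD('n) \<ge> 3" and z: "z \<in> setT" "z' \<in> setT"
  obtains g where "rotation_matrix g" "act g z = z'"
proof -
  have n2: "2 \<le> CARD('n)" using n by simp
  obtain x y x' y' where xy: "z = (x, y)" "z' = (x', y')" by (cases z; cases z')
  have xyn: "norm x = 1" "norm y = 1" "x \<bullet> y = 0" "norm x' = 1" "norm y' = 1" "x' \<bullet> y' = 0"
    using z by (auto simp: xy setT_iff)
  obtain S where S: "orthogonal_matrix S" "S *v x = x'"
    using orthogonal_matrix_swap[OF _ n2, of x x'] xyn by metis
  have Sy: "norm (S *v y) = norm y'" "x' \<bullet> (S *v y) = 0"
    using xyn S rotation_norm_inner[OF S(1)] by metis+
  obtain R where R: "orthogonal_matrix R" "R *v (S *v y) = y'" "R *v x' = x'"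
    using orthogonal_matrix_swap[OF Sy(1) n2] Sy(2) xyn(6) by metis
  let ?h = "R ** S"
  have h: "orthogonal_matrix ?h" "?h *v x = x'" "?h *v y = y'"
    using R S by (auto intro!: orthogonal_matrix_mul simp flip: matrix_vector_mul_assoc)
  show thesis
  proof (cases "det ?h = 1")
    case True
    then show thesis using h by (intro that[of ?h]) (auto simp: rotation_matrix_def act_def xy)
  next
    case False
    then have d: "det ?h = -1" using det_orthogonal_matrix[OF h(1)] by auto
    obtain w where w: "norm w = 1" "w \<bullet> x' = 0" "w \<bullet> y' = 0"
      using unit_orthogonal_to_pair[OF n] by metis
    obtain H where H: "orthogonal_matrix H" "det H = -1" "\<And>x. H *v x = x - (2 * (w \<bullet> x)) *\<^sub>R w"
      using reflection_exists[OF w(1) n2] by metis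
    have "rotation_matrix (H ** ?h)"
      using H(1,2) h(1) d by (auto simp: rotation_matrix_def det_mul intro!: orthogonal_matrix_mul)
    moreover have "act (H ** ?h) z = z'"
      using h H(3) w(2,3) by (simp add: act_def xy flip: matrix_vector_mul_assoc[of H])
    ultimately show thesis by (rule that)
  qed
qed

lemma compact_setT: "compact (setT :: ((real^'n::finite) \<times> (real^'n)) set)"
proof -
  have "closed (varietyI :: ((real^'n) \<times> (real^'n)) set)"
    unfolding varietyI_def case_prod_beta by (intro closed_Collect_eq continuous_intros)
  then show ?thesis
    unfolding setT_def by (intro compact_Int_closed compact_Times compact_sphere)
qed

lemma continuous_act: "continuous_on S (act g)"
  unfolding act_def
  by (intro continuous_on_Pair bounded_linear.continuous_on[OF matrix_vector_mul_bounded_linear]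
      continuous_on_fst continuous_on_snd continuous_on_id)

section \<open>Integration against the invariant measure\<close>

locale stiefel =
  fixes \<sigma> :: "((real^'n::finite) \<times> (real^'n)) measure"
  assumes n3: "CARD('n) \<ge> 3" and inv: "invariant_measure_T \<sigma>"
begin

lemma space_sigma [simp]: "space \<sigma> = setT"
  and sets_sigma: "sets \<sigma> = sets (restrict_space borel setT)"
  and emeasure_setT: "emeasure \<sigma> setT = 1"
  using inv by (auto simp: invariant_measure_T_def)

sublocale finite_measure \<sigma>
  by (rule finite_measureI) (simp add: emeasure_setT)

lemma setT_nonempty: "setT \<noteq> ({} :: ((real^'n) \<times> (real^'n)) set)"
  using emeasure_setT by force

lemma measure_setT: "measure \<sigma> setT = 1"
  by (simp add: measure_def emeasure_setT)

lemma measurable_sigma: "f \<in> measurable borel N \<Longrightarrow> f \<in> measurable \<sigma> N"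
  unfolding measurable_cong_sets[OF sets_sigma refl] by (rule measurable_restrict_space1)

lemma continuous_measurable: "continuous_on UNIV f \<Longrightarrow> f \<in> borel_measurable \<sigma>"
  by (intro measurable_sigma borel_measurable_continuous_onI)

lemma continuous_bounded:
  assumes "continuous_on UNIV (f :: _ \<Rightarrow> real)"
  obtains B where "\<And>z. z \<in> setT \<Longrightarrow> \<bar>f z\<bar> \<le> B"
proof -
  have "compact (f ` setT)"
    using assms compact_setT by (metis compact_continuous_image continuous_on_subset top_greatest)
  then obtain B where "\<forall>v\<in>f ` setT. norm v \<le> B"
    using compact_imp_bounded bounded_iff by metis
  then show thesis using that by auto
qed

lemma integrable_bounded:
  assumes "f \<in> borel_measurable \<sigma>" "\<And>z. z \<in> setT \<Longrightarrow> \<bar>f z\<bar> \<le> (B :: real)"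
  shows "integrable \<sigma> f"
  by (rule integrable_const_bound[of _ B]) (use assms in auto)

lemma integrable_continuous:
  assumes "continuous_on UNIV (f :: _ \<Rightarrow> real)"
  shows "integrable \<sigma> f"
  using continuous_bounded[OF assms] integrable_bounded[OF continuous_measurable[OF assms]] by metis

lemma integrable_biform: "F \<in> biform k \<Longrightarrow> integrable \<sigma> F"
  by (intro integrable_continuous continuous_on_biform)

lemma integral_const_setT: "(\<And>z. z \<in> setT \<Longrightarrow> f z = (c :: real)) \<Longrightarrow> (\<integral>z. f z \<partial>\<sigma>) = c"
  by (subst Bochner_Integration.integral_cong[of \<sigma> \<sigma> f "\<lambda>_. c"]) (auto simp: measure_setT)

lemma integral_cong_setT: "(\<And>z. z \<in> setT \<Longrightarrow> f z = (g z :: real)) \<Longrightarrow> (\<integral>z. f z \<partial>\<sigma>) = (\<integral>z. g z \<partial>\<sigma>)"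
  by (rule Bochner_Integration.integral_cong) auto

lemma act_measurable:
  assumes "orthogonal_matrix g" shows "act g \<in> measurable \<sigma> \<sigma>"
proof -
  have "act g \<in> measurable borel borel"
    by (rule borel_measurable_continuous_onI[OF continuous_act])
  then have "act g \<in> measurable (restrict_space borel setT) (restrict_space borel setT)"
    by (rule measurable_restrict_space3) (use act_setT[OF assms] in auto)
  then show ?thesis
    unfolding measurable_cong_sets[OF sets_sigma sets_sigma] .
qed

lemma integral_act:
  assumes g: "rotation_matrix g" and f: "f \<in> borel_measurable \<sigma>"
  shows "(\<integral>z. f (act g z) \<partial>\<sigma>) = (\<integral>z. (f z :: real) \<partial>\<sigma>)"
proof -
  have "distr \<sigma> \<sigma> (act g) = \<sigma>"
    using inv g unfolding invariant_measure_T_def act_def[abs_def] case_prod_beta by blast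
  then have "(\<integral>z. f z \<partial>\<sigma>) = (\<integral>z. f z \<partial>distr \<sigma> \<sigma> (act g))" by simp
  also have "\<dots> = (\<integral>z. f (act g z) \<partial>\<sigma>)"
    by (rule integral_distr[OF act_measurable f]) (use g in \<open>simp add: rotation_matrix_def\<close>)
  finally show ?thesis by simp
qed

text \<open>
  The measure has full support. If \<open>f\<close> were nonzero at \<open>z\<close>, then by transitivity and compactness the
  sum of finitely many rotated copies of \<open>f\<close> would be positive on all of \<open>T\<close>, although its integral
  vanishes.
\<close>

lemma null_imp_zero_on_setT:
  assumes f: "continuous_on UNIV f" "\<And>z. f z \<ge> (0::real)" and int: "(\<integral>z. f z \<partial>\<sigma>) = 0"
    and z: "z \<in> setT"
  shows "f z = 0"
proof (rule ccontr)
  assume nz: "f z \<noteq> 0"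
  define U where "U g = {w. f (act g w) \<noteq> 0}" for g :: "real^'n^'n"
  have fc: "continuous_on UNIV (\<lambda>w. f (act g w))" for g
    by (rule continuous_on_compose2[OF f(1) continuous_act]) auto
  have opn: "open (U g)" for g
    unfolding U_def by (intro open_Collect_neq continuous_on_const fc)
  have "setT \<subseteq> (\<Union>g\<in>{g. rotation_matrix g}. U g)"
  proof
    fix w :: "(real^'n) \<times> (real^'n)" assume "w \<in> setT"
    then obtain g where "rotation_matrix g" "act g w = z" using rotation_transitive[OF n3 _ z] by metis
    then show "w \<in> (\<Union>g\<in>{g. rotation_matrix g}. U g)" using nz by (auto simp: U_def)
  qed
  then obtain G where G: "G \<subseteq> {g. rotation_matrix g}" "finite G" "setT \<subseteq> (\<Union>g\<in>G. U g)"
    using compactE_image[OF compact_setT, of "{g. rotation_matrix g}" U] opn by metis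
  let ?s = "\<lambda>w. \<Sum>g\<in>G. f (act g w)"
  have "(\<integral>w. ?s w \<partial>\<sigma>) = (\<Sum>g\<in>G. \<integral>w. f (act g w) \<partial>\<sigma>)"
    by (intro Bochner_Integration.integral_sum integrable_continuous fc)
  also have "\<dots> = 0"
    using G(1) integral_act[OF _ continuous_measurable[OF f(1)]] int by (intro sum.neutral) auto
  finally have "AE w in \<sigma>. ?s w = 0"
    by (subst (asm) integral_nonneg_eq_0_iff_AE) (auto intro!: integrable_continuous continuous_on_sum fc sum_nonneg f(2))
  moreover have "?s w \<noteq> 0" if w: "w \<in> setT" for w
  proof -
    obtain g where "g \<in> G" "f (act g w) \<noteq> 0" using G(3) w by (auto simp: U_def)
    then have "0 < ?s w" using G(2) f(2) by (intro sum_pos2[of _ g]) (auto simp: less_le)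
    then show ?thesis by simp
  qed
  ultimately have "AE w in \<sigma>. False" by (simp cong: AE_cong_simp)
  then show False
    by (simp add: eventually_False ae_filter_eq_bot_iff emeasure_setT)
qed

end

section \<open>Reproducing kernels of rotation-invariant function spaces\<close>

lemma act_transpose: "orthogonal_matrix g \<Longrightarrow> act (transpose g) (act g z) = z"
  unfolding act_def by (simp only: matrix_vector_mul_assoc fst_conv snd_conv orthogonal_matrix_def
      matrix_vector_mul_lid prod.collapse)

lemma rotation_transpose: "rotation_matrix g \<Longrightarrow> rotation_matrix (transpose g)"
  by (simp add: rotation_matrix_def orthogonal_matrix_transpose det_transpose)

definition invariant_space :: "((real^'n::finite) \<times> (real^'n) \<Rightarrow> real) set \<Rightarrow> bool" where
  "invariant_space V \<longleftrightarrow>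
     (\<forall>F\<in>V. continuous_on UNIV F) \<and> (\<lambda>z. 0) \<in> V \<and>
     (\<forall>F\<in>V. \<forall>G\<in>V. (\<lambda>z. F z + G z) \<in> V) \<and> (\<forall>F\<in>V. \<forall>c. (\<lambda>z. c * F z) \<in> V) \<and>
     (\<forall>F\<in>V. \<forall>g. rotation_matrix g \<longrightarrow> (\<lambda>z. F (act g z)) \<in> V)"

lemma invariant_spaceD:
  assumes "invariant_space V"
  shows "F \<in> V \<Longrightarrow> continuous_on UNIV F" "(\<lambda>z. 0) \<in> V"
    "F \<in> V \<Longrightarrow> G \<in> V \<Longrightarrow> (\<lambda>z. F z + G z) \<in> V" "F \<in> V \<Longrightarrow> (\<lambda>z. c * F z) \<in> V"
    "F \<in> V \<Longrightarrow> rotation_matrix g \<Longrightarrow> (\<lambda>z. F (act g z)) \<in> V"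
  using assms by (auto simp: invariant_space_def)

lemma invariant_space_sum:
  assumes "invariant_space V" "\<And>i. i \<in> S \<Longrightarrow> e i \<in> V"
  shows "(\<lambda>z. \<Sum>i\<in>S. c i * e i z) \<in> V"
  using assms(2)
  by (induction S rule: infinite_finite_induct) (auto intro!: invariant_spaceD[OF assms(1)])

lemma invariant_space_biform: "invariant_space (biform k)"
  by (simp add: invariant_space_def continuous_on_biform biform_zero biform_add biform_scale biform_act)

context stiefel
begin

definition ip :: "((real^'n) \<times> (real^'n) \<Rightarrow> real) \<Rightarrow> ((real^'n) \<times> (real^'n) \<Rightarrow> real) \<Rightarrow> real" where
  "ip F G = (\<integral>z. F z * G z \<partial>\<sigma>)"

lemma integrable_mult:
  "continuous_on UNIV F \<Longrightarrow> continuous_on UNIV G \<Longrightarrow> integrable \<sigma> (\<lambda>z. F z * G z :: real)"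
  by (intro integrable_continuous continuous_intros)

lemma ip_commute: "ip F G = ip G F"
  by (simp add: ip_def mult.commute)

lemma ip_sum_left:
  assumes "\<And>i. i \<in> S \<Longrightarrow> continuous_on UNIV (e i)" "continuous_on UNIV G"
    and "\<And>z. z \<in> setT \<Longrightarrow> F z = (\<Sum>i\<in>S. c i * e i z)"
  shows "ip F G = (\<Sum>i\<in>S. c i * ip (e i) G)"
proof -
  have "ip F G = (\<integral>z. (\<Sum>i\<in>S. c i * (e i z * G z)) \<partial>\<sigma>)"
    unfolding ip_def by (rule integral_cong_setT) (simp add: assms(3) sum_distrib_right mult.assoc)
  also have "\<dots> = (\<Sum>i\<in>S. \<integral>z. c i * (e i z * G z) \<partial>\<sigma>)"
    using assms by (intro Bochner_Integration.integral_sum integrable_mult_right integrable_mult) auto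
  finally show ?thesis by (simp add: ip_def)
qed

definition orthonormal_basis ::
  "((real^'n) \<times> (real^'n) \<Rightarrow> real) set \<Rightarrow> nat \<Rightarrow> (nat \<Rightarrow> (real^'n) \<times> (real^'n) \<Rightarrow> real) \<Rightarrow> bool" where
  "orthonormal_basis V N e \<longleftrightarrow> (\<forall>i<N. e i \<in> V) \<and>
     (\<forall>i<N. \<forall>j<N. ip (e i) (e j) = (if i = j then 1 else 0)) \<and>
     (\<forall>F\<in>V. \<forall>z\<in>setT. F z = (\<Sum>i<N. ip F (e i) * e i z))"

text \<open>
  Functions are identified when they agree on \<open>T\<close>. A residual of length zero vanishes there because
  the measure has full support, and then contributes no new basis function.
\<close>

lemma gram_schmidt:
  assumes V: "invariant_space V" and "set bs \<subseteq> V"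
  shows "\<exists>N e. N \<le> length bs \<and> (\<forall>i<N. e i \<in> V) \<and>
     (\<forall>i<N. \<forall>j<N. ip (e i) (e j) = (if i = j then 1 else 0)) \<and>
     (\<forall>F\<in>set bs. \<forall>z\<in>setT. F z = (\<Sum>i<N. ip F (e i) * e i z))"
  using assms(2)
proof (induction bs)
  case Nil
  then show ?case by (intro exI[of _ 0]) auto
next
  case (Cons b bs)
  note VD = invariant_spaceD[OF V]
  have "set bs \<subseteq> V" using Cons.prems by simp
  from Cons.IH[OF this]
  obtain N e where *: "N \<le> length bs \<and> (\<forall>i<N. e i \<in> V) \<and>
     (\<forall>i<N. \<forall>j<N. ip (e i) (e j) = (if i = j then 1 else 0)) \<and>
     (\<forall>F\<in>set bs. \<forall>z\<in>setT. F z = (\<Sum>i<N. ip F (e i) * e i z))"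
    by (elim exE)
  then have N: "N \<le> length bs" and eV: "\<And>i. i < N \<Longrightarrow> e i \<in> V"
    and on: "\<And>i j. i < N \<Longrightarrow> j < N \<Longrightarrow> ip (e i) (e j) = (if i = j then 1 else 0)"
    and ex: "\<And>F z. F \<in> set bs \<Longrightarrow> z \<in> setT \<Longrightarrow> F z = (\<Sum>i<N. ip F (e i) * e i z)"
    by blast+
  have bV: "b \<in> V" and bsV: "set bs \<subseteq> V" using Cons by auto
  have cont: "continuous_on UNIV F" if "F \<in> V" for F using VD(1) that .
  \<comment> \<open>the residual of \<open>b\<close> after projection to the span of the functions chosen so far\<close>
  define r where "r z = b z + (\<Sum>i<N. (- ip b (e i)) * e i z)" for z
  have rV: "r \<in> V"
    unfolding r_def[abs_def] by (intro VD(3) bV invariant_space_sum[OF V] eV) auto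
  have b_eq: "b z = r z + (\<Sum>i<N. ip b (e i) * e i z)" for z
    by (simp add: r_def sum_negf)
  have ip_r: "ip r (e j) = 0" if j: "j < N" for j
  proof -
    have "ip r (e j) = ip b (e j) + (\<Sum>i<N. (- ip b (e i)) * ip (e i) (e j))"
    proof -
      have "ip r (e j) = (\<integral>z. b z * e j z + (\<Sum>i<N. (- ip b (e i)) * e i z) * e j z \<partial>\<sigma>)"
        unfolding ip_def r_def by (simp add: distrib_right)
      also have "\<dots> = ip b (e j) + ip (\<lambda>z. \<Sum>i<N. (- ip b (e i)) * e i z) (e j)"
        unfolding ip_def
        by (rule Bochner_Integration.integral_add; intro integrable_mult cont bV eV j invariant_space_sum[OF V]) auto
      also have "ip (\<lambda>z. \<Sum>i<N. (- ip b (e i)) * e i z) (e j) = (\<Sum>i<N. (- ip b (e i)) * ip (e i) (e j))"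
        by (rule ip_sum_left) (auto intro: cont eV j)
      finally show ?thesis .
    qed
    also have "\<dots> = ip b (e j) + (\<Sum>i<N. if i = j then - ip b (e j) else 0)"
      by (intro arg_cong2[of _ _ _ _ "(+)"] sum.cong) (auto simp: on j)
    finally show ?thesis using j by simp
  qed
  define s where "s = ip r r"
  show ?case
  proof (cases "s = 0")
    case True
    have r0: "r z * r z = 0" if "z \<in> setT" for z
      by (rule null_imp_zero_on_setT[OF _ _ _ that])
         (use True cont[OF rV] in \<open>auto simp: s_def ip_def intro!: continuous_intros\<close>)
    have "F z = (\<Sum>i<N. ip F (e i) * e i z)" if "F \<in> set (b # bs)" "z \<in> setT" for F z
    proof (cases "F = b")
      case True
      show ?thesis unfolding True using b_eq[of z] r0[OF that(2)] by simp
    next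
      case False
      then show ?thesis using that ex by simp
    qed
    then show ?thesis using N eV on by (intro exI[of _ N] exI[of _ e]) auto
  next
    case False
    have s: "s > 0"
      using False unfolding s_def ip_def by (simp add: less_le)
    define q where "q z = (1 / sqrt s) * r z" for z
    define e' where "e' = e(N := q)"
    have qV: "q \<in> V" unfolding q_def[abs_def] by (rule VD(4)[OF rV])
    have ip_q: "ip q G = ip r G / sqrt s" "ip G q = ip G r / sqrt s" for G
      by (simp_all add: ip_def q_def mult.assoc mult.left_commute[of _ "inverse _"] divide_inverse mult.commute[of _ "inverse _"])
    have e'V: "e' i \<in> V" if "i < Suc N" for i
      using that eV qV by (auto simp: e'_def less_Suc_eq)
    have "ip (e' i) (e' j) = (if i = j then 1 else 0)" if "i < Suc N" "j < Suc N" for i j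
    proof -
      have "ip q q = 1" using s by (simp add: ip_q flip: s_def)
      moreover have "ip q (e i) = 0" "ip (e i) q = 0" if "i < N" for i
        using ip_r[OF that] by (simp_all add: ip_q ip_commute[of "e i"])
      ultimately show ?thesis
        using that on by (auto simp: e'_def less_Suc_eq)
    qed
    moreover have "F z = (\<Sum>i<Suc N. ip F (e' i) * e' i z)" if F: "F \<in> set (b # bs)" and z: "z \<in> setT" for F z
    proof -
      have S: "(\<Sum>i<Suc N. ip F (e' i) * e' i z) = (\<Sum>i<N. ip F (e i) * e i z) + ip F q * q z" for F
        by (simp add: e'_def)
      show ?thesis
      proof (cases "F = b")
        case True
        have "ip b r = ip r r"
        proof -
          have "ip b r = (\<integral>z. r z * r z + (\<Sum>i<N. ip b (e i) * e i z) * r z \<partial>\<sigma>)"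
            unfolding ip_def[of b r] by (subst b_eq) (simp add: distrib_right)
          also have "\<dots> = ip r r + ip (\<lambda>z. \<Sum>i<N. ip b (e i) * e i z) r"
            unfolding ip_def
            by (rule Bochner_Integration.integral_add; intro integrable_mult cont rV invariant_space_sum[OF V] eV) auto
          also have "ip (\<lambda>z. \<Sum>i<N. ip b (e i) * e i z) r = (\<Sum>i<N. ip b (e i) * ip (e i) r)"
            by (rule ip_sum_left) (auto intro: cont eV rV)
          also have "\<dots> = 0" by (intro sum.neutral) (simp add: ip_commute[of "e _" r] ip_r)
          finally show ?thesis by simp
        qed
        then have "ip b q * q z = r z"
          using s by (simp add: ip_q q_def flip: s_def)
        then show ?thesis unfolding S using b_eq[of z] True by simp
      next
        case False
        then have F: "F \<in> set bs" using F by simp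
        have "ip F r = (\<Sum>i<N. ip F (e i) * ip (e i) r)"
          by (rule ip_sum_left) (use ex[OF F] in \<open>auto intro: cont eV rV\<close>)
        also have "\<dots> = 0" by (intro sum.neutral) (simp add: ip_commute[of "e _" r] ip_r)
        finally have "ip F q = 0" by (simp add: ip_q)
        then show ?thesis unfolding S using ex[OF F z] by simp
      qed
    qed
    ultimately show ?thesis
      using N e'V by (intro exI[of _ "Suc N"] exI[of _ e']) (auto simp del: sum.lessThan_Suc)
  qed
qed

lemma orthonormal_basis_of_span:
  assumes V: "invariant_space V" and B: "finite B" "\<And>b. b \<in> B \<Longrightarrow> f b \<in> V"
    and span: "\<And>F. F \<in> V \<Longrightarrow> \<exists>c. \<forall>z\<in>setT. F z = (\<Sum>b\<in>B. c b * f b z)"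
  obtains N e where "N \<le> card B" "orthonormal_basis V N e"
proof -
  obtain bl where bl: "set bl = B" "distinct bl" using finite_distinct_list[OF B(1)] by auto
  have "set (map f bl) \<subseteq> V" using B(2) bl by auto
  from gram_schmidt[OF V this]
  obtain N e where *: "N \<le> length (map f bl) \<and> (\<forall>i<N. e i \<in> V) \<and>
     (\<forall>i<N. \<forall>j<N. ip (e i) (e j) = (if i = j then 1 else 0)) \<and>
     (\<forall>F\<in>set (map f bl). \<forall>z\<in>setT. F z = (\<Sum>i<N. ip F (e i) * e i z))"
    by (elim exE)
  then have N: "N \<le> length (map f bl)" and eV: "\<And>i. i < N \<Longrightarrow> e i \<in> V"
    and on: "\<forall>i<N. \<forall>j<N. ip (e i) (e j) = (if i = j then 1 else 0)"
    and ex: "\<And>F z. F \<in> set (map f bl) \<Longrightarrow> z \<in> setT \<Longrightarrow> F z = (\<Sum>i<N. ip F (e i) * e i z)"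
    by blast+
  note cont = invariant_spaceD(1)[OF V]
  have "F z = (\<Sum>i<N. ip F (e i) * e i z)" if F: "F \<in> V" and z: "z \<in> setT" for F z
  proof -
    obtain c where c: "\<And>z. z \<in> setT \<Longrightarrow> F z = (\<Sum>b\<in>B. c b * f b z)" using span[OF F] by auto
    have "F z = (\<Sum>b\<in>B. c b * (\<Sum>i<N. ip (f b) (e i) * e i z))"
      unfolding c[OF z] by (rule sum.cong) (use ex[OF _ z] bl in auto)
    also have "\<dots> = (\<Sum>i<N. (\<Sum>b\<in>B. c b * ip (f b) (e i)) * e i z)"
      by (simp add: sum_distrib_left sum_distrib_right mult.assoc) (rule sum.swap)
    also have "\<dots> = (\<Sum>i<N. ip F (e i) * e i z)"
      by (rule sum.cong) (auto simp: ip_sum_left[OF _ _ c] cont B(2) eV)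
    finally show ?thesis .
  qed
  then have "orthonormal_basis V N e" using eV on by (simp add: orthonormal_basis_def)
  moreover have "N \<le> card B" using N distinct_card[OF bl(2)] bl(1) by simp
  ultimately show thesis using that by blast
qed

lemma constant_on_setT:
  fixes f :: "(real^'n) \<times> (real^'n) \<Rightarrow> real"
  assumes "\<And>g z. rotation_matrix g \<Longrightarrow> z \<in> setT \<Longrightarrow> f (act g z) = f z"
  obtains c where "\<And>z. z \<in> setT \<Longrightarrow> f z = c"
proof -
  obtain z0 where z0: "z0 \<in> (setT :: ((real^'n) \<times> (real^'n)) set)" using setT_nonempty by blast
  show thesis
  proof (rule that)
    fix z :: "(real^'n) \<times> (real^'n)" assume "z \<in> setT"
    then obtain g where "rotation_matrix g" "act g z0 = z" using rotation_transitive[OF n3 z0] by metis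
    then show "f z = f z0" using assms z0 by metis
  qed
qed

context
  fixes V :: "((real^'n) \<times> (real^'n) \<Rightarrow> real) set" and N :: nat and e
  assumes V: "invariant_space V" and onb: "orthonormal_basis V N e"
begin

lemma onb_in: "i < N \<Longrightarrow> e i \<in> V"
  and onb_ip: "i < N \<Longrightarrow> j < N \<Longrightarrow> ip (e i) (e j) = (if i = j then 1 else 0)"
  and onb_expand: "F \<in> V \<Longrightarrow> z \<in> setT \<Longrightarrow> F z = (\<Sum>i<N. ip F (e i) * e i z)"
  using onb by (auto simp: orthonormal_basis_def)

lemma V_cont: "F \<in> V \<Longrightarrow> continuous_on UNIV F"
  by (rule invariant_spaceD(1)[OF V])

text \<open>
  As a function of \<open>z\<close>, the rotated kernel lies in \<open>V\<close>. Its coefficient at \<open>e j\<close> is computed by moving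
  the rotation to the other factor of the inner product, which gives the expansion of
  \<open>e j\<close> composed with the inverse rotation at the point \<open>g w\<close>, that is, the value \<open>e j w\<close>.
\<close>

lemma kernel_invariant:
  assumes g: "rotation_matrix g" and w: "w \<in> setT" and z: "z \<in> setT"
  shows "(\<Sum>i<N. e i (act g w) * e i (act g z)) = (\<Sum>i<N. e i w * e i z)"
proof -
  have og: "orthogonal_matrix g" using g by (simp add: rotation_matrix_def)
  define H where "H z = (\<Sum>i<N. e i (act g w) * e i (act g z))" for z
  have eg: "(\<lambda>z. e i (act g z)) \<in> V" if "i < N" for i
    by (rule invariant_spaceD(5)[OF V onb_in[OF that] g])
  have HV: "H \<in> V"
    unfolding H_def[abs_def] by (rule invariant_space_sum[OF V eg]) simp
  have "ip H (e j) = e j w" if j: "j < N" for j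
  proof -
    have "ip H (e j) = (\<Sum>i<N. e i (act g w) * ip (\<lambda>z. e i (act g z)) (e j))"
      by (rule ip_sum_left) (auto simp: H_def intro!: V_cont eg onb_in j)
    also have "\<dots> = (\<Sum>i<N. ip (\<lambda>z. e j (act (transpose g) z)) (e i) * e i (act g w))"
    proof (rule sum.cong[OF refl])
      fix i assume i: "i \<in> {..<N}"
      have "ip (\<lambda>z. e j (act (transpose g) z)) (e i) =
          (\<integral>z. e j (act (transpose g) (act g z)) * e i (act g z) \<partial>\<sigma>)"
        unfolding ip_def using i
        by (intro integral_act[OF g, symmetric] continuous_measurable continuous_intros V_cont onb_in
            invariant_spaceD(5)[OF V _ rotation_transpose[OF g]] j) auto
      also have "\<dots> = ip (\<lambda>z. e i (act g z)) (e j)"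
        by (simp add: act_transpose[OF og] ip_def mult.commute)
      finally show "e i (act g w) * ip (\<lambda>z. e i (act g z)) (e j) =
          ip (\<lambda>z. e j (act (transpose g) z)) (e i) * e i (act g w)" by simp
    qed
    also have "\<dots> = e j (act (transpose g) (act g w))"
      by (rule onb_expand[symmetric, OF invariant_spaceD(5)[OF V onb_in[OF j] rotation_transpose[OF g]]])
         (simp add: act_setT[OF og] w)
    finally show ?thesis by (simp add: act_transpose[OF og])
  qed
  then show ?thesis
    using onb_expand[OF HV z] by (simp add: H_def)
qed

lemma kernel_diagonal:
  assumes w: "w \<in> setT" shows "(\<Sum>i<N. (e i w)\<^sup>2) = real N"
proof -
  obtain c where c: "\<And>z. z \<in> setT \<Longrightarrow> (\<Sum>i<N. e i z * e i z) = c"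
  proof (rule constant_on_setT)
    show "(\<Sum>i<N. e i (act g z) * e i (act g z)) = (\<Sum>i<N. e i z * e i z)"
      if "rotation_matrix g" "z \<in> setT" for g z
      using that by (intro kernel_invariant)
  qed (rule that)
  have "c = (\<integral>z. (\<Sum>i<N. e i z * e i z) \<partial>\<sigma>)"
    using integral_const_setT[OF c] by simp
  also have "\<dots> = (\<Sum>i<N. ip (e i) (e i))"
    unfolding ip_def by (intro Bochner_Integration.integral_sum integrable_mult V_cont onb_in) auto
  also have "\<dots> = real N" by (simp add: onb_ip)
  finally show ?thesis using c[OF w] by (simp add: power2_eq_square)
qed

text \<open>
  Cauchy-Schwarz for the coefficients of \<open>F\<close> in an orthonormal basis, where the diagonal of the kernel
  is the dimension.
\<close>

lemma sup_norm_le: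
  assumes F: "F \<in> V" and w: "w \<in> setT"
  shows "(F w)\<^sup>2 \<le> real N * ip F F"
proof -
  have "(F w)\<^sup>2 = (\<Sum>i<N. ip F (e i) * e i w)\<^sup>2"
    using onb_expand[OF F w] by simp
  also have "\<dots> \<le> (\<Sum>i<N. (ip F (e i))\<^sup>2) * (\<Sum>i<N. (e i w)\<^sup>2)"
    by (rule Cauchy_Schwarz_ineq_sum)
  also have "(\<Sum>i<N. (ip F (e i))\<^sup>2) = (\<Sum>i<N. ip F (e i) * ip (e i) F)"
    by (simp add: power2_eq_square ip_commute)
  also have "\<dots> = ip F F"
    by (rule ip_sum_left[symmetric]) (auto intro: V_cont onb_in F onb_expand)
  finally show ?thesis by (simp add: kernel_diagonal[OF w] mult.commute)
qed

text \<open>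
  The functional is represented by the function \<open>C\<close> obtained by applying it to one argument of the
  kernel. Invariance of the kernel and of the functional make \<open>C\<close> constant on \<open>T\<close>.
\<close>

lemma invariant_functional_unique:
  assumes add: "\<And>F G. F \<in> V \<Longrightarrow> G \<in> V \<Longrightarrow> L (\<lambda>z. F z + G z) = L F + (L G :: real)"
    and scale: "\<And>F c. F \<in> V \<Longrightarrow> L (\<lambda>z. c * F z) = c * L F"
    and cong: "\<And>F G. F \<in> V \<Longrightarrow> G \<in> V \<Longrightarrow> (\<And>z. z \<in> setT \<Longrightarrow> F z = G z) \<Longrightarrow> L F = L G"
    and inv: "\<And>F g. F \<in> V \<Longrightarrow> rotation_matrix g \<Longrightarrow> L (\<lambda>z. F (act g z)) = L F"
  obtains c where "\<And>F. F \<in> V \<Longrightarrow> L F = c * (\<integral>z. F z \<partial>\<sigma>)"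
proof -
  have zero: "L (\<lambda>z. 0) = 0" using scale[OF invariant_spaceD(2)[OF V], of 0] by simp
  have lsum: "L (\<lambda>z. \<Sum>i<M. a i * e i z) = (\<Sum>i<M. a i * L (e i))" if "M \<le> N" for M a
    using that
  proof (induction M)
    case 0 then show ?case by (simp add: zero)
  next
    case (Suc M)
    then have "L (\<lambda>z. (\<Sum>i<M. a i * e i z) + a M * e M z) = L (\<lambda>z. \<Sum>i<M. a i * e i z) + L (\<lambda>z. a M * e M z)"
      by (intro add invariant_space_sum[OF V] onb_in invariant_spaceD(4)[OF V]) auto
    then show ?case using Suc scale[OF onb_in] by simp
  qed
  define C where "C z = (\<Sum>i<N. e i z * L (e i))" for z
  have kV: "(\<lambda>w. \<Sum>i<N. e i z * e i w) \<in> V" for z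
    by (rule invariant_space_sum[OF V onb_in]) simp
  have C_L: "C z = L (\<lambda>w. \<Sum>i<N. e i z * e i w)" for z
    by (simp add: C_def lsum)
  have "C (act g z) = C z" if g: "rotation_matrix g" and z: "z \<in> setT" for g z
  proof -
    have "C (act g z) = L (\<lambda>w. \<Sum>i<N. e i (act g z) * e i (act g w))"
      unfolding C_L by (rule inv[OF kV g, symmetric])
    also have "\<dots> = L (\<lambda>w. \<Sum>i<N. e i z * e i w)"
      by (rule cong[OF invariant_spaceD(5)[OF V kV g] kV kernel_invariant[OF g z]])
    finally show ?thesis by (simp add: C_L)
  qed
  note C_inv = this
  obtain c where c: "\<And>z. z \<in> setT \<Longrightarrow> C z = c"
  proof (rule constant_on_setT[of C])
    show "C (act g z) = C z" if "rotation_matrix g" "z \<in> setT" for g z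
      using that by (rule C_inv)
  qed (rule that)
  show thesis
  proof (rule that)
    fix F assume F: "F \<in> V"
    have "L F = L (\<lambda>z. \<Sum>i<N. ip F (e i) * e i z)"
      by (rule cong[OF F invariant_space_sum[OF V onb_in] onb_expand[OF F]]) simp_all
    also have "\<dots> = (\<Sum>i<N. ip F (e i) * L (e i))"
      by (rule lsum) simp
    also have "\<dots> = (\<Sum>i<N. L (e i) * ip (e i) F)"
      by (intro sum.cong refl) (simp add: ip_commute[of F])
    also have "\<dots> = ip C F"
      by (rule ip_sum_left[symmetric]) (auto intro: V_cont onb_in F simp: C_def mult.commute)
    also have "\<dots> = (\<integral>z. c * F z \<partial>\<sigma>)"
      unfolding ip_def by (rule integral_cong_setT) (simp add: c)
    finally show "L F = c * (\<integral>z. F z \<partial>\<sigma>)" by simp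
  qed
qed

end

lemma biform_onb:
  obtains N e where "N \<le> card (bimonoms k :: 'n monom_xy set)" "orthonormal_basis (biform k) N e"
proof (rule orthonormal_basis_of_span[OF invariant_space_biform bimonoms_finite_card(1)])
  show "(\<lambda>z. eval_monom m (fst z) (snd z)) \<in> biform k" if "m \<in> bimonoms k" for m :: "'n monom_xy"
    using that by (rule biform_monom)
  show "\<exists>c. \<forall>z\<in>setT. F z = (\<Sum>m\<in>bimonoms k. c m * eval_monom m (fst z) (snd z))"
    if F: "F \<in> biform k" for F :: "(real^'n) \<times> (real^'n) \<Rightarrow> real"
    by (rule biform_expand[OF F]) auto
qed (rule that)

end

section \<open>Moments of orthonormal pairs\<close>

lemma norm_sq_coordinates: "(norm (x :: real^'m::finite))\<^sup>2 = (\<Sum>i\<in>UNIV. (x $ i)\<^sup>2)"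
  unfolding power2_norm_eq_inner inner_vec_def by (simp add: power2_eq_square)

lemma matrix_norm_rows: "(norm (A :: real^'n::finite^'m::finite))\<^sup>2 = (\<Sum>i\<in>UNIV. (norm (A $ i))\<^sup>2)"
  by (simp add: power2_norm_eq_inner inner_vec_def)

lemma matrix_norm_columns: "(norm (A :: real^'n^'n::finite))\<^sup>2 = (\<Sum>j\<in>UNIV. (norm (column j A))\<^sup>2)"
  unfolding matrix_norm_rows norm_sq_coordinates by (subst sum.swap) (simp add: column_def)

context stiefel
begin

lemma real_card_ge_3: "real CARD('n) \<ge> 3" using n3 by simp

lemma moment_unit:
  assumes v: "norm v = 1"
  shows "(\<integral>z. (fst z \<bullet> v) ^ p \<partial>\<sigma>) = (\<integral>z. (fst z $ k) ^ p \<partial>\<sigma>)"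
proof -
  obtain g :: "real^'n^'n" where g: "rotation_matrix g" "g *v axis k 1 = v"
    using rotation_matrix_exists_basis[OF _ v] n3 by (metis One_nat_def Suc_1 Suc_leD numeral_3_eq_3)
  then have og: "orthogonal_matrix g" by (simp add: rotation_matrix_def)
  have "(\<integral>z. (fst z \<bullet> v) ^ p \<partial>\<sigma>) = (\<integral>z. (fst (act g z) \<bullet> v) ^ p \<partial>\<sigma>)"
    by (rule integral_act[OF g(1), symmetric]) (intro continuous_measurable continuous_intros)
  also have "\<dots> = (\<integral>z. (fst z $ k) ^ p \<partial>\<sigma>)"
    by (simp add: act_def rotation_norm_inner[OF og] inner_axis flip: g(2))
  finally show ?thesis .
qed

lemma moment_homogeneous:
  "(\<integral>z. (fst z \<bullet> v) ^ p \<partial>\<sigma>) = norm v ^ p * (\<integral>z. (fst z $ k) ^ p \<partial>\<sigma>)"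
proof (cases "v = 0")
  case True
  then show ?thesis
    by (cases p) (auto simp: measure_setT)
next
  case False
  then have "fst z \<bullet> v = norm v * (fst z \<bullet> (v /\<^sub>R norm v))" for z :: "(real^'n) \<times> (real^'n)"
    by simp
  then have "(fst z \<bullet> v) ^ p = norm v ^ p * (fst z \<bullet> (v /\<^sub>R norm v)) ^ p" for z :: "(real^'n) \<times> (real^'n)"
    by (metis power_mult_distrib)
  then show ?thesis
    using moment_unit[of "v /\<^sub>R norm v" p k] False by simp
qed

lemma second_moment: "(\<integral>z. (fst z \<bullet> v)\<^sup>2 \<partial>\<sigma>) = (norm v)\<^sup>2 / real CARD('n)"
proof -
  fix k :: 'n
  let ?m = "\<integral>z. (fst z $ k)\<^sup>2 \<partial>\<sigma>"
  have "1 = (\<integral>z. (\<Sum>i\<in>UNIV. (fst z \<bullet> axis i 1)\<^sup>2) \<partial>\<sigma>)"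
    by (rule integral_const_setT[symmetric]) (auto simp: setT_iff inner_axis simp flip: norm_sq_coordinates)
  also have "\<dots> = (\<Sum>i\<in>UNIV. \<integral>z. (fst z \<bullet> axis i 1)\<^sup>2 \<partial>\<sigma>)"
    by (intro Bochner_Integration.integral_sum integrable_continuous continuous_intros)
  also have "\<dots> = real CARD('n) * ?m"
    using moment_homogeneous[of "axis _ 1" 2 k] by (simp add: norm_axis_1)
  finally have "?m = 1 / real CARD('n)" using real_card_ge_3 by (simp add: field_simps)
  then show ?thesis using moment_homogeneous[of v 2 k] by simp
qed

lemma integral_lincomb:
  assumes "continuous_on UNIV F" "continuous_on UNIV G"
  shows "(\<integral>z. a * F z + b * G z \<partial>\<sigma>) = a * (\<integral>z. F z \<partial>\<sigma>) + b * (\<integral>z. (G z :: real) \<partial>\<sigma>)"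
  using assms by (simp add: integrable_continuous)

text \<open>
  By rotation invariance the fourth moment of a linear form is a multiple \<open>\<kappa>\<close> of the fourth power of
  its length. Two polarizations turn this into the moment of four linear forms, and \<open>\<kappa>\<close> is then found
  from the fact that \<open>(\<Sum>i j. x\<^sub>i\<^sup>2 x\<^sub>j\<^sup>2) = 1\<close> on the sphere.
\<close>

lemma fourth_moment_polarized:
  fixes a b c d :: "real^'n"
  shows "(\<integral>z. (fst z \<bullet> a) * (fst z \<bullet> b) * (fst z \<bullet> c) * (fst z \<bullet> d) \<partial>\<sigma>) =
     ((a \<bullet> b) * (c \<bullet> d) + (a \<bullet> c) * (b \<bullet> d) + (a \<bullet> d) * (b \<bullet> c)) / (real CARD('n) * (real CARD('n) + 2))"
proof -
  fix k :: 'n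
  define \<kappa> where "\<kappa> = (\<integral>z. (fst z $ k) ^ 4 \<partial>\<sigma>)"
  have cont: "continuous_on UNIV (\<lambda>z :: (real^'n) \<times> (real^'n). (fst z \<bullet> v) ^ p)" for v p
    by (intro continuous_intros)
  have m4: "(\<integral>z. (fst z \<bullet> v) ^ 4 \<partial>\<sigma>) = \<kappa> * (v \<bullet> v)\<^sup>2" for v
    using moment_homogeneous[of v 4 k]
    by (simp add: \<kappa>_def power2_norm_eq_inner[symmetric] flip: power_mult)
  have m22: "(\<integral>z. (fst z \<bullet> v)\<^sup>2 * (fst z \<bullet> w)\<^sup>2 \<partial>\<sigma>) = \<kappa> / 3 * ((v \<bullet> v) * (w \<bullet> w) + 2 * (v \<bullet> w)\<^sup>2)" for v w
  proof -
    have "(\<integral>z. (fst z \<bullet> v)\<^sup>2 * (fst z \<bullet> w)\<^sup>2 \<partial>\<sigma>) =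
       (\<integral>z. 1 / 12 * (fst z \<bullet> (v + w)) ^ 4 + 1 / 12 * (fst z \<bullet> (v - w)) ^ 4 \<partial>\<sigma>)
       + (\<integral>z. - 1 / 6 * (fst z \<bullet> v) ^ 4 + - 1 / 6 * (fst z \<bullet> w) ^ 4 \<partial>\<sigma>)"
    proof (subst Bochner_Integration.integral_add[symmetric])
      show "(\<integral>z. (fst z \<bullet> v)\<^sup>2 * (fst z \<bullet> w)\<^sup>2 \<partial>\<sigma>) =
        (\<integral>z. 1 / 12 * (fst z \<bullet> (v + w)) ^ 4 + 1 / 12 * (fst z \<bullet> (v - w)) ^ 4
          + (- 1 / 6 * (fst z \<bullet> v) ^ 4 + - 1 / 6 * (fst z \<bullet> w) ^ 4) \<partial>\<sigma>)"
        by (intro integral_cong_setT) (simp add: inner_add_right inner_diff_right field_simps, algebra)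
    qed (intro integrable_continuous continuous_intros)+
    also have "\<dots> = \<kappa> / 12 * (((v + w) \<bullet> (v + w))\<^sup>2 + ((v - w) \<bullet> (v - w))\<^sup>2 - 2 * (v \<bullet> v)\<^sup>2 - 2 * (w \<bullet> w)\<^sup>2)"
      unfolding integral_lincomb[OF cont cont] m4 by (simp add: field_simps)
    also have "\<dots> = \<kappa> / 3 * ((v \<bullet> v) * (w \<bullet> w) + 2 * (v \<bullet> w)\<^sup>2)"
    proof -
      have "w \<bullet> v = v \<bullet> w" by (rule inner_commute)
      then show ?thesis
        by (simp add: inner_add_left inner_add_right inner_diff_left inner_diff_right field_simps power2_eq_square)
    qed
    finally show ?thesis .
  qed
  have M: "(\<integral>z. (fst z \<bullet> a) * (fst z \<bullet> b) * (fst z \<bullet> c) * (fst z \<bullet> d) \<partial>\<sigma>) =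
     \<kappa> / 3 * ((a \<bullet> b) * (c \<bullet> d) + (a \<bullet> c) * (b \<bullet> d) + (a \<bullet> d) * (b \<bullet> c))" for a b c d
  proof -
    have c22: "continuous_on UNIV (\<lambda>z :: (real^'n) \<times> (real^'n). (fst z \<bullet> v)\<^sup>2 * (fst z \<bullet> w)\<^sup>2)" for v w
      by (intro continuous_intros)
    have "(\<integral>z. (fst z \<bullet> a) * (fst z \<bullet> b) * (fst z \<bullet> c) * (fst z \<bullet> d) \<partial>\<sigma>) =
       (\<integral>z. 1 / 16 * ((fst z \<bullet> (a + b))\<^sup>2 * (fst z \<bullet> (c + d))\<^sup>2) + - 1 / 16 * ((fst z \<bullet> (a + b))\<^sup>2 * (fst z \<bullet> (c - d))\<^sup>2) \<partial>\<sigma>)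
       + (\<integral>z. - 1 / 16 * ((fst z \<bullet> (a - b))\<^sup>2 * (fst z \<bullet> (c + d))\<^sup>2) + 1 / 16 * ((fst z \<bullet> (a - b))\<^sup>2 * (fst z \<bullet> (c - d))\<^sup>2) \<partial>\<sigma>)"
    proof (subst Bochner_Integration.integral_add[symmetric])
      show "(\<integral>z. (fst z \<bullet> a) * (fst z \<bullet> b) * (fst z \<bullet> c) * (fst z \<bullet> d) \<partial>\<sigma>) =
         (\<integral>z. 1 / 16 * ((fst z \<bullet> (a + b))\<^sup>2 * (fst z \<bullet> (c + d))\<^sup>2) + - 1 / 16 * ((fst z \<bullet> (a + b))\<^sup>2 * (fst z \<bullet> (c - d))\<^sup>2)
         + (- 1 / 16 * ((fst z \<bullet> (a - b))\<^sup>2 * (fst z \<bullet> (c + d))\<^sup>2) + 1 / 16 * ((fst z \<bullet> (a - b))\<^sup>2 * (fst z \<bullet> (c - d))\<^sup>2)) \<partial>\<sigma>)"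
        by (intro integral_cong_setT) (simp add: inner_add_right inner_diff_right field_simps, algebra)
    qed (intro integrable_continuous continuous_intros)+
    also have "\<dots> = \<kappa> / 3 * ((a \<bullet> b) * (c \<bullet> d) + (a \<bullet> c) * (b \<bullet> d) + (a \<bullet> d) * (b \<bullet> c))"
      unfolding integral_lincomb[OF c22 c22] m22
      by (simp add: inner_add_left inner_add_right inner_diff_left inner_diff_right field_simps power2_eq_square
         inner_commute[of b a] inner_commute[of c a] inner_commute[of d a] inner_commute[of c b] inner_commute[of d b] inner_commute[of d c])
    finally show ?thesis .
  qed
  have "1 = (\<integral>z. (\<Sum>i\<in>UNIV. \<Sum>j\<in>UNIV. (fst z \<bullet> axis i 1)\<^sup>2 * (fst z \<bullet> axis j 1)\<^sup>2) \<partial>\<sigma>)"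
  proof (rule integral_const_setT[symmetric])
    fix z :: "(real^'n) \<times> (real^'n)" assume "z \<in> setT"
    then have "(\<Sum>i\<in>UNIV. (fst z \<bullet> axis i 1)\<^sup>2) = 1"
      by (simp add: setT_iff inner_axis flip: norm_sq_coordinates)
    then show "(\<Sum>i\<in>UNIV. \<Sum>j\<in>UNIV. (fst z \<bullet> axis i 1)\<^sup>2 * (fst z \<bullet> axis j 1)\<^sup>2) = 1"
      by (simp flip: sum_product)
  qed
  also have "\<dots> = (\<Sum>i\<in>UNIV. \<Sum>j\<in>UNIV. \<integral>z. (fst z \<bullet> axis i 1)\<^sup>2 * (fst z \<bullet> axis j 1)\<^sup>2 \<partial>\<sigma>)"
    by (subst Bochner_Integration.integral_sum, intro integrable_continuous continuous_intros)
       (intro sum.cong refl Bochner_Integration.integral_sum integrable_continuous continuous_intros)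
  also have "\<dots> = (\<Sum>i\<in>(UNIV :: 'n set). \<Sum>j\<in>UNIV. \<kappa> / 3 + (if i = j then 2 * \<kappa> / 3 else 0))"
    unfolding m22 by (intro sum.cong refl) (auto simp: inner_axis_axis)
  also have "\<dots> = \<kappa> / 3 * (real CARD('n) * (real CARD('n) + 2))"
    by (simp add: sum.distrib) (simp add: field_simps)
  finally have one: "\<kappa> / 3 * (real CARD('n) * (real CARD('n) + 2)) = 1" by simp
  have "real CARD('n) * (real CARD('n) + 2) \<noteq> 0" using real_card_ge_3 by simp
  then have "\<kappa> / 3 = 1 / (real CARD('n) * (real CARD('n) + 2))"
    using one by (rule nonzero_eq_divide_eq[THEN iffD2])
  then show ?thesis using M[of a b c d] by simp
qed

lemma fourth_moment: "(\<integral>z. (fst z \<bullet> v) ^ 4 \<partial>\<sigma>) = 3 * (norm v) ^ 4 / (real CARD('n) * (real CARD('n) + 2))"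
proof -
  have "(\<integral>z. (fst z \<bullet> v) ^ 4 \<partial>\<sigma>) = (\<integral>z. (fst z \<bullet> v) * (fst z \<bullet> v) * (fst z \<bullet> v) * (fst z \<bullet> v) \<partial>\<sigma>)"
    by (simp add: power4_eq_xxxx)
  also have "\<dots> = 3 * (norm v) ^ 4 / (real CARD('n) * (real CARD('n) + 2))"
    unfolding fourth_moment_polarized by (simp add: dot_square_norm flip: power_add)
  finally show ?thesis .
qed

lemma matrix_image_second_moment:
  fixes A :: "real^'n^'n"
  shows "(\<integral>z. (norm (transpose A *v fst z))\<^sup>2 \<partial>\<sigma>) = (norm A)\<^sup>2 / real CARD('n)"
proof -
  have *: "(norm (transpose A *v x))\<^sup>2 = (\<Sum>j\<in>UNIV. (x \<bullet> column j A)\<^sup>2)" for x :: "real^'n"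
    unfolding norm_sq_coordinates matrix_vector_mul_component row_def[symmetric]
    by (simp add: column_def transpose_def inner_commute)
  have "(\<integral>z. (norm (transpose A *v fst z))\<^sup>2 \<partial>\<sigma>) = (\<Sum>j\<in>UNIV. \<integral>z. (fst z \<bullet> column j A)\<^sup>2 \<partial>\<sigma>)"
    unfolding * by (intro Bochner_Integration.integral_sum integrable_continuous continuous_intros)
  then show ?thesis
    unfolding second_moment matrix_norm_columns sum_divide_distrib .
qed

lemma matrix_image_fourth_moment:
  fixes A :: "real^'n^'n"
  shows "(\<integral>z. (norm (transpose A *v fst z)) ^ 4 \<partial>\<sigma>) \<le> 3 * (norm A) ^ 4 / (real CARD('n) * (real CARD('n) + 2))"
proof -
  have *: "(norm (transpose A *v x)) ^ 4 = (\<Sum>j\<in>UNIV. \<Sum>k\<in>UNIV. (x \<bullet> column j A) * (x \<bullet> column j A) * (x \<bullet> column k A) * (x \<bullet> column k A))" for x :: "real^'n"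
  proof -
    have "(norm (transpose A *v x)) ^ 4 = ((norm (transpose A *v x))\<^sup>2)\<^sup>2" by simp
    also have "(norm (transpose A *v x))\<^sup>2 = (\<Sum>j\<in>UNIV. (x \<bullet> column j A)\<^sup>2)"
      unfolding norm_sq_coordinates matrix_vector_mul_component row_def[symmetric]
      by (simp add: column_def transpose_def inner_commute)
    finally show ?thesis by (simp add: power2_eq_square sum_product mult.assoc)
  qed
  have "(\<integral>z. (norm (transpose A *v fst z)) ^ 4 \<partial>\<sigma>) = (\<Sum>j\<in>UNIV. \<Sum>k\<in>UNIV. \<integral>z.
     (fst z \<bullet> column j A) * (fst z \<bullet> column j A) * (fst z \<bullet> column k A) * (fst z \<bullet> column k A) \<partial>\<sigma>)"
    unfolding *
    by (subst Bochner_Integration.integral_sum, intro integrable_continuous continuous_intros)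
       (intro sum.cong refl Bochner_Integration.integral_sum integrable_continuous continuous_intros)
  also have "\<dots> \<le> (\<Sum>j\<in>UNIV. \<Sum>k\<in>UNIV. 3 * ((norm (column j A))\<^sup>2 * (norm (column k A))\<^sup>2) / (real CARD('n) * (real CARD('n) + 2)))"
  proof (intro sum_mono)
    fix j k :: 'n
    have "(column j A \<bullet> column k A)\<^sup>2 \<le> (norm (column j A))\<^sup>2 * (norm (column k A))\<^sup>2"
      using Cauchy_Schwarz_ineq[of "column j A" "column k A"] by (simp add: power2_norm_eq_inner)
    then show "(\<integral>z. (fst z \<bullet> column j A) * (fst z \<bullet> column j A) * (fst z \<bullet> column k A) * (fst z \<bullet> column k A) \<partial>\<sigma>)
      \<le> 3 * ((norm (column j A))\<^sup>2 * (norm (column k A))\<^sup>2) / (real CARD('n) * (real CARD('n) + 2))"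
      unfolding fourth_moment_polarized
      by (intro divide_right_mono) (auto simp: dot_square_norm simp flip: power2_eq_square)
  qed
  also have "\<dots> = 3 * ((norm A)\<^sup>2 * (norm A)\<^sup>2) / (real CARD('n) * (real CARD('n) + 2))"
    unfolding matrix_norm_columns sum_product
    by (simp only: sum_divide_distrib[symmetric] sum_distrib_left[symmetric])
  finally show ?thesis by (simp flip: power_add)
qed

text \<open>
  Of the three pairings in the fourth moment, one gives the square of the trace, which vanishes, and
  the other two are each bounded by the squared Frobenius norm.
\<close>

lemma quadratic_second_moment:
  fixes A :: "real^'n^'n"
  assumes tr: "trace A = 0"
  shows "(\<integral>z. (fst z \<bullet> (A *v fst z))\<^sup>2 \<partial>\<sigma>) \<le> 2 * (norm A)\<^sup>2 / (real CARD('n) * (real CARD('n) + 2))"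
proof -
  have ax: "axis i (1::real) $ k = (if k = i then 1 else 0)" for i k :: 'n
    by (simp add: axis_def)
  have *: "(x \<bullet> (A *v x))\<^sup>2 = (\<Sum>i\<in>UNIV. \<Sum>k\<in>UNIV. (x \<bullet> axis i 1) * (x \<bullet> A $ i) * (x \<bullet> axis k 1) * (x \<bullet> A $ k))" for x :: "real^'n"
  proof -
    have "x \<bullet> (A *v x) = (\<Sum>i\<in>UNIV. (x \<bullet> axis i 1) * (x \<bullet> A $ i))"
      by (simp add: inner_vec_def[of x "A *v x"] matrix_vector_mul_component inner_axis inner_commute)
    then show ?thesis by (simp add: power2_eq_square sum_product mult.assoc)
  qed
  have "(\<integral>z. (fst z \<bullet> (A *v fst z))\<^sup>2 \<partial>\<sigma>) = (\<Sum>i\<in>UNIV. \<Sum>k\<in>UNIV. \<integral>z.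
     (fst z \<bullet> axis i 1) * (fst z \<bullet> A $ i) * (fst z \<bullet> axis k 1) * (fst z \<bullet> A $ k) \<partial>\<sigma>)"
    unfolding *
    by (subst Bochner_Integration.integral_sum, intro integrable_continuous continuous_intros)
       (intro sum.cong refl Bochner_Integration.integral_sum integrable_continuous continuous_intros)
  also have "\<dots> = (\<Sum>i\<in>UNIV. \<Sum>k\<in>UNIV. A $ i $ i * A $ k $ k + (if i = k then (norm (A $ i))\<^sup>2 else 0) + A $ k $ i * A $ i $ k) / (real CARD('n) * (real CARD('n) + 2))"
    unfolding fourth_moment_polarized sum_divide_distrib
    by (intro sum.cong refl arg_cong2[of _ _ _ _ "(/)"])
       (auto simp: inner_axis inner_axis' ax dot_square_norm)
  also have "\<dots> = ((norm A)\<^sup>2 + (\<Sum>i\<in>UNIV. \<Sum>k\<in>UNIV. A $ k $ i * A $ i $ k)) / (real CARD('n) * (real CARD('n) + 2))"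
  proof -
    have "(\<Sum>i\<in>UNIV. \<Sum>k\<in>UNIV. A $ i $ i * A $ k $ k) = trace A * trace A"
      by (simp add: trace_def sum_product)
    then show ?thesis using tr by (simp add: sum.distrib matrix_norm_rows)
  qed
  also have "\<dots> \<le> ((norm A)\<^sup>2 + (norm A)\<^sup>2) / (real CARD('n) * (real CARD('n) + 2))"
  proof (intro divide_right_mono add_left_mono)
    have "(\<Sum>i\<in>UNIV. \<Sum>k\<in>UNIV. A $ k $ i * A $ i $ k) \<le> (\<Sum>i\<in>UNIV. \<Sum>k\<in>UNIV. ((A $ k $ i)\<^sup>2 + (A $ i $ k)\<^sup>2) / 2)"
    proof (intro sum_mono)
      fix i k
      show "A $ k $ i * A $ i $ k \<le> ((A $ k $ i)\<^sup>2 + (A $ i $ k)\<^sup>2) / 2"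
        using sum_squares_bound[of "A $ k $ i" "A $ i $ k"] by simp
    qed
    also have "\<dots> = ((\<Sum>i\<in>UNIV. \<Sum>k\<in>UNIV. (A $ k $ i)\<^sup>2) + (\<Sum>i\<in>UNIV. \<Sum>k\<in>UNIV. (A $ i $ k)\<^sup>2)) / 2"
      by (simp add: sum.distrib flip: sum_divide_distrib)
    also have "(\<Sum>i\<in>UNIV. \<Sum>k\<in>UNIV. (A $ k $ i)\<^sup>2) = (norm A)\<^sup>2"
      by (subst sum.swap) (simp add: matrix_norm_rows norm_sq_coordinates)
    also have "(\<Sum>i\<in>UNIV. \<Sum>k\<in>UNIV. (A $ i $ k)\<^sup>2) = (norm A)\<^sup>2"
      by (simp add: matrix_norm_rows norm_sq_coordinates)
    finally show "(\<Sum>i\<in>UNIV. \<Sum>k\<in>UNIV. A $ k $ i * A $ i $ k) \<le> (norm A)\<^sup>2" by simp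
  qed auto
  finally show ?thesis by simp
qed

end

section \<open>Resampling the second vector\<close>

text \<open>
  For a unit vector \<open>x\<close> this is the component of \<open>v\<close> orthogonal to \<open>x\<close>.
\<close>

definition proj :: "real^'n \<Rightarrow> real^'n \<Rightarrow> real^'n::finite" where
  "proj x v = v - (x \<bullet> v) *\<^sub>R x"

lemma proj_orthogonal: "norm x = 1 \<Longrightarrow> x \<bullet> proj x v = 0"
  by (simp add: proj_def inner_diff_right dot_square_norm)

lemma norm_proj: "norm x = 1 \<Longrightarrow> (norm (proj x v))\<^sup>2 = (norm v)\<^sup>2 - (x \<bullet> v)\<^sup>2"
proof -
  assume "norm x = 1"
  then have "x \<bullet> x = 1" by (simp add: dot_square_norm)
  then show ?thesis
    unfolding power2_norm_eq_inner proj_def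
    by (simp add: inner_diff_left inner_diff_right inner_commute[of v x] power2_eq_square)
qed

lemma inner_proj_swap: "w \<bullet> proj x v = v \<bullet> proj x w"
  by (simp add: proj_def inner_diff_right inner_commute)

context stiefel
begin

lemma sigma_pair: "pair_sigma_finite \<sigma> \<sigma>"
  by (simp add: pair_sigma_finite_def sigma_finite_measure_axioms)

lemma pair_integrable:
  fixes H :: "((real^'n) \<times> (real^'n)) \<times> ((real^'n) \<times> (real^'n)) \<Rightarrow> real"
  assumes H: "continuous_on UNIV H"
  shows "integrable (\<sigma> \<Otimes>\<^sub>M \<sigma>) H"
proof -
  interpret P: pair_sigma_finite \<sigma> \<sigma> by (rule sigma_pair)
  have "(\<lambda>p. (fst p, snd p)) \<in> measurable (\<sigma> \<Otimes>\<^sub>M \<sigma>) (borel \<Otimes>\<^sub>M borel)"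
    by (intro measurable_Pair measurable_compose[OF measurable_fst] measurable_compose[OF measurable_snd]
        measurable_sigma measurable_ident_sets[OF refl])
  then have "(\<lambda>p. p) \<in> measurable (\<sigma> \<Otimes>\<^sub>M \<sigma>) borel" by (simp add: borel_prod)
  then have meas: "H \<in> borel_measurable (\<sigma> \<Otimes>\<^sub>M \<sigma>)"
    by (rule measurable_compose[OF _ borel_measurable_continuous_onI[OF H]])
  have "compact (H ` (setT \<times> setT))"
    by (intro compact_continuous_image compact_Times compact_setT continuous_on_subset[OF H]) auto
  then obtain B where B: "\<forall>v\<in>H ` (setT \<times> setT). norm v \<le> B"
    using compact_imp_bounded bounded_iff by metis
  have "emeasure (\<sigma> \<Otimes>\<^sub>M \<sigma>) (setT \<times> setT) = 1"
    using emeasure_pair_measure_Times[of setT \<sigma> setT] sets.top[of \<sigma>] by (simp add: emeasure_setT)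
  then have "finite_measure (\<sigma> \<Otimes>\<^sub>M \<sigma>)"
    by (intro finite_measureI) (simp add: space_pair_measure)
  then show ?thesis
    using meas B by (intro finite_measure.integrable_const_bound[of _ _ B]) (auto simp: space_pair_measure)
qed

text \<open>
  The conditional law of \<open>y\<close> given \<open>x\<close> is not directly accessible. Here \<open>y\<close> is replaced by the part
  orthogonal to \<open>x\<close> of the first vector \<open>x'\<close> of an independent pair. The result is again an invariant
  functional on forms, hence proportional to the integral, and for fixed \<open>x\<close> the inner integral is
  a moment of a linear form in \<open>x'\<close>.
\<close>

definition resample :: "((real^'n) \<times> (real^'n) \<Rightarrow> real) \<Rightarrow> real" where
  "resample F = (\<integral>z. (\<integral>z'. F (fst z, proj (fst z) (fst z')) \<partial>\<sigma>) \<partial>\<sigma>)"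

lemma proj_continuous:
  fixes F :: "(real^'n) \<times> (real^'n) \<Rightarrow> real"
  assumes "continuous_on UNIV F"
  shows "continuous_on UNIV (\<lambda>p :: ((real^'n) \<times> (real^'n)) \<times> ((real^'n) \<times> (real^'n)).
     F (fst (fst p), proj (fst (fst p)) (fst (snd p))))"
  unfolding proj_def
  by (rule continuous_on_compose2[OF assms]) (intro continuous_intros, auto)

lemma resample_pair:
  assumes F: "continuous_on UNIV F"
  shows "resample F = (\<integral>p. F (fst (fst p), proj (fst (fst p)) (fst (snd p))) \<partial>(\<sigma> \<Otimes>\<^sub>M \<sigma>))"
  unfolding resample_def
  using pair_sigma_finite.integral_fst'[OF sigma_pair pair_integrable[OF proj_continuous[OF F]]] by simp

lemma resample_outer_integrable:
  fixes F :: "(real^'n) \<times> (real^'n) \<Rightarrow> real"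
  assumes F: "continuous_on UNIV F"
  shows "integrable \<sigma> (\<lambda>z. \<integral>z'. F (fst z, proj (fst z) (fst z')) \<partial>\<sigma>)"
  using pair_sigma_finite.integrable_fst'[OF sigma_pair pair_integrable[OF proj_continuous[OF F]]] by simp

lemma resample_add:
  "continuous_on UNIV F \<Longrightarrow> continuous_on UNIV G \<Longrightarrow> resample (\<lambda>z. F z + G z) = resample F + resample G"
  by (simp add: resample_pair continuous_on_add pair_integrable proj_continuous)

lemma resample_scale: "resample (\<lambda>z. c * F z) = c * resample F"
  by (simp add: resample_def)

lemma biform_zero_snd:
  assumes "F \<in> biform k" "k > 0" shows "F (x, 0) = 0"
  using biform_scaleR[OF assms(1), of 1 x 0 0] assms(2) by (simp add: power_0_left)

text \<open>
  The vector that replaces \<open>y\<close> need not have length one, but a bihomogeneous function is determined on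
  the whole variety by its values on \<open>T\<close>. A positive degree is needed when this vector vanishes.
\<close>

lemma resample_cong:
  assumes F: "F \<in> biform k" and G: "G \<in> biform k" and k: "k > 0"
    and eq: "\<And>z. z \<in> setT \<Longrightarrow> F z = G z"
  shows "resample F = resample G"
  unfolding resample_def
proof (intro integral_cong_setT)
  fix z z' :: "(real^'n) \<times> (real^'n)"
  assume z: "z \<in> setT"
  let ?p = "proj (fst z) (fst z')"
  have x: "norm (fst z) = 1" using z by (simp add: setT_iff)
  show "F (fst z, ?p) = G (fst z, ?p)"
  proof (cases "?p = 0")
    case True
    then show ?thesis using biform_zero_snd[OF F k] biform_zero_snd[OF G k] by simp
  next
    case False
    have sc: "H (fst z, ?p) = norm ?p ^ k * H (fst z, ?p /\<^sub>R norm ?p)" if "H \<in> biform k" for H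
      using biform_scaleR[OF that, of 1 "fst z" "norm ?p" "?p /\<^sub>R norm ?p"] False by simp
    have "(fst z, ?p /\<^sub>R norm ?p) \<in> setT"
      using False x proj_orthogonal[OF x] by (simp add: setT_iff)
    then show ?thesis using sc[OF F] sc[OF G] eq by simp
  qed
qed

lemma proj_rotation: "orthogonal_matrix g \<Longrightarrow> g *v proj x v = proj (g *v x) (g *v v)"
  for g :: "real^'n^'n"
  by (simp add: proj_def rotation_norm_inner matrix_vector_mult_diff_distrib matrix_vector_mult_scaleR)

lemma resample_act:
  assumes F: "continuous_on UNIV F" and g: "rotation_matrix g"
  shows "resample (\<lambda>z. F (act g z)) = resample F"
proof -
  have og: "orthogonal_matrix g" using g by (simp add: rotation_matrix_def)
  have "resample (\<lambda>z. F (act g z)) =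
      (\<integral>z. (\<integral>z'. F (fst (act g z), proj (fst (act g z)) (fst (act g z'))) \<partial>\<sigma>) \<partial>\<sigma>)"
    unfolding resample_def by (simp add: act_def proj_rotation[OF og])
  also have "\<dots> = (\<integral>z. (\<integral>z'. F (fst (act g z), proj (fst (act g z)) (fst z')) \<partial>\<sigma>) \<partial>\<sigma>)"
  proof (rule integral_cong_setT, rule integral_act[OF g], rule continuous_measurable)
    fix z :: "(real^'n) \<times> (real^'n)"
    show "continuous_on UNIV (\<lambda>z' :: (real^'n) \<times> (real^'n). F (fst (act g z), proj (fst (act g z)) (fst z')))"
      unfolding proj_def by (rule continuous_on_compose2[OF F]) (intro continuous_intros, auto)
  qed
  also have "\<dots> = resample F"
    unfolding resample_def
    by (rule integral_act[OF g]) (rule borel_measurable_integrable[OF resample_outer_integrable[OF F]])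
  finally show ?thesis .
qed

lemma resample_eq:
  assumes k: "k > 0"
  obtains c where "\<And>F. F \<in> biform k \<Longrightarrow> resample F = c * (\<integral>z. F z \<partial>\<sigma>)"
proof -
  obtain N e where onb: "orthonormal_basis (biform k) N e" by (rule biform_onb)
  show thesis
  proof (rule invariant_functional_unique[OF invariant_space_biform onb, where L = resample])
    fix F G :: "(real^'n) \<times> (real^'n) \<Rightarrow> real"
    assume "F \<in> biform k" "G \<in> biform k" "\<And>z. z \<in> setT \<Longrightarrow> F z = G z"
    then show "resample F = resample G"
      using resample_cong[OF _ _ k] by blast
  qed (auto intro: resample_add resample_scale resample_act continuous_on_biform that)
qed

text \<open>
  The factor of proportionality is read off from the form \<open>(\<bar>x\<bar>\<^sup>2 \<bar>y\<bar>\<^sup>2)\<^sup>j\<close>, which is \<open>1\<close> on \<open>T\<close>.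
\<close>

lemma resample_normalized:
  assumes F: "F \<in> biform (2 * j)" and j: "j > 0"
  shows "resample F = resample (\<lambda>z. (norm (fst z) ^ 2 * norm (snd z) ^ 2) ^ j) * (\<integral>z. F z \<partial>\<sigma>)"
proof -
  obtain c where c: "\<And>F. F \<in> biform (2 * j) \<Longrightarrow> resample F = c * (\<integral>z. F z \<partial>\<sigma>)"
    using resample_eq[of "2 * j"] j by auto
  have "(\<lambda>z. (norm (fst z) ^ 2 * norm (snd z) ^ 2) ^ j) \<in> (biform (2 * j) :: ((real^'n) \<times> (real^'n) \<Rightarrow> real) set)"
    using biform_power[OF biform_normsq, of j] by (simp add: mult.commute)
  then have "resample (\<lambda>z. (norm (fst z) ^ 2 * norm (snd z) ^ 2) ^ j) =
      c * (\<integral>z. (norm (fst z) ^ 2 * norm (snd z) ^ 2) ^ j \<partial>\<sigma>)" by (rule c)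
  also have "(\<integral>z. (norm (fst z) ^ 2 * norm (snd z) ^ 2) ^ j \<partial>\<sigma>) = 1"
    by (rule integral_const_setT) (simp add: setT_iff)
  finally show ?thesis using c[OF F] by simp
qed

lemma resample_const_2:
  "resample (\<lambda>z. (norm (fst z) ^ 2 * norm (snd z) ^ 2) ^ 1) = 1 - 1 / real CARD('n)"
proof -
  have "(\<integral>z'. (norm (fst z) ^ 2 * norm (proj (fst z) (fst z')) ^ 2) ^ 1 \<partial>\<sigma>) = 1 - 1 / real CARD('n)"
    if z: "z \<in> setT" for z
  proof -
    have x: "norm (fst z) = 1" using z by (simp add: setT_iff)
    have "(\<integral>z'. (norm (fst z) ^ 2 * norm (proj (fst z) (fst z')) ^ 2) ^ 1 \<partial>\<sigma>) =
        (\<integral>z'. 1 - (fst z' \<bullet> fst z)\<^sup>2 \<partial>\<sigma>)"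
      by (rule integral_cong_setT) (simp add: norm_proj x setT_iff inner_commute)
    also have "\<dots> = (\<integral>z'. 1 \<partial>\<sigma>) - (\<integral>z'. (fst z' \<bullet> fst z)\<^sup>2 \<partial>\<sigma>)"
      by (intro Bochner_Integration.integral_diff integrable_continuous continuous_intros)
    finally show ?thesis by (simp add: second_moment x measure_setT)
  qed
  then show ?thesis
    unfolding resample_def fst_conv snd_conv by (rule integral_const_setT)
qed

lemma resample_const_4:
  "resample (\<lambda>z. (norm (fst z) ^ 2 * norm (snd z) ^ 2) ^ 2) =
     1 - 2 / real CARD('n) + 3 / (real CARD('n) * (real CARD('n) + 2))"
proof -
  have "(\<integral>z'. (norm (fst z) ^ 2 * norm (proj (fst z) (fst z')) ^ 2) ^ 2 \<partial>\<sigma>) =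
     1 - 2 / real CARD('n) + 3 / (real CARD('n) * (real CARD('n) + 2))"
    if z: "z \<in> setT" for z
  proof -
    have x: "norm (fst z) = 1" using z by (simp add: setT_iff)
    have "(\<integral>z'. (norm (fst z) ^ 2 * norm (proj (fst z) (fst z')) ^ 2) ^ 2 \<partial>\<sigma>) =
        (\<integral>z'. 1 + (-2 * (fst z' \<bullet> fst z)\<^sup>2 + 1 * (fst z' \<bullet> fst z) ^ 4) \<partial>\<sigma>)"
      by (rule integral_cong_setT) (simp add: norm_proj x setT_iff inner_commute power2_diff)
    also have "\<dots> = (\<integral>z'. 1 \<partial>\<sigma>) + (\<integral>z'. -2 * (fst z' \<bullet> fst z)\<^sup>2 + 1 * (fst z' \<bullet> fst z) ^ 4 \<partial>\<sigma>)"
      by (intro Bochner_Integration.integral_add integrable_continuous continuous_intros)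
    also have "\<dots> = 1 + (-2 * (\<integral>z'. (fst z' \<bullet> fst z)\<^sup>2 \<partial>\<sigma>) + 1 * (\<integral>z'. (fst z' \<bullet> fst z) ^ 4 \<partial>\<sigma>))"
      by (subst integral_lincomb) (auto intro!: continuous_intros simp: measure_setT)
    finally show ?thesis by (simp add: second_moment fourth_moment x)
  qed
  then show ?thesis
    unfolding resample_def fst_conv snd_conv by (rule integral_const_setT)
qed

section \<open>Bilinear forms on orthonormal pairs\<close>

lemma bilin_proj:
  "bilin A (x, proj x v) = v \<bullet> proj x (transpose A *v x)"
  for A :: "real^'n^'n"
proof -
  have "bilin A (x, proj x v) = (transpose A *v x) \<bullet> proj x v"
    by (simp add: bilin_def dot_lmul_matrix)
  then show ?thesis by (simp add: inner_proj_swap)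
qed

lemma resample_bilin:
  "resample (\<lambda>z. bilin A z ^ p) = (\<integral>z. (\<integral>z'. (fst z' \<bullet> proj (fst z) (transpose A *v fst z)) ^ p \<partial>\<sigma>) \<partial>\<sigma>)"
  unfolding resample_def bilin_proj ..

text \<open>
  Resampling gives \<open>(\<bar>A\<^sup>T x\<bar>\<^sup>2 - (x \<bullet> A x)\<^sup>2) / n\<close> for fixed \<open>x\<close>. The trace has to vanish since the identity
  matrix is the zero function on orthogonal pairs.
\<close>

lemma bilin_second_moment:
  fixes A :: "real^'n^'n"
  assumes tr: "trace A = 0"
  shows "(norm A)\<^sup>2 \<le> (real CARD('n) - 1) * (real CARD('n) + 2) * (\<integral>z. (bilin A z)\<^sup>2 \<partial>\<sigma>)"
proof -
  let ?n = "real CARD('n)" and ?I = "\<integral>z. (bilin A z)\<^sup>2 \<partial>\<sigma>"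
  have n: "?n \<ge> 3" by (rule real_card_ge_3)
  have "(1 - 1 / ?n) * ?I = resample (\<lambda>z. bilin A z ^ 2)"
    using resample_normalized[of "\<lambda>z. bilin A z ^ 2" 1] biform_power[OF biform_bilin, of A 2]
    by (simp add: resample_const_2[simplified])
  also have "\<dots> = (\<integral>z. 1 / ?n * (norm (transpose A *v fst z))\<^sup>2 + - 1 / ?n * (fst z \<bullet> (A *v fst z))\<^sup>2 \<partial>\<sigma>)"
    unfolding resample_bilin second_moment
    by (rule integral_cong_setT)
       (simp add: norm_proj setT_iff diff_divide_distrib dot_lmul_matrix
         inner_commute[of "fst _" "fst _ v* A"])
  also have "\<dots> = 1 / ?n * (\<integral>z. (norm (transpose A *v fst z))\<^sup>2 \<partial>\<sigma>) + - 1 / ?n * (\<integral>z. (fst z \<bullet> (A *v fst z))\<^sup>2 \<partial>\<sigma>)"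
    by (rule integral_lincomb)
       (intro continuous_intros bounded_linear.continuous_on[OF matrix_vector_mul_bounded_linear])+
  also have "\<dots> \<ge> 1 / ?n * ((norm A)\<^sup>2 / ?n) + - 1 / ?n * (2 * (norm A)\<^sup>2 / (?n * (?n + 2)))"
    unfolding matrix_image_second_moment
    using quadratic_second_moment[OF tr] n by (intro add_left_mono mult_left_mono_neg) auto
  also have "1 / ?n * ((norm A)\<^sup>2 / ?n) + - 1 / ?n * (2 * (norm A)\<^sup>2 / (?n * (?n + 2))) = (norm A)\<^sup>2 / (?n * (?n + 2))"
    using n by (simp add: divide_simps power2_eq_square) (simp add: algebra_simps)
  finally have "(norm A)\<^sup>2 / (?n * (?n + 2)) \<le> (1 - 1 / ?n) * ?I" .
  then have "(norm A)\<^sup>2 \<le> (1 - 1 / ?n) * ?I * (?n * (?n + 2))"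
    using n by (simp add: pos_divide_le_eq)
  also have "\<dots> = (?n - 1) * (?n + 2) * ?I"
    using n by (simp add: field_simps)
  finally show ?thesis .
qed

text \<open>
  Resampling makes the form linear in an independent unit vector, for which the fourth moment is about
  three times the square of the second, and the mean over \<open>x\<close> of \<open>\<bar>A\<^sup>T x\<bar>\<^sup>4\<close> costs another factor of three:
  the constant \<open>9\<close> is the one for a bilinear form in independent Gaussian vectors.
\<close>

lemma bilin_fourth_moment:
  fixes A :: "real^'n^'n"
  shows "((real CARD('n) - 1) * (real CARD('n) + 2))\<^sup>2 * (\<integral>z. bilin A z ^ 4 \<partial>\<sigma>) \<le> 9 * norm A ^ 4"
proof -
  let ?n = "real CARD('n)" and ?I = "\<integral>z. bilin A z ^ 4 \<partial>\<sigma>"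
  have n: "?n \<ge> 3" by (rule real_card_ge_3)
  let ?K = "?n * (?n + 2)"
  have I0: "?I \<ge> 0" by simp
  have outer: "(\<integral>z'. (fst z' \<bullet> proj (fst z) (transpose A *v fst z)) ^ 4 \<partial>\<sigma>) \<le> 3 / ?K * norm (transpose A *v fst z) ^ 4"
    if z: "z \<in> setT" for z
  proof -
    have x: "norm (fst z) = 1" using z by (simp add: setT_iff)
    have "(norm (proj (fst z) (transpose A *v fst z)))\<^sup>2 \<le> (norm (transpose A *v fst z))\<^sup>2"
      by (simp add: norm_proj[OF x])
    then have "((norm (proj (fst z) (transpose A *v fst z)))\<^sup>2)\<^sup>2 \<le> ((norm (transpose A *v fst z))\<^sup>2)\<^sup>2"
      by (rule power_mono) simp
    then have "norm (proj (fst z) (transpose A *v fst z)) ^ 4 \<le> norm (transpose A *v fst z) ^ 4"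
      by (simp flip: power_mult)
    then show ?thesis
      unfolding fourth_moment using n by (simp add: divide_right_mono)
  qed
  have cont: "continuous_on UNIV (\<lambda>z :: (real^'n) \<times> (real^'n). 3 / ?K * norm (transpose A *v fst z) ^ 4)"
    by (intro continuous_intros bounded_linear.continuous_on[OF matrix_vector_mul_bounded_linear])
  have "(1 - 2 / ?n + 3 / ?K) * ?I = resample (\<lambda>z. bilin A z ^ 4)"
    using resample_normalized[of "\<lambda>z. bilin A z ^ 4" 2] biform_power[OF biform_bilin, of A 4]
    by (simp add: resample_const_4)
  also have "\<dots> \<le> (\<integral>z. 3 / ?K * norm (transpose A *v fst z) ^ 4 \<partial>\<sigma>)"
    unfolding resample_bilin
  proof (rule Bochner_Integration.integral_mono)
    show "integrable \<sigma> (\<lambda>z. \<integral>z'. (fst z' \<bullet> proj (fst z) (transpose A *v fst z)) ^ 4 \<partial>\<sigma>)"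
      using resample_outer_integrable[OF continuous_on_power[OF continuous_on_biform[OF biform_bilin]], of A 4]
      by (simp add: bilin_proj del: transpose_matrix_vector)
    show "integrable \<sigma> (\<lambda>z. 3 / ?K * norm (transpose A *v fst z) ^ 4)"
      by (rule integrable_continuous[OF cont])
  qed (use outer in auto)
  also have "\<dots> = 3 / ?K * (\<integral>z. norm (transpose A *v fst z) ^ 4 \<partial>\<sigma>)" by simp
  also have "\<dots> \<le> 3 / ?K * (3 * norm A ^ 4 / ?K)"
    using n by (intro mult_left_mono matrix_image_fourth_moment) auto
  finally have "(1 - 2 / ?n + 3 / ?K) * ?I \<le> 9 * norm A ^ 4 / ?K\<^sup>2"
    by (simp add: power2_eq_square)
  then have "(1 - 2 / ?n + 3 / ?K) * ?I * ?K\<^sup>2 \<le> 9 * norm A ^ 4"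
    using n by (subst (asm) pos_le_divide_eq) auto
  moreover have "(1 - 2 / ?n + 3 / ?K) * ?K\<^sup>2 = (?n - 1) * (?n + 1) * ?K"
    using n by (simp add: divide_simps power2_eq_square) (simp add: algebra_simps)
  moreover have "((?n - 1) * (?n + 2))\<^sup>2 * ?I \<le> (?n - 1) * (?n + 1) * ?K * ?I"
  proof (rule mult_right_mono[OF _ I0])
    have "(?n - 1) * (?n + 2) * ((?n - 1) * (?n + 2)) \<le> (?n - 1) * (?n + 2) * ((?n + 1) * ?n)"
      using n by (intro mult_left_mono mult_nonneg_nonneg) (simp_all add: algebra_simps)
    then show "((?n - 1) * (?n + 2))\<^sup>2 \<le> (?n - 1) * (?n + 1) * ?K"
      by (simp add: power2_eq_square mult_ac)
  qed
  ultimately show ?thesis by (simp add: mult_ac)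
qed

end

section \<open>Covering convex hulls by balls\<close>

text \<open>
  The balls of radius \<open>\<delta> \<rho> / 2\<close> around the points are disjoint and lie in a ball of radius
  \<open>(1 + \<delta> / 2) \<rho>\<close>.
\<close>

lemma separated_card_le:
  fixes F :: "'a::euclidean_space set"
  assumes \<rho>: "\<rho> > 0" and \<delta>: "\<delta> > 0" and F: "finite F" "F \<subseteq> cball 0 \<rho>"
    and sep: "\<And>x y. x \<in> F \<Longrightarrow> y \<in> F \<Longrightarrow> x \<noteq> y \<Longrightarrow> dist x y > \<delta> * \<rho>"
  shows "real (card F) \<le> (1 + 2 / \<delta>) ^ DIM('a)"
proof -
  define r where "r = \<delta> * \<rho> / 2"
  have r: "r > 0" using \<rho> \<delta> by (simp add: r_def)
  let ?v = "unit_ball_vol (real DIM('a))"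
  have v: "?v > 0" by simp
  have disj: "disjoint_family_on (\<lambda>y. ball y r) F"
    unfolding disjoint_family_on_def
  proof (intro ballI impI)
    fix x y assume xy: "x \<in> F" "y \<in> F" "x \<noteq> y"
    then have "dist x y > 2 * r" using sep[OF xy] by (simp add: r_def)
    then have "\<not> (dist x z < r \<and> dist y z < r)" for z
      using dist_triangle2[of x y z] by linarith
    then show "ball x r \<inter> ball y r = {}" by auto
  qed
  have "real (card F) * (?v * r ^ DIM('a)) = (\<Sum>y\<in>F. measure lborel (ball y r))"
    using r by (simp add: content_ball)
  also have "\<dots> = measure lborel (\<Union>y\<in>F. ball y r)"
    using F(1) disj emeasure_lborel_ball_finite
    by (intro measure_finite_Union[symmetric]) (auto simp: less_top[symmetric])
  also have "\<dots> \<le> measure lborel (cball (0::'a) (\<rho> + r))"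
  proof (rule measure_mono_fmeasurable)
    show "(\<Union>y\<in>F. ball y r) \<subseteq> cball 0 (\<rho> + r)"
    proof
      fix z assume "z \<in> (\<Union>y\<in>F. ball y r)"
      then obtain y where "y \<in> F" "dist y z < r" by auto
      then show "z \<in> cball 0 (\<rho> + r)"
        using F(2) dist_triangle[of 0 z y] by (force simp: dist_commute)
    qed
    show "(\<Union>y\<in>F. ball y r) \<in> sets lborel"
      using F(1) by (intro sets.finite_UN) auto
    show "cball (0::'a) (\<rho> + r) \<in> fmeasurable lborel"
      using emeasure_lborel_cball_finite[of "0::'a" "\<rho> + r"] by (intro fmeasurableI) auto
  qed
  also have "\<dots> = ?v * (\<rho> + r) ^ DIM('a)"
    using \<rho> r by (simp add: content_cball)
  finally have "real (card F) * r ^ DIM('a) \<le> (\<rho> + r) ^ DIM('a)"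
    using v by (simp add: mult.left_commute)
  then have "real (card F) \<le> ((\<rho> + r) / r) ^ DIM('a)"
    using r by (simp add: power_divide pos_le_divide_eq)
  also have "(\<rho> + r) / r = 1 + 2 / \<delta>"
    using \<rho> \<delta> by (simp add: r_def field_simps)
  finally show ?thesis .
qed

text \<open>
  A separated set of maximal cardinality is a net, since any uncovered point could be added to it.
\<close>

lemma ball_net:
  fixes \<rho> \<delta> :: real
  assumes \<rho>: "\<rho> > 0" and \<delta>: "\<delta> > 0"
  obtains F :: "'a::euclidean_space set" where "finite F" "F \<subseteq> cball 0 \<rho>"
    "real (card F) \<le> (1 + 2 / \<delta>) ^ DIM('a)"
    "\<And>x. x \<in> cball 0 \<rho> \<Longrightarrow> \<exists>y\<in>F. dist x y \<le> \<delta> * \<rho>"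
proof -
  define P where "P F \<longleftrightarrow> finite F \<and> F \<subseteq> cball 0 \<rho> \<and>
    (\<forall>x\<in>F. \<forall>y\<in>F. x \<noteq> y \<longrightarrow> dist x y > \<delta> * \<rho>)" for F :: "'a set"
  have bound: "real (card F) \<le> (1 + 2 / \<delta>) ^ DIM('a)" if "P F" for F :: "'a set"
    using that separated_card_le[OF \<rho> \<delta>, of F] by (auto simp: P_def)
  then have "\<forall>F :: 'a set. P F \<longrightarrow> card F < Suc (nat \<lfloor>(1 + 2 / \<delta>) ^ DIM('a)\<rfloor>)"
    by (simp add: le_nat_floor less_Suc_eq_le)
  moreover have "P {}" by (simp add: P_def)
  ultimately obtain F :: "'a set" where F: "P F" and max: "\<And>G. P G \<Longrightarrow> card G \<le> card F"
    using ex_has_greatest_nat[of P "{}" card] by metis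
  show thesis
  proof (rule that[of F])
    show "finite F" "F \<subseteq> cball 0 \<rho>" using F by (auto simp: P_def)
    show "real (card F) \<le> (1 + 2 / \<delta>) ^ DIM('a)" by (rule bound[OF F])
    fix x :: 'a assume x: "x \<in> cball 0 \<rho>"
    show "\<exists>y\<in>F. dist x y \<le> \<delta> * \<rho>"
    proof (rule ccontr)
      assume "\<not> ?thesis"
      then have far: "\<And>y. y \<in> F \<Longrightarrow> dist x y > \<delta> * \<rho>" by (auto simp: not_le)
      then have "x \<notin> F" using far[of x] mult_pos_pos[OF \<delta> \<rho>] by auto
      have "P (insert x F)"
        using F x far by (auto simp: P_def dist_commute)
      from max[OF this] show False using \<open>x \<notin> F\<close> F by (simp add: P_def)
    qed
  qed
qed

text \<open>
  Otherwise a hyperplane with normal \<open>a\<close> separates \<open>x\<close> from the hull. The point of the sphere farthest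
  in the direction opposite to \<open>a\<close> has a point of the net nearby, and this one lies on the wrong side.
\<close>

lemma net_hull_contains_ball:
  fixes F :: "'a::euclidean_space set"
  assumes \<rho>: "\<rho> > 0" and F: "finite F"
    and net: "\<And>x. x \<in> cball 0 \<rho> \<Longrightarrow> \<exists>y\<in>F. dist x y \<le> \<delta> * \<rho>"
    and x: "norm x \<le> (1 - \<delta>) * \<rho>"
  shows "x \<in> convex hull F"
proof (rule ccontr)
  assume "x \<notin> convex hull F"
  moreover have "closed (convex hull F)"
    by (intro compact_imp_closed finite_imp_compact_convex_hull F)
  ultimately obtain a b where ab: "a \<bullet> x < b" "\<And>y. y \<in> convex hull F \<Longrightarrow> b < a \<bullet> y"
    using separating_hyperplane_closed_point[of "convex hull F" x] convex_convex_hull by blast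
  define u where "u = - (\<rho> *\<^sub>R sgn a)"
  have "u \<in> cball 0 \<rho>" using \<rho> by (simp add: u_def norm_sgn)
  then obtain y where y: "y \<in> F" "dist u y \<le> \<delta> * \<rho>" using net by blast
  have "a \<bullet> y = a \<bullet> u + a \<bullet> (y - u)" by (simp add: inner_diff_right)
  also have "a \<bullet> u = - (\<rho> * norm a)"
    by (cases "a = 0") (simp_all add: u_def sgn_div_norm dot_square_norm power2_eq_square)
  also have "a \<bullet> (y - u) \<le> norm a * (\<delta> * \<rho>)"
  proof -
    have "a \<bullet> (y - u) \<le> norm a * norm (y - u)" by (rule norm_cauchy_schwarz)
    also have "\<dots> \<le> norm a * (\<delta> * \<rho>)"
      using y(2) by (intro mult_left_mono) (simp_all add: dist_norm norm_minus_commute)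
    finally show ?thesis .
  qed
  finally have "a \<bullet> y \<le> - (norm a * ((1 - \<delta>) * \<rho>))" by (simp add: algebra_simps)
  also have "\<dots> \<le> - (norm a * norm x)" using x by (simp add: mult_left_mono)
  also have "\<dots> \<le> a \<bullet> x" using Cauchy_Schwarz_ineq2[of a x] by linarith
  finally show False using ab(1) ab(2)[OF hull_inc[OF y(1)]] by linarith
qed

lemma weighted_average_attained:
  fixes f :: "'a \<Rightarrow> real"
  assumes G: "finite G" "\<And>g. g \<in> G \<Longrightarrow> u g \<ge> 0" "sum u G = 1"
  obtains g where "g \<in> G" "f g \<le> (\<Sum>g\<in>G. u g * f g)"
proof -
  let ?S = "\<Sum>g\<in>G. u g * f g"
  have "\<exists>g\<in>G. f g \<le> ?S"
  proof (rule ccontr)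
    assume "\<not> ?thesis"
    then have gt: "\<And>g. g \<in> G \<Longrightarrow> f g - ?S > 0" by (auto simp: not_le)
    have "(\<Sum>g\<in>G. u g * (f g - ?S)) = ?S - sum u G * ?S"
      by (simp add: right_diff_distrib sum_subtractf sum_distrib_right)
    then have "(\<Sum>g\<in>G. u g * (f g - ?S)) = 0" using G(3) by simp
    then have "\<forall>g\<in>G. u g * (f g - ?S) = 0"
      by (subst (asm) sum_nonneg_eq_0_iff) (use G gt in \<open>auto intro!: mult_nonneg_nonneg intro: less_imp_le\<close>)
    then have "\<forall>g\<in>G. u g = 0" using gt by force
    then show False using G(3) by simp
  qed
  then show thesis using that by blast
qed

text \<open>
  Derandomized sampling: if the next point is drawn with the weights that represent \<open>x\<close>, the squared
  deviation grows by at most \<open>C\<^sup>2\<close> on average, so some choice achieves this.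
\<close>

lemma empirical_approximation:
  fixes G :: "'a::real_inner set"
  assumes G: "finite G" and C: "\<And>g. g \<in> G \<Longrightarrow> norm g \<le> C" and x: "x \<in> convex hull G"
  shows "\<exists>xs. set xs \<subseteq> G \<and> length xs = k \<and> (norm (sum_list xs - real k *\<^sub>R x))\<^sup>2 \<le> real k * C\<^sup>2"
proof (induction k)
  case 0
  then show ?case by (intro exI[of _ "[]"]) auto
next
  case (Suc k)
  then obtain xs where xs: "set xs \<subseteq> G" "length xs = k"
    "(norm (sum_list xs - real k *\<^sub>R x))\<^sup>2 \<le> real k * C\<^sup>2" by blast
  define w where "w = sum_list xs - real k *\<^sub>R x"
  obtain u where u: "\<And>g. g \<in> G \<Longrightarrow> u g \<ge> 0" "sum u G = 1" "(\<Sum>g\<in>G. u g *\<^sub>R g) = x"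
    using x unfolding convex_hull_finite[OF G] by auto
  obtain g where g: "g \<in> G"
    "(norm (w + (g - x)))\<^sup>2 \<le> (\<Sum>g\<in>G. u g * (norm (w + (g - x)))\<^sup>2)"
    by (rule weighted_average_attained[OF G u(1,2), where f = "\<lambda>g. (norm (w + (g - x)))\<^sup>2"])
  have "(\<Sum>g\<in>G. u g * (norm (w + (g - x)))\<^sup>2) =
      (\<Sum>g\<in>G. u g * ((norm (w - x))\<^sup>2 + (norm g)\<^sup>2) + 2 * ((w - x) \<bullet> (u g *\<^sub>R g)))"
  proof (rule sum.cong[OF refl])
    fix g
    \<comment> \<open>the cross term \<open>(w - x) \<bullet> g\<close> averages to \<open>(w - x) \<bullet> x\<close>\<close>
    have "w + (g - x) = (w - x) + g" by simp
    then have "(norm (w + (g - x)))\<^sup>2 = (norm (w - x))\<^sup>2 + (norm g)\<^sup>2 + 2 * ((w - x) \<bullet> g)"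
      by (simp only: power2_norm_eq_inner) (simp add: inner_add_left inner_add_right inner_commute)
    then show "u g * (norm (w + (g - x)))\<^sup>2 = u g * ((norm (w - x))\<^sup>2 + (norm g)\<^sup>2) + 2 * ((w - x) \<bullet> (u g *\<^sub>R g))"
      by (simp only: distrib_left inner_scaleR_right mult.left_commute)
  qed
  also have "\<dots> = (\<Sum>g\<in>G. u g * ((norm (w - x))\<^sup>2 + (norm g)\<^sup>2)) + 2 * ((w - x) \<bullet> x)"
    by (simp only: sum.distrib sum_distrib_left[symmetric] inner_sum_right[symmetric] u(3))
  also have "\<dots> \<le> (\<Sum>g\<in>G. u g * ((norm (w - x))\<^sup>2 + C\<^sup>2)) + 2 * ((w - x) \<bullet> x)"
    using u(1) C by (intro add_right_mono sum_mono mult_left_mono add_left_mono power_mono) auto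
  also have "\<dots> = (norm (w - x))\<^sup>2 + C\<^sup>2 + 2 * ((w - x) \<bullet> x)"
    by (simp add: u(2) flip: sum_distrib_right)
  also have "\<dots> = (norm w)\<^sup>2 - (norm x)\<^sup>2 + C\<^sup>2"
    unfolding power2_norm_eq_inner by (simp add: inner_diff_left inner_diff_right inner_commute)
  also have "\<dots> \<le> real k * C\<^sup>2 + C\<^sup>2"
    using xs(3) zero_le_power2[of "norm x"] unfolding w_def by linarith
  finally have "(norm (w + (g - x)))\<^sup>2 \<le> real (Suc k) * C\<^sup>2" using g(2) by (simp add: algebra_simps)
  moreover have "sum_list (g # xs) - real (Suc k) *\<^sub>R x = w + (g - x)"
    by (simp add: w_def algebra_simps)
  ultimately have "(norm (sum_list (g # xs) - real (Suc k) *\<^sub>R x))\<^sup>2 \<le> real (Suc k) * C\<^sup>2"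
    by (simp only:)
  then show ?case
    using xs(1,2) g(1) by (intro exI[of _ "g # xs"] conjI) auto
qed

text \<open>
  The averages of \<open>m\<close>-tuples of points of \<open>G\<close> are the centres of a covering by balls. A set \<open>K\<close> that is
  not measurable has measure \<open>0\<close> by convention.
\<close>

lemma hull_volume_le:
  fixes G :: "'a::euclidean_space set"
  assumes G: "finite G" "\<And>g. g \<in> G \<Longrightarrow> norm g \<le> C" and C: "C \<ge> 0" and m: "m > 0"
    and K: "K \<subseteq> convex hull G"
  shows "measure lebesgue K \<le> real (card G) ^ m * (unit_ball_vol (real DIM('a)) * (C / sqrt (real m)) ^ DIM('a))"
proof (cases "K \<in> sets lebesgue")
  case False
  then have "measure lebesgue K = 0" by (simp add: measure_notin_sets)
  then show ?thesis using C by simp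
next
  case True
  let ?L = "{xs. set xs \<subseteq> G \<and> length xs = m}"
  let ?B = "\<lambda>xs. cball (sum_list xs /\<^sub>R real m) (C / sqrt (real m))"
  have finL: "finite ?L" by (rule finite_lists_length_eq[OF G(1)])
  have "K \<subseteq> (\<Union>xs\<in>?L. ?B xs)"
  proof
    fix x assume "x \<in> K"
    then have "x \<in> convex hull G" using K by blast
    from empirical_approximation[OF G this, of m]
    obtain xs where xs: "xs \<in> ?L" "(norm (sum_list xs - real m *\<^sub>R x))\<^sup>2 \<le> real m * C\<^sup>2" by blast
    have "norm (sum_list xs - real m *\<^sub>R x) \<le> sqrt (real m * C\<^sup>2)"
      by (rule real_le_rsqrt[OF xs(2)])
    then have "norm (sum_list xs - real m *\<^sub>R x) \<le> sqrt (real m) * C"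
      using C by (simp add: real_sqrt_mult)
    moreover have "sum_list xs /\<^sub>R real m - x = (sum_list xs - real m *\<^sub>R x) /\<^sub>R real m"
      using m by (simp add: scaleR_diff_right)
    then have "dist (sum_list xs /\<^sub>R real m) x = norm (sum_list xs - real m *\<^sub>R x) / real m"
      by (simp add: dist_norm divide_inverse)
    ultimately have "dist (sum_list xs /\<^sub>R real m) x \<le> sqrt (real m) * C / real m"
      by (simp add: divide_right_mono)
    also have "\<dots> = C / sqrt (real m)"
      using m by (simp add: field_simps)
    finally show "x \<in> (\<Union>xs\<in>?L. ?B xs)" using xs(1) by auto
  qed
  then have "measure lebesgue K \<le> measure lebesgue (\<Union>xs\<in>?L. ?B xs)"
    using finL True by (intro measure_mono_fmeasurable) (auto intro!: fmeasurable.finite_UN)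
  also have "\<dots> \<le> (\<Sum>xs\<in>?L. measure lebesgue (?B xs))"
    using finL by (intro measure_UNION_le) auto
  also have "\<dots> = real (card ?L) * (unit_ball_vol (real DIM('a)) * (C / sqrt (real m)) ^ DIM('a))"
    using C by (simp add: content_cball)
  also have "card ?L = card G ^ m" by (rule card_lists_length_eq[OF G(1)])
  finally show ?thesis by simp
qed

section \<open>Elements of the quotient as functions\<close>

lemma rep_quotQ_bihom: "rep_quotQ f \<in> bihom 2 2"
  using Quotient_rep_reflp[OF Quotient_quotQ, of f] by (simp add: equivQ_def)

lemma evalQ_abs:
  assumes "p \<in> bihom 2 2" "z \<in> varietyI"
  shows "evalQ (abs_quotQ p) z = eval_xy p (fst z) (snd z)"
  using assms(2) evalQ.abs_eq[OF equivQ_refl[OF assms(1)]] by (cases z) auto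

text \<open>
  A representing form, defined also off the variety. It is a continuous function, unlike the evaluation
  of a class, which has the dummy value \<open>0\<close> there.
\<close>

definition repfun :: "'n::finite quotQ \<Rightarrow> (real^'n) \<times> (real^'n) \<Rightarrow> real" where
  "repfun f z = eval_xy (rep_quotQ f) (fst z) (snd z)"

lemma repfun_biform: "repfun f \<in> biform 2"
  by (rule biformI[OF rep_quotQ_bihom]) (simp add: repfun_def)

lemma evalQ_repfun: "z \<in> varietyI \<Longrightarrow> evalQ f z = repfun f z"
  using evalQ_abs[OF rep_quotQ_bihom, of z f] Quotient_abs_rep[OF Quotient_quotQ, of f]
  by (simp add: repfun_def)

lemma evalQ_add: "evalQ (f + g) z = evalQ f z + evalQ g z"
  by transfer (auto simp: eval_xy_add split: prod.splits)

lemma evalQ_scaleR: "evalQ (c *\<^sub>R f) z = c * evalQ f z"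
  by transfer (auto simp: eval_smult_xy split: prod.splits)

lemma evalQ_zero: "evalQ 0 z = 0"
  using evalQ_scaleR[of 0 0 z] by simp

lemma evalQ_sum: "evalQ (\<Sum>i\<in>S. f i) z = (\<Sum>i\<in>S. evalQ (f i) z)"
  by (induction S rule: infinite_finite_induct) (auto simp: evalQ_add evalQ_zero)

lemma evalQ_normsqQ: "z \<in> varietyI \<Longrightarrow> evalQ normsqQ z = (norm (fst z))\<^sup>2 * (norm (snd z))\<^sup>2"
  unfolding normsqQ_def evalQ_abs[OF normsq_bihom]
  by (simp add: eval_xy_mult eval_xy_sum eval_xy_power norm_sq_coordinates)

lemma biform_quotQ:
  assumes "F \<in> biform 2"
  obtains f where "\<And>z. z \<in> varietyI \<Longrightarrow> evalQ f z = F z"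
proof -
  obtain p where p: "p \<in> bihom 2 2" "F = (\<lambda>z. eval_xy p (fst z) (snd z))"
    using assms by (rule biformE)
  show thesis
    by (rule that[of "abs_quotQ p"]) (simp add: evalQ_abs p)
qed

lemma setT_subset_variety: "z \<in> setT \<Longrightarrow> z \<in> varietyI"
  by (simp add: setT_def)

locale stiefel_isometry = stiefel \<sigma> for \<sigma> :: "((real^'n::finite) \<times> (real^'n)) measure" +
  fixes \<phi> :: "real^'d::finite \<Rightarrow> 'n quotQ"
  assumes iso: "isometry_onto_M \<sigma> \<phi>"
begin

lemma phi_linear: "linear \<phi>" and phi_range: "range \<phi> = spaceM \<sigma>"
  and phi_inner: "innerM \<sigma> (\<phi> u) (\<phi> v) = u \<bullet> v"
  using iso by (auto simp: isometry_onto_M_def)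

text \<open>
  Forms of mean zero are parametrized by their coordinates \<open>u\<close> with respect to the given isometry;
  \<open>\<zeta> z\<close> represents evaluation at \<open>z\<close> in these coordinates.
\<close>

definition fn :: "real^'d \<Rightarrow> (real^'n) \<times> (real^'n) \<Rightarrow> real" where "fn u = repfun (\<phi> u)"

definition \<zeta> :: "(real^'n) \<times> (real^'n) \<Rightarrow> real^'d" where "\<zeta> z = (\<chi> j. fn (axis j 1) z)"

lemma fn_biform: "fn u \<in> biform 2"
  by (simp add: fn_def repfun_biform)

lemma fn_continuous: "continuous_on S (fn u)"
  by (rule continuous_on_biform[OF fn_biform])

lemma \<zeta>_continuous: "continuous_on S \<zeta>"
  unfolding \<zeta>_def by (intro continuous_on_vec_lambda fn_continuous)

lemma evalQ_fn: "z \<in> varietyI \<Longrightarrow> evalQ (\<phi> u) z = fn u z"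
  by (simp add: fn_def evalQ_repfun)

lemma fn_inner:
  assumes z: "z \<in> varietyI" shows "fn u z = u \<bullet> \<zeta> z"
proof -
  have "u = (\<Sum>j\<in>UNIV. u $ j *\<^sub>R axis j 1)"
    using basis_expansion[of u] by (simp add: scalar_mult_eq_scaleR)
  then have "\<phi> u = \<phi> (\<Sum>j\<in>UNIV. u $ j *\<^sub>R axis j 1)" by (rule arg_cong)
  also have "\<dots> = (\<Sum>j\<in>UNIV. u $ j *\<^sub>R \<phi> (axis j 1))"
    by (simp add: linear_sum[OF phi_linear] linear_scale[OF phi_linear])
  finally have "evalQ (\<phi> u) z = (\<Sum>j\<in>UNIV. u $ j * evalQ (\<phi> (axis j 1)) z)"
    by (simp add: evalQ_sum evalQ_scaleR)
  then show ?thesis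
    by (simp add: evalQ_fn[OF z] \<zeta>_def inner_vec_def)
qed

lemma fn_ip: "ip (fn u) (fn v) = u \<bullet> v"
  unfolding phi_inner[symmetric] ip_def innerM_def
  by (rule integral_cong_setT) (simp add: evalQ_fn setT_subset_variety)

lemma fn_mean: "(\<integral>z. fn u z \<partial>\<sigma>) = 0"
proof -
  have "\<phi> u \<in> spaceM \<sigma>" using phi_range by auto
  then have "(\<integral>z. evalQ (\<phi> u) z \<partial>\<sigma>) = 0" by (simp add: spaceM_def)
  moreover have "(\<integral>z. fn u z \<partial>\<sigma>) = (\<integral>z. evalQ (\<phi> u) z \<partial>\<sigma>)"
    by (rule integral_cong_setT) (simp add: evalQ_fn setT_subset_variety)
  ultimately show ?thesis by simp
qed

text \<open>
  The squared length of \<open>\<zeta> z\<close> is the diagonal of the kernel of the space of forms of mean zero, because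
  the isometry maps the coordinate vectors to an orthonormal basis of it.
\<close>

lemma norm_\<zeta>:
  assumes z: "z \<in> setT" shows "(norm (\<zeta> z))\<^sup>2 = real CARD('d)"
proof -
  define V where "V = {F \<in> biform 2. (\<integral>z. F z \<partial>\<sigma>) = 0}"
  have V: "invariant_space V"
    unfolding V_def invariant_space_def
    by (auto simp: continuous_on_biform biform_zero biform_add biform_scale biform_act integrable_biform
        integral_act continuous_measurable)
  obtain b :: "nat \<Rightarrow> 'd" where b: "bij_betw b {..<CARD('d)} UNIV"
    using ex_bij_betw_nat_finite[of "UNIV :: 'd set"] by (auto simp: atLeast0LessThan)
  define e where "e i = fn (axis (b i) 1)" for i
  have re: "(\<Sum>i<CARD('d). h (b i)) = (\<Sum>j\<in>UNIV. h j)" for h :: "'d \<Rightarrow> real"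
    by (rule sum.reindex_bij_betw[OF b])
  have "orthonormal_basis V CARD('d) e"
    unfolding orthonormal_basis_def
  proof (intro conjI allI impI ballI)
    show "e i \<in> V" for i by (simp add: e_def V_def fn_biform fn_mean)
    show "ip (e i) (e j) = (if i = j then 1 else 0)" if "i < CARD('d)" "j < CARD('d)" for i j
      using that bij_betw_imp_inj_on[OF b] by (auto simp: e_def fn_ip inner_axis_axis inj_on_eq_iff)
    fix F :: "(real^'n) \<times> (real^'n) \<Rightarrow> real" and z :: "(real^'n) \<times> (real^'n)"
    assume F: "F \<in> V" and z: "z \<in> setT"
    obtain f where f: "\<And>z. z \<in> varietyI \<Longrightarrow> evalQ f z = F z"
      using biform_quotQ F by (auto simp: V_def)
    have "(\<integral>z. evalQ f z \<partial>\<sigma>) = (\<integral>z. F z \<partial>\<sigma>)"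
      by (rule integral_cong_setT) (simp add: f setT_subset_variety)
    then have "f \<in> range \<phi>" unfolding phi_range using F by (simp add: spaceM_def V_def)
    then obtain u where u: "f = \<phi> u" by blast
    have Fu: "F z = fn u z" if "z \<in> setT" for z
      using f[OF setT_subset_variety[OF that]] evalQ_fn[OF setT_subset_variety[OF that]] u by simp
    have "ip F (fn (axis j 1)) = u $ j" for j
    proof -
      have "ip F (fn (axis j 1)) = ip (fn u) (fn (axis j 1))"
        unfolding ip_def by (rule integral_cong_setT) (simp add: Fu)
      then show ?thesis by (simp add: fn_ip inner_axis)
    qed
    then have "(\<Sum>i<CARD('d). ip F (e i) * e i z) = (\<Sum>i<CARD('d). u $ b i * fn (axis (b i) 1) z)"
      by (simp add: e_def)
    also have "\<dots> = u \<bullet> \<zeta> z"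
      by (subst re[of "\<lambda>j. u $ j * fn (axis j 1) z"]) (simp add: inner_vec_def \<zeta>_def)
    finally show "F z = (\<Sum>i<CARD('d). ip F (e i) * e i z)"
      using Fu[OF z] fn_inner[OF setT_subset_variety[OF z]] by simp
  qed
  from kernel_diagonal[OF V this z] have "(\<Sum>i<CARD('d). (fn (axis (b i) 1) z)\<^sup>2) = real CARD('d)"
    by (simp add: e_def)
  then have "(\<Sum>j\<in>UNIV. (fn (axis j 1) z)\<^sup>2) = real CARD('d)"
    by (simp add: re[of "\<lambda>j. (fn (axis j 1) z)\<^sup>2"])
  then show ?thesis by (simp add: norm_sq_coordinates \<zeta>_def)
qed

section \<open>The nonnegative forms contain a large section of a ball\<close>

lemma shifted_in_hyperH: "\<phi> u + normsqQ \<in> hyperH \<sigma>"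
proof -
  have "(\<integral>z. evalQ (\<phi> u + normsqQ) z \<partial>\<sigma>) = (\<integral>z. fn u z + 1 \<partial>\<sigma>)"
    by (rule integral_cong_setT) (simp add: evalQ_add evalQ_fn evalQ_normsqQ setT_subset_variety setT_iff)
  also have "\<dots> = (\<integral>z. fn u z \<partial>\<sigma>) + (\<integral>z. 1 \<partial>\<sigma>)"
    by (intro Bochner_Integration.integral_add integrable_continuous fn_continuous continuous_on_const)
  finally show ?thesis by (simp add: hyperH_def fn_mean measure_setT)
qed

lemma Pos_preimage:
  "\<phi> -` PosTilde \<sigma> = {u. \<forall>z\<in>varietyI. u \<bullet> \<zeta> z + (norm (fst z))\<^sup>2 * (norm (snd z))\<^sup>2 \<ge> 0}"
  using shifted_in_hyperH by (auto simp: PosTilde_def PosQ_def evalQ_add evalQ_fn evalQ_normsqQ fn_inner)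

lemma Pos_preimage_closed: "closed (\<phi> -` PosTilde \<sigma>)"
proof -
  have "\<phi> -` PosTilde \<sigma> = (\<Inter>z\<in>varietyI. {u. 0 \<le> u \<bullet> \<zeta> z + (norm (fst z))\<^sup>2 * (norm (snd z))\<^sup>2})"
    unfolding Pos_preimage by auto
  then show ?thesis
    by (simp only:) (intro closed_INT ballI closed_Collect_le continuous_intros)
qed

text \<open>
  Nonnegativity only has to be checked on \<open>T\<close>, by homogeneity.
\<close>

lemma sup_bound_imp_Pos:
  assumes "\<And>z. z \<in> setT \<Longrightarrow> \<bar>fn u z\<bar> \<le> 1"
  shows "u \<in> \<phi> -` PosTilde \<sigma>"
  unfolding Pos_preimage
proof (intro CollectI ballI)
  fix z :: "(real^'n) \<times> (real^'n)" assume z: "z \<in> varietyI"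
  obtain x y where xy: "z = (x, y)" by (cases z)
  have "- ((norm x)\<^sup>2 * (norm y)\<^sup>2) \<le> fn u (x, y)"
  proof (cases "x = 0 \<or> y = 0")
    case True
    then have "fn u (x, y) = 0"
      using biform_scaleR[OF fn_biform, of u 0 x 1 y] biform_scaleR[OF fn_biform, of u 1 x 0 y] by auto
    then show ?thesis by simp
  next
    case False
    have "(sgn x, sgn y) \<in> setT"
      using z False by (simp add: setT_iff norm_sgn sgn_div_norm xy varietyI_def inner_commute)
    then have "- 1 \<le> fn u (sgn x, sgn y)" using assms by fastforce
    then have "(norm x)\<^sup>2 * (norm y)\<^sup>2 * (- 1) \<le> (norm x)\<^sup>2 * (norm y)\<^sup>2 * fn u (sgn x, sgn y)"
      by (rule mult_left_mono) simp
    also have "\<dots> = fn u (norm x *\<^sub>R sgn x, norm y *\<^sub>R sgn y)"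
      by (rule biform_scaleR[OF fn_biform, symmetric])
    finally show ?thesis using False by (simp add: sgn_div_norm)
  qed
  then show "0 \<le> u \<bullet> \<zeta> z + (norm (fst z))\<^sup>2 * (norm (snd z))\<^sup>2"
    using fn_inner[OF z, of u] by (simp add: xy)
qed

text \<open>
  The centre \<open>(t r / D) v\<close> is at distance \<open>t r / sqrt D\<close> from the origin, since \<open>v\<close> has length \<open>sqrt D\<close>.
  The square of the distance of a point of the cap from it is at most \<open>r\<^sup>2 (1 - t\<^sup>2 / D)\<close>, and
  \<open>1 + a \<le> exp a\<close> is used for \<open>a = - t\<^sup>2 / D\<close>.
\<close>

lemma cap_subset:
  fixes v :: "real^'d"
  assumes v: "(norm v)\<^sup>2 = real CARD('d)" and t: "t \<ge> 0" and r: "r \<ge> 0"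
  shows "{u \<in> cball 0 r. v \<bullet> u > t * r} \<subseteq> cball ((t * r / real CARD('d)) *\<^sub>R v) (r * exp (- t\<^sup>2 / (2 * real CARD('d))))"
proof
  let ?D = "real CARD('d)"
  have D: "?D > 0" by simp
  fix u assume u: "u \<in> {u \<in> cball 0 r. v \<bullet> u > t * r}"
  let ?c = "(t * r / ?D) *\<^sub>R v"
  have "(norm (a *\<^sub>R v - u))\<^sup>2 = a\<^sup>2 * (norm v)\<^sup>2 - 2 * a * (v \<bullet> u) + (norm u)\<^sup>2" for a
    unfolding power2_norm_eq_inner
    by (simp add: inner_diff_left inner_diff_right inner_commute[of u v] power2_eq_square algebra_simps)
  then have "(norm (?c - u))\<^sup>2 = (t * r / ?D)\<^sup>2 * (norm v)\<^sup>2 - 2 * (t * r / ?D) * (v \<bullet> u) + (norm u)\<^sup>2" .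
  also have "(t * r / ?D)\<^sup>2 * (norm v)\<^sup>2 = (t * r)\<^sup>2 / ?D"
    using D unfolding v by (simp add: power2_eq_square)
  also have "(t * r)\<^sup>2 / ?D - 2 * (t * r / ?D) * (v \<bullet> u) + (norm u)\<^sup>2 \<le> (t * r)\<^sup>2 / ?D - 2 * (t * r / ?D) * (t * r) + r\<^sup>2"
    using u t r D by (intro add_mono diff_left_mono mult_left_mono power_mono) auto
  also have "\<dots> = r\<^sup>2 * (1 + (- t\<^sup>2 / ?D))"
    using D by (simp add: field_simps power2_eq_square)
  also have "\<dots> \<le> r\<^sup>2 * exp (- t\<^sup>2 / ?D)"
    by (intro mult_left_mono exp_ge_add_one_self) auto
  also have "\<dots> = (r * exp (- t\<^sup>2 / (2 * ?D)))\<^sup>2"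
    by (simp add: power_mult_distrib flip: exp_of_nat_mult)
  finally have "norm (?c - u) \<le> r * exp (- t\<^sup>2 / (2 * ?D))"
    by (rule power2_le_imp_le) (use r in simp)
  then show "u \<in> cball ?c (r * exp (- t\<^sup>2 / (2 * ?D)))" by (simp add: dist_norm)
qed

lemma cap_volume:
  fixes v :: "real^'d"
  assumes v: "(norm v)\<^sup>2 = real CARD('d)" and t: "t \<ge> 0" and r: "r \<ge> 0"
  shows "emeasure lborel {u \<in> cball 0 r. \<bar>v \<bullet> u\<bar> > t * r} \<le>
     ennreal (2 * exp (- t\<^sup>2 / 2) * (unit_ball_vol (real CARD('d)) * r ^ CARD('d)))"
proof -
  let ?D = "real CARD('d)"
  let ?\<rho> = "r * exp (- t\<^sup>2 / (2 * ?D))"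
  let ?c = "(t * r / ?D) *\<^sub>R v"
  have v': "(norm (- v))\<^sup>2 = ?D" using v by simp
  have "{u \<in> cball 0 r. \<bar>v \<bullet> u\<bar> > t * r} \<subseteq> {u \<in> cball 0 r. v \<bullet> u > t * r} \<union> {u \<in> cball 0 r. (- v) \<bullet> u > t * r}"
    by auto
  also have "\<dots> \<subseteq> cball ?c ?\<rho> \<union> cball ((t * r / ?D) *\<^sub>R (- v)) ?\<rho>"
    by (rule Un_mono[OF cap_subset[OF v t r] cap_subset[OF v' t r]])
  finally have "emeasure lborel {u \<in> cball 0 r. \<bar>v \<bullet> u\<bar> > t * r} \<le>
      emeasure lborel (cball ?c ?\<rho> \<union> cball ((t * r / ?D) *\<^sub>R (- v)) ?\<rho>)"
    by (rule emeasure_mono) auto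
  also have "\<dots> \<le> emeasure lborel (cball ?c ?\<rho>) + emeasure lborel (cball ((t * r / ?D) *\<^sub>R (- v)) ?\<rho>)"
    by (rule emeasure_subadditive) auto
  also have "\<dots> = ennreal (unit_ball_vol ?D * ?\<rho> ^ CARD('d)) + ennreal (unit_ball_vol ?D * ?\<rho> ^ CARD('d))"
    using r by (simp add: emeasure_cball)
  also have "\<dots> = ennreal (2 * (unit_ball_vol ?D * ?\<rho> ^ CARD('d)))"
    using r by (simp flip: ennreal_plus)
  also have "2 * (unit_ball_vol ?D * ?\<rho> ^ CARD('d)) = 2 * exp (- t\<^sup>2 / 2) * (unit_ball_vol ?D * r ^ CARD('d))"
    by (simp add: power_mult_distrib flip: exp_of_nat_mult)
  finally show ?thesis .
qed

text \<open>
  The pairs \<open>(u, z)\<close> with \<open>\<bar>fn u z\<bar> > t r\<close> have product measure at most \<open>2 exp(- t\<^sup>2 / 2)\<close> times the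
  volume of the ball, by the cap estimate for every \<open>z\<close>. Markov's inequality for the measure of the
  sections over \<open>u\<close> leaves at least half of the ball.
\<close>

lemma typical_tail:
  assumes t: "t \<ge> 0" and r: "r > 0"
  defines "Good \<equiv> {u \<in> cball 0 r. measure \<sigma> {z \<in> setT. \<bar>fn u z\<bar> > t * r} \<le> 4 * exp (- t\<^sup>2 / 2)}"
  shows "Good \<in> sets lborel"
    and "measure lborel Good \<ge> unit_ball_vol (real CARD('d)) * r ^ CARD('d) / 2"
proof -
  let ?D = "real CARD('d)" and ?\<eta> = "exp (- t\<^sup>2 / 2)"
  let ?vol = "unit_ball_vol (real CARD('d)) * r ^ CARD('d)"
  let ?B = "cball (0 :: real^'d) r"
  interpret L: pair_sigma_finite "lborel :: (real^'d) measure" \<sigma>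
    by (simp add: pair_sigma_finite_def sigma_finite_measure_axioms lborel.sigma_finite_measure_axioms)
  define E where "E = {p \<in> space (lborel \<Otimes>\<^sub>M \<sigma>). fst p \<in> ?B \<and> \<bar>\<zeta> (snd p) \<bullet> fst p\<bar> > t * r}"
  have z: "\<zeta> \<in> borel_measurable \<sigma>"
    by (intro measurable_sigma borel_measurable_continuous_onI \<zeta>_continuous)
  have fm: "fst \<in> borel_measurable (lborel \<Otimes>\<^sub>M \<sigma>)"
    using measurable_fst[of lborel \<sigma>] by simp
  have sm: "(\<lambda>p. \<zeta> (snd p)) \<in> borel_measurable (lborel \<Otimes>\<^sub>M \<sigma>)"
    by (rule measurable_compose[OF measurable_snd z])
  have E: "E \<in> sets (lborel \<Otimes>\<^sub>M \<sigma>)"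
  proof -
    have "(\<lambda>p. \<bar>\<zeta> (snd p) \<bullet> fst p\<bar>) \<in> borel_measurable (lborel \<Otimes>\<^sub>M \<sigma>)"
      by (intro borel_measurable_abs borel_measurable_inner fm sm)
    then have "(\<lambda>p. \<bar>\<zeta> (snd p) \<bullet> fst p\<bar>) -` {t * r<..} \<inter> space (lborel \<Otimes>\<^sub>M \<sigma>) \<in> sets (lborel \<Otimes>\<^sub>M \<sigma>)"
      by (rule measurable_sets) simp
    moreover have "fst -` ?B \<inter> space (lborel \<Otimes>\<^sub>M \<sigma>) \<in> sets (lborel \<Otimes>\<^sub>M \<sigma>)"
      using fm by (rule measurable_sets) simp
    moreover have "E = (fst -` ?B \<inter> space (lborel \<Otimes>\<^sub>M \<sigma>)) \<inter>
        ((\<lambda>p. \<bar>\<zeta> (snd p) \<bullet> fst p\<bar>) -` {t * r<..} \<inter> space (lborel \<Otimes>\<^sub>M \<sigma>))"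
      by (auto simp: E_def)
    ultimately show ?thesis by simp
  qed
  have sec: "Pair u -` E = (if u \<in> ?B then {z \<in> setT. \<bar>fn u z\<bar> > t * r} else {})" for u
    by (auto simp: E_def space_pair_measure fn_inner[OF setT_subset_variety] inner_commute)
  have "emeasure (lborel \<Otimes>\<^sub>M \<sigma>) E = (\<integral>\<^sup>+z. emeasure lborel ((\<lambda>u. (u, z)) -` E) \<partial>\<sigma>)"
    by (rule L.emeasure_pair_measure_alt2[OF E])
  also have "\<dots> \<le> (\<integral>\<^sup>+z. ennreal (2 * ?\<eta> * ?vol) \<partial>\<sigma>)"
  proof (rule nn_integral_mono)
    fix z assume "z \<in> space \<sigma>"
    then have z: "z \<in> setT" by simp
    then have "(\<lambda>u. (u, z)) -` E = {u \<in> ?B. \<bar>\<zeta> z \<bullet> u\<bar> > t * r}"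
      by (auto simp: E_def space_pair_measure)
    then show "emeasure lborel ((\<lambda>u. (u, z)) -` E) \<le> ennreal (2 * ?\<eta> * ?vol)"
      using cap_volume[OF norm_\<zeta>[OF z] t, of r] r by simp
  qed
  also have "\<dots> = ennreal (2 * ?\<eta> * ?vol)" by (simp add: emeasure_setT)
  finally have tot: "(\<integral>\<^sup>+u. emeasure \<sigma> (Pair u -` E) \<partial>lborel) \<le> ennreal (2 * ?\<eta> * ?vol)"
    by (simp add: emeasure_pair_measure_alt[OF E])
  have secm: "(\<lambda>u. emeasure \<sigma> (Pair u -` E)) \<in> borel_measurable lborel"
    by (rule measurable_emeasure_Pair[OF E])
  define Bad where "Bad = {u \<in> space lborel. 1 \<le> ennreal (1 / (4 * ?\<eta>)) * emeasure \<sigma> (Pair u -` E)}"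
  have Badm: "Bad \<in> sets lborel"
    unfolding Bad_def using secm by measurable
  have "emeasure lborel Bad \<le> ennreal (1 / (4 * ?\<eta>)) * (\<integral>\<^sup>+u. emeasure \<sigma> (Pair u -` E) * indicator (space lborel) u \<partial>lborel)"
    using nn_integral_Markov_inequality[of "\<lambda>u. emeasure \<sigma> (Pair u -` E)" "space lborel" lborel "ennreal (1 / (4 * ?\<eta>))"] secm
    by (simp add: Bad_def)
  also have "\<dots> \<le> ennreal (1 / (4 * ?\<eta>)) * ennreal (2 * ?\<eta> * ?vol)"
    using tot by (intro mult_left_mono) simp_all
  also have "\<dots> = ennreal (?vol / 2)"
    using r by (simp flip: ennreal_mult)
  finally have Bad: "emeasure lborel Bad \<le> ennreal (?vol / 2)" .
  have Good_eq: "Good = {u \<in> ?B. emeasure \<sigma> (Pair u -` E) \<le> ennreal (4 * ?\<eta>)}"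
    unfolding Good_def by (auto simp: sec emeasure_eq_measure)
  have "(\<lambda>u. emeasure \<sigma> (Pair u -` E)) -` {..ennreal (4 * ?\<eta>)} \<inter> space lborel \<in> sets lborel"
    using secm by (rule measurable_sets) simp
  then have "?B \<inter> ((\<lambda>u. emeasure \<sigma> (Pair u -` E)) -` {..ennreal (4 * ?\<eta>)} \<inter> space lborel) \<in> sets lborel"
    by (intro sets.Int) auto
  moreover have "Good = ?B \<inter> ((\<lambda>u. emeasure \<sigma> (Pair u -` E)) -` {..ennreal (4 * ?\<eta>)} \<inter> space lborel)"
    by (auto simp: Good_eq)
  ultimately show Gm: "Good \<in> sets lborel" by simp
  have "?B \<subseteq> Good \<union> Bad"
  proof
    fix u assume u: "u \<in> ?B"
    show "u \<in> Good \<union> Bad"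
    proof (cases "u \<in> Good")
      case False
      then have "4 * ?\<eta> < measure \<sigma> (Pair u -` E)"
        using u by (simp add: Good_eq emeasure_eq_measure)
      then have "1 \<le> 1 / (4 * ?\<eta>) * measure \<sigma> (Pair u -` E)"
        by (simp add: field_simps)
      then have "ennreal 1 \<le> ennreal (1 / (4 * ?\<eta>) * measure \<sigma> (Pair u -` E))"
        by (rule ennreal_leI)
      moreover have "ennreal (1 / (4 * ?\<eta>) * measure \<sigma> (Pair u -` E)) =
          ennreal (1 / (4 * ?\<eta>)) * emeasure \<sigma> (Pair u -` E)"
        unfolding emeasure_eq_measure by (rule ennreal_mult) auto
      ultimately have le: "1 \<le> ennreal (1 / (4 * ?\<eta>)) * emeasure \<sigma> (Pair u -` E)"
        by (simp only: ennreal_1)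
      have "u \<in> Bad"
        unfolding Bad_def by (intro CollectI conjI le) simp
      then show ?thesis by simp
    qed simp
  qed
  then have "emeasure lborel ?B \<le> emeasure lborel Good + emeasure lborel Bad"
    using Gm Badm emeasure_mono[of ?B "Good \<union> Bad" lborel] emeasure_subadditive[of Good lborel Bad]
    by (meson order_trans sets.Un)
  also have "\<dots> \<le> emeasure lborel Good + ennreal (?vol / 2)"
    by (intro add_left_mono Bad)
  finally have *: "ennreal ?vol \<le> emeasure lborel Good + ennreal (?vol / 2)"
    using r by (simp add: emeasure_cball)
  have "emeasure lborel Good \<le> emeasure lborel ?B"
    by (rule emeasure_mono) (auto simp: Good_def)
  then have "emeasure lborel Good < \<infinity>"
    using emeasure_lborel_cball_finite[of "0::real^'d" r] by (simp add: order_le_less_trans)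
  then have "emeasure lborel Good = ennreal (measure lborel Good)"
    by (simp add: emeasure_eq_ennreal_measure less_top)
  with * have "ennreal ?vol \<le> ennreal (measure lborel Good + ?vol / 2)"
    using r by (simp add: ennreal_plus)
  then have "?vol \<le> measure lborel Good + ?vol / 2"
    using r by (subst (asm) ennreal_le_iff) auto
  then show "measure lborel Good \<ge> ?vol / 2" by simp
qed

end

context stiefel_isometry
begin

text \<open>
  For degree \<open>32 n\<close> the choice \<open>t = 32 / 33\<close> is optimal in the generating function bound; it bounds
  the dimension of the space of forms by \<open>8100\<^sup>n\<close>.
\<close>

lemma biform_dimension_numeric:
  fixes n :: nat
  shows "((33 / 32 :: real) ^ (32 * n) * 33 ^ n)\<^sup>2 \<le> 8100 ^ n"
proof -
  have "(33 / 32 :: real) ^ 32 * 33 \<le> 90" by (simp add: power_divide)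
  then have "((33 / 32 :: real) ^ 32 * 33) ^ n \<le> 90 ^ n" by (rule power_mono) simp
  then have "((33 / 32 :: real) ^ (32 * n) * 33 ^ n) \<le> 90 ^ n"
    by (simp only: power_mult power_mult_distrib)
  then have "((33 / 32 :: real) ^ (32 * n) * 33 ^ n)\<^sup>2 \<le> (90 ^ n)\<^sup>2"
    by (rule power_mono) simp
  also have "(90 ^ n)\<^sup>2 = (8100 :: real) ^ n"
    by (simp add: power2_eq_square flip: power_mult_distrib)
  finally show ?thesis .
qed

lemma tail_numeric:
  assumes "n \<ge> 3"
  shows "(8100 :: real) ^ n * (4 * exp (- (10 * real n))) \<le> 1 / 2"
proof -
  have "(1 + 1 / 10 + (1 / 10)\<^sup>2 / 2 :: real) \<le> exp (1 / 10)"
    using exp_lower_Taylor_quadratic[of "1 / 10"] by simp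
  then have "(221 / 200 :: real) ^ 100 \<le> exp (1 / 10) ^ 100"
    by (intro power_mono) (simp_all add: power2_eq_square)
  moreover have "(16200 :: real) \<le> (221 / 200) ^ 100" by (simp add: power_divide)
  moreover have "exp (1 / 10) ^ 100 = exp (10 :: real)"
    by (simp flip: exp_of_nat_mult)
  ultimately have "(16200 :: real) \<le> exp 10" by linarith
  then have "(16200 :: real) ^ n \<le> exp 10 ^ n" by (rule power_mono) simp
  then have e: "(2 :: real) ^ n * 8100 ^ n \<le> exp (10 * real n)"
    by (simp flip: power_mult_distrib exp_of_nat2_mult)
  have "(2 :: real) ^ 3 \<le> 2 ^ n" using assms by (rule power_increasing) simp
  then have "8 * 8100 ^ n \<le> (2 :: real) ^ n * 8100 ^ n" by (intro mult_right_mono) auto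
  with e have "8 * 8100 ^ n \<le> exp (10 * real n)" by linarith
  then show ?thesis by (simp add: exp_minus field_simps)
qed

lemma sup_numeric:
  assumes "n \<ge> 2"
  shows "2 * 8100 ^ n * sqrt (20 * real n) ^ (32 * n) \<le> (6 * sqrt (real n)) ^ (32 * n)"
proof -
  have e: "(32 * n) = 2 * (16 * n)" by simp
  have s1: "sqrt (20 * real n) ^ (32 * n) = (20 * real n) ^ (16 * n)"
    unfolding e power_mult by simp
  have s2: "(6 * sqrt (real n)) ^ (32 * n) = (36 * real n) ^ (16 * n)"
    unfolding e power_mult by (simp add: power_mult_distrib)
  have "(2 :: real) \<le> (12000 / 8100)\<^sup>2" by (simp add: power2_eq_square)
  also have "\<dots> \<le> (12000 / 8100) ^ n" using assms by (rule power_increasing) simp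
  finally have "2 * 8100 ^ n \<le> (12000 / 8100 :: real) ^ n * 8100 ^ n" by (intro mult_right_mono) auto
  also have "\<dots> = 12000 ^ n" by (simp flip: power_mult_distrib)
  also have "\<dots> \<le> ((36 / 20 :: real) ^ 16) ^ n" by (rule power_mono) (simp_all add: power_divide)
  also have "\<dots> = (36 / 20) ^ (16 * n)" by (rule power_mult[symmetric])
  finally have "2 * 8100 ^ n * (20 * real n) ^ (16 * n) \<le> (36 / 20 :: real) ^ (16 * n) * (20 * real n) ^ (16 * n)"
    by (rule mult_right_mono) simp
  also have "\<dots> = (36 / 20 * (20 * real n)) ^ (16 * n)" by (rule power_mult_distrib[symmetric])
  also have "36 / 20 * (20 * real n) = 36 * real n" by simp
  finally show ?thesis by (simp only: s1 s2)
qed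

text \<open>
  Let \<open>S\<close> be the supremum and \<open>k = 32 n\<close>. The function \<open>f\<^sup>k\<close> is the square of \<open>f\<^sup>1\<^sup>6\<^sup>n\<close>, so its supremum
  \<open>S\<^sup>k\<close> is at most \<open>8100\<^sup>n\<close> times its integral. The integral is at most \<open>(t r)\<^sup>k\<close> plus \<open>S\<^sup>k\<close> times the
  measure of the exceptional set. The latter measure is at most \<open>1 / (2 * 8100\<^sup>n)\<close>, so that the last
  term can be absorbed on the left.
\<close>

lemma typical_sup:
  fixes u :: "real^'d" and r :: real
  defines "n \<equiv> CARD('n)"
  assumes r: "r > 0"
    and tail: "measure \<sigma> {z \<in> setT. \<bar>fn u z\<bar> > sqrt (20 * real n) * r} \<le> 4 * exp (- (sqrt (20 * real n))\<^sup>2 / 2)"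
    and z: "z \<in> setT"
  shows "\<bar>fn u z\<bar> \<le> 6 * sqrt (real n) * r"
proof -
  have n: "n \<ge> 3" using n3 by (simp add: n_def)
  let ?t = "sqrt (20 * real n)" and ?p = "16 * n"
  have "compact ((\<lambda>z. \<bar>fn u z\<bar>) ` setT)"
    by (intro compact_continuous_image compact_setT continuous_intros fn_continuous)
  then obtain z0 where z0: "z0 \<in> setT" and max: "\<And>z. z \<in> setT \<Longrightarrow> \<bar>fn u z\<bar> \<le> \<bar>fn u z0\<bar>"
    using compact_attains_sup[of "(\<lambda>z. \<bar>fn u z\<bar>) ` setT"] setT_nonempty by auto
  define S where "S = \<bar>fn u z0\<bar>"
  have S0: "S \<ge> 0" by (simp add: S_def)
  define A where "A = {z \<in> setT. \<bar>fn u z\<bar> > ?t * r}"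
  have Am: "A \<in> sets \<sigma>"
  proof -
    have "(\<lambda>z. \<bar>fn u z\<bar>) \<in> borel_measurable \<sigma>"
      by (intro continuous_measurable continuous_intros fn_continuous)
    then have "(\<lambda>z. \<bar>fn u z\<bar>) -` {?t * r<..} \<inter> space \<sigma> \<in> sets \<sigma>"
      by (rule measurable_sets) simp
    moreover have "(\<lambda>z. \<bar>fn u z\<bar>) -` {?t * r<..} \<inter> space \<sigma> = A" by (auto simp: A_def)
    ultimately show ?thesis by simp
  qed
  have AT: "A \<inter> setT = A" by (auto simp: A_def)
  define F where "F z = fn u z ^ ?p" for z
  have F: "F \<in> biform (32 * n)"
    using biform_power[OF fn_biform, of u ?p] by (simp add: F_def[abs_def] mult.commute)
  obtain N e where N: "N \<le> card (bimonoms (32 * n) :: 'n monom_xy set)"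
    and onb: "orthonormal_basis (biform (32 * n)) N e"
    by (rule biform_onb)
  have "real (card (bimonoms (32 * n) :: 'n monom_xy set)) \<le> ((1 / (32 / 33)) ^ (32 * n) * (1 / (1 - 32 / 33)) ^ CARD('n))\<^sup>2"
    by (rule bimonoms_finite_card(2)) auto
  also have "\<dots> \<le> 8100 ^ n"
    using biform_dimension_numeric[of n] by (simp add: n_def)
  finally have N': "real N \<le> 8100 ^ n" using N by linarith
  have pw: "F z * F z = \<bar>fn u z\<bar> ^ (32 * n)" for z
  proof -
    have e: "32 * n = 16 * n + 16 * n" by simp
    show ?thesis
      unfolding F_def e power_add power_abs[symmetric] abs_mult_self_eq ..
  qed
  have "ip F F \<le> (\<integral>z. (?t * r) ^ (32 * n) + S ^ (32 * n) * indicator A z \<partial>\<sigma>)"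
    unfolding ip_def
  proof (rule Bochner_Integration.integral_mono)
    show "integrable \<sigma> (\<lambda>z. F z * F z)"
      by (intro integrable_mult continuous_on_biform[OF F])
    show "integrable \<sigma> (\<lambda>z. (?t * r) ^ (32 * n) + S ^ (32 * n) * indicator A z)"
      using Am by (intro Bochner_Integration.integrable_add integrable_mult_right)
        (auto simp: emeasure_eq_measure)
    fix z assume "z \<in> space \<sigma>"
    then have z: "z \<in> setT" by simp
    show "F z * F z \<le> (?t * r) ^ (32 * n) + S ^ (32 * n) * indicator A z"
    proof (cases "z \<in> A")
      case True
      have "\<bar>fn u z\<bar> ^ (32 * n) \<le> S ^ (32 * n)"
        using max[OF z] by (intro power_mono) (auto simp: S_def)
      then show ?thesis using True r by (simp add: pw add_increasing)
    next
      case False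
      then have "\<bar>fn u z\<bar> ^ (32 * n) \<le> (?t * r) ^ (32 * n)"
        using z by (intro power_mono) (auto simp: A_def)
      then show ?thesis using False by (simp add: pw)
    qed
  qed
  also have "\<dots> = (?t * r) ^ (32 * n) + S ^ (32 * n) * measure \<sigma> A"
    using Am by (subst Bochner_Integration.integral_add)
      (auto simp: emeasure_eq_measure measure_setT AT)
  finally have ipF: "ip F F \<le> (?t * r) ^ (32 * n) + S ^ (32 * n) * measure \<sigma> A" .
  have mA: "measure \<sigma> A \<le> 4 * exp (- (10 * real n))"
    using tail by (simp add: A_def)
  have "S ^ (32 * n) = (F z0)\<^sup>2" using pw[of z0] by (simp add: S_def power2_eq_square)
  also have "\<dots> \<le> real N * ip F F"
    by (rule sup_norm_le[OF invariant_space_biform onb F z0])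
  also have "\<dots> \<le> 8100 ^ n * ip F F"
    by (rule mult_right_mono[OF N']) (simp add: ip_def)
  also have "\<dots> \<le> 8100 ^ n * ((?t * r) ^ (32 * n) + S ^ (32 * n) * (4 * exp (- (10 * real n))))"
    using ipF mA S0 by (intro mult_left_mono order_trans[OF ipF] add_left_mono) auto
  also have "\<dots> = 8100 ^ n * (?t * r) ^ (32 * n) + S ^ (32 * n) * (8100 ^ n * (4 * exp (- (10 * real n))))"
    by (simp add: algebra_simps)
  also have "\<dots> \<le> 8100 ^ n * (?t * r) ^ (32 * n) + S ^ (32 * n) * (1 / 2)"
    using S0 tail_numeric[OF n] by (intro add_left_mono mult_left_mono) auto
  finally have "S ^ (32 * n) \<le> 2 * 8100 ^ n * (?t * r) ^ (32 * n)" by simp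
  also have "\<dots> = (2 * 8100 ^ n * ?t ^ (32 * n)) * r ^ (32 * n)"
    by (simp add: power_mult_distrib)
  also have "\<dots> \<le> (6 * sqrt (real n)) ^ (32 * n) * r ^ (32 * n)"
    using r n by (intro mult_right_mono sup_numeric) auto
  also have "\<dots> = (6 * sqrt (real n) * r) ^ (32 * n)"
    by (simp add: power_mult_distrib)
  finally have "S ^ (32 * n) \<le> (6 * sqrt (real n) * r) ^ (32 * n)" .
  then have "S \<le> 6 * sqrt (real n) * r"
    using S0 r n by (subst (asm) power_mono_iff) auto
  then show ?thesis using max[OF z] by (simp add: S_def)
qed

lemma Pos_volume:
  assumes fin: "emeasure lborel (\<phi> -` PosTilde \<sigma>) < \<infinity>"
  shows "volM \<phi> (PosTilde \<sigma>) \<ge>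
     unit_ball_vol (real CARD('d)) * (1 / (6 * sqrt (real CARD('n)))) ^ CARD('d) / 2"
proof -
  define n where "n = CARD('n)"
  have n: "n \<ge> 3" using n3 by (simp add: n_def)
  define r where "r = 1 / (6 * sqrt (real n))"
  have r: "r > 0" using n by (simp add: r_def)
  have t: "sqrt (20 * real n) \<ge> 0" by simp
  define Good where "Good = {u \<in> cball 0 r. measure \<sigma> {z \<in> setT. \<bar>fn u z\<bar> > sqrt (20 * real n) * r}
    \<le> 4 * exp (- (sqrt (20 * real n))\<^sup>2 / 2)}"
  have Good: "Good \<in> sets lborel" "measure lborel Good \<ge> unit_ball_vol (real CARD('d)) * r ^ CARD('d) / 2"
    unfolding Good_def by (rule typical_tail[OF t r])+
  have "Good \<subseteq> \<phi> -` PosTilde \<sigma>"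
  proof
    fix u assume u: "u \<in> Good"
    show "u \<in> \<phi> -` PosTilde \<sigma>"
    proof (rule sup_bound_imp_Pos)
      fix z :: "(real^'n) \<times> (real^'n)" assume z: "z \<in> setT"
      have "\<bar>fn u z\<bar> \<le> 6 * sqrt (real n) * r"
        using u z typical_sup[OF r _ z, of u] by (simp add: Good_def n_def)
      then show "\<bar>fn u z\<bar> \<le> 1" using n by (simp add: r_def)
    qed
  qed
  then have "measure lborel Good \<le> measure lborel (\<phi> -` PosTilde \<sigma>)"
    using fin Good(1) Pos_preimage_closed
    by (intro measure_mono_fmeasurable fmeasurableI) auto
  also have "\<dots> = volM \<phi> (PosTilde \<sigma>)"
    using Pos_preimage_closed by (simp add: volM_def)
  finally show ?thesis using Good(2) by (simp add: r_def n_def)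
qed

section \<open>The sums of squares lie in a small convex hull\<close>

lemma ip_Cauchy_Schwarz:
  assumes F: "continuous_on UNIV F" and G: "continuous_on UNIV G"
  shows "(ip F G)\<^sup>2 \<le> ip F F * ip G G"
proof -
  have nn: "0 \<le> ip F F + 2 * s * ip F G + s\<^sup>2 * ip G G" for s
  proof -
    have "0 \<le> (\<integral>z. (F z + s * G z)\<^sup>2 \<partial>\<sigma>)" by simp
    also have "\<dots> = (\<integral>z. F z * F z + (2 * s * (F z * G z) + s\<^sup>2 * (G z * G z)) \<partial>\<sigma>)"
      by (rule integral_cong_setT) (simp add: power2_eq_square algebra_simps)
    also have "\<dots> = ip F F + (2 * s * ip F G + s\<^sup>2 * ip G G)"
      unfolding ip_def using F G by (simp add: integrable_mult)
    finally show ?thesis by simp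
  qed
  show ?thesis
  proof (cases "ip G G = 0")
    case True
    have "G z = 0" if "z \<in> setT" for z
      using null_imp_zero_on_setT[of "\<lambda>z. G z * G z", OF _ _ _ that] True G
      by (simp add: ip_def continuous_on_mult)
    then have "ip F G = 0" unfolding ip_def by (intro integral_const_setT) simp
    then show ?thesis using True by simp
  next
    case False
    then have pos: "ip G G > 0" by (simp add: ip_def less_le)
    from nn[of "- ip F G / ip G G"]
    have "(ip F G)\<^sup>2 / ip G G \<le> ip F F"
      using pos by (simp add: power2_eq_square field_simps)
    then show ?thesis using pos by (simp add: pos_divide_le_eq)
  qed
qed

text \<open>
  The coordinates of the orthogonal projection to \<open>M\<close> of the product of two bilinear forms.
\<close>

definition \<beta> :: "real^'n^'n \<Rightarrow> real^'n^'n \<Rightarrow> real^'d" where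
  "\<beta> A B = (\<chi> j. ip (\<lambda>z. bilin A z * bilin B z) (fn (axis j 1)))"

lemma bilin_continuous: "continuous_on S (bilin A)"
  by (rule continuous_on_biform[OF biform_bilin])

lemma bilin_prod_continuous: "continuous_on S (\<lambda>z. bilin A z * bilin B z)"
  by (intro continuous_on_mult bilin_continuous)

lemma \<beta>_commute: "\<beta> A B = \<beta> B A"
  by (simp add: \<beta>_def mult.commute)

lemma \<beta>_linear: "linear (\<beta> A)"
proof (rule linearI)
  show "\<beta> A (B + C) = \<beta> A B + \<beta> A C" for B C
  proof -
    have "ip (\<lambda>z. bilin A z * bilin (B + C) z) G = ip (\<lambda>z. bilin A z * bilin B z) G + ip (\<lambda>z. bilin A z * bilin C z) G"
      if "continuous_on UNIV G" for G
      unfolding ip_def bilin_add distrib_left distrib_right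
      by (intro Bochner_Integration.integral_add integrable_mult bilin_prod_continuous that)
    then show ?thesis by (simp add: \<beta>_def vec_eq_iff fn_continuous)
  qed
  show "\<beta> A (c *\<^sub>R B) = c *\<^sub>R \<beta> A B" for c B
    by (simp add: \<beta>_def vec_eq_iff bilin_scaleR ip_def mult.left_commute[of _ c] mult.assoc)
qed

lemma \<beta>_inner: "\<beta> A B \<bullet> u = ip (\<lambda>z. bilin A z * bilin B z) (fn u)"
proof -
  have "ip (fn u) (\<lambda>z. bilin A z * bilin B z) = (\<Sum>j\<in>UNIV. u $ j * ip (fn (axis j 1)) (\<lambda>z. bilin A z * bilin B z))"
  proof (rule ip_sum_left)
    show "fn u z = (\<Sum>j\<in>UNIV. u $ j * fn (axis j 1) z)" if "z \<in> setT" for z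
      using fn_inner[OF setT_subset_variety[OF that], of u] by (simp add: \<zeta>_def inner_vec_def)
  qed (auto intro: fn_continuous bilin_prod_continuous)
  then show ?thesis
    by (simp add: \<beta>_def inner_vec_def ip_commute[of "\<lambda>z. bilin A z * bilin B z"] mult.commute)
qed

text \<open>
  The projection does not increase the norm, and the mean square of the product is bounded by the two
  fourth moments.
\<close>

lemma norm_\<beta>:
  defines "\<rho>2 \<equiv> (real CARD('n) - 1) * (real CARD('n) + 2)"
  shows "\<rho>2 * norm (\<beta> A B) \<le> 3 * norm A * norm B"
proof -
  have \<rho>: "\<rho>2 > 0" using real_card_ge_3 by (simp add: \<rho>2_def)
  let ?h = "\<lambda>z. bilin A z * bilin B z"
  have f4: "\<rho>2\<^sup>2 * ip (\<lambda>z. bilin A z * bilin A z) (\<lambda>z. bilin A z * bilin A z) \<le> 9 * norm A ^ 4" for A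
    using bilin_fourth_moment[of A] by (simp add: ip_def \<rho>2_def power4_eq_xxxx mult.assoc)
  have hh: "ip ?h ?h = ip (\<lambda>z. bilin A z * bilin A z) (\<lambda>z. bilin B z * bilin B z)"
    unfolding ip_def by (rule integral_cong_setT) (simp add: mult_ac)
  have "(\<rho>2\<^sup>2 * ip ?h ?h)\<^sup>2 \<le> (\<rho>2\<^sup>2 * ip (\<lambda>z. bilin A z * bilin A z) (\<lambda>z. bilin A z * bilin A z)) *
      (\<rho>2\<^sup>2 * ip (\<lambda>z. bilin B z * bilin B z) (\<lambda>z. bilin B z * bilin B z))"
  proof -
    have cs: "(ip ?h ?h)\<^sup>2 \<le> ip (\<lambda>z. bilin A z * bilin A z) (\<lambda>z. bilin A z * bilin A z) *
        ip (\<lambda>z. bilin B z * bilin B z) (\<lambda>z. bilin B z * bilin B z)"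
      unfolding hh by (intro ip_Cauchy_Schwarz bilin_prod_continuous)
    have "(c * x)\<^sup>2 \<le> (c * a) * (c * b)" if "x\<^sup>2 \<le> a * b" for a b c x :: real
      using mult_left_mono[OF that, of "c\<^sup>2"] by (simp add: power2_eq_square mult_ac)
    from this[OF cs] show ?thesis .
  qed
  also have "\<dots> \<le> (9 * norm A ^ 4) * (9 * norm B ^ 4)"
    by (intro mult_mono f4) (auto simp: ip_def)
  also have "\<dots> = ((3 * norm A * norm B)\<^sup>2)\<^sup>2"
    by (simp add: power_mult_distrib flip: power_mult)
  finally have h2: "\<rho>2\<^sup>2 * ip ?h ?h \<le> (3 * norm A * norm B)\<^sup>2"
    by (rule power2_le_imp_le) simp
  have "(norm (\<beta> A B))\<^sup>2 = ip ?h (fn (\<beta> A B))"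
    by (simp add: \<beta>_inner[symmetric] power2_norm_eq_inner)
  then have "((norm (\<beta> A B))\<^sup>2)\<^sup>2 \<le> ip ?h ?h * (norm (\<beta> A B))\<^sup>2"
    using ip_Cauchy_Schwarz[OF bilin_prod_continuous[of UNIV A B] fn_continuous[of UNIV "\<beta> A B"]]
    by (simp add: fn_ip power2_norm_eq_inner)
  then have "(norm (\<beta> A B))\<^sup>2 \<le> ip ?h ?h"
    by (cases "\<beta> A B = 0") (auto simp: power2_eq_square ip_def)
  then have "\<rho>2\<^sup>2 * (norm (\<beta> A B))\<^sup>2 \<le> \<rho>2\<^sup>2 * ip ?h ?h" by (rule mult_left_mono) simp
  with h2 have "(\<rho>2 * norm (\<beta> A B))\<^sup>2 \<le> (3 * norm A * norm B)\<^sup>2"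
    by (simp add: power_mult_distrib)
  then show ?thesis by (rule power2_le_imp_le) simp
qed

text \<open>
  Multiples of the identity matrix give multiples of \<open>x \<bullet> y\<close>, which vanishes on the variety.
\<close>

lemma traceless_representative:
  assumes "q \<in> bihom 1 1"
  obtains A :: "real^'n^'n" where "trace A = 0" "\<And>z. z \<in> varietyI \<Longrightarrow> eval_xy q (fst z) (snd z) = bilin A z"
proof -
  have "(\<lambda>z. eval_xy q (fst z) (snd z)) \<in> biform 1" by (rule biformI[OF assms]) simp
  then obtain B :: "real^'n^'n" where B: "(\<lambda>z. eval_xy q (fst z) (snd z)) = bilin B" by (rule biform_1_bilin)
  define A where "A = B + (- trace B / real CARD('n)) *\<^sub>R mat 1"
  show thesis
  proof (rule that)
    show "trace A = 0"
      by (simp add: A_def trace_def mat_def sum_subtractf)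
    fix z :: "(real^'n) \<times> (real^'n)" assume "z \<in> varietyI"
    then have "bilin (mat 1) z = 0"
      by (cases z) (simp add: bilin_def varietyI_def inner_commute)
    then show "eval_xy q (fst z) (snd z) = bilin A z"
      using fun_cong[OF B, of z] by (simp add: A_def bilin_add bilin_scaleR del: scaleR_minus_left)
  qed
qed

lemma Sos_decomposition:
  assumes "\<phi> u \<in> SosTilde \<sigma>"
  obtains k :: nat and A :: "nat \<Rightarrow> real^'n^'n" where "\<And>i. i < k \<Longrightarrow> trace (A i) = 0"
    "\<And>z. z \<in> varietyI \<Longrightarrow> u \<bullet> \<zeta> z + (norm (fst z))\<^sup>2 * (norm (snd z))\<^sup>2 = (\<Sum>i<k. (bilin (A i) z)\<^sup>2)"
proof -
  obtain p k and q :: "nat \<Rightarrow> 'n poly_xy" where p: "\<phi> u + normsqQ = abs_quotQ p" "p \<in> bihom 2 2"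
    and q: "\<And>i. i < k \<Longrightarrow> q i \<in> bihom 1 1" and pq: "p - (\<Sum>i<k. (q i)\<^sup>2) \<in> idealI"
    using assms by (auto simp: SosTilde_def SosQ_def)
  have "\<forall>i. \<exists>A :: real^'n^'n. i < k \<longrightarrow> trace A = 0 \<and> (\<forall>z\<in>varietyI. eval_xy (q i) (fst z) (snd z) = bilin A z)"
    using traceless_representative[OF q] by metis
  then obtain A :: "nat \<Rightarrow> real^'n^'n" where A: "\<And>i. i < k \<Longrightarrow> trace (A i) = 0"
    "\<And>i z. i < k \<Longrightarrow> z \<in> varietyI \<Longrightarrow> eval_xy (q i) (fst z) (snd z) = bilin (A i) z"
    by metis
  show thesis
  proof (rule that[OF A(1)])
    fix z :: "(real^'n) \<times> (real^'n)" assume z: "z \<in> varietyI"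
    have "eval_xy (p - (\<Sum>i<k. (q i)\<^sup>2)) (fst z) (snd z) = 0"
      using eval_idealI[OF pq, of "fst z" "snd z"] z by simp
    then have "eval_xy p (fst z) (snd z) = (\<Sum>i<k. (bilin (A i) z)\<^sup>2)"
      by (simp add: eval_xy_diff eval_xy_sum eval_xy_power A(2)[OF _ z])
    moreover have "eval_xy p (fst z) (snd z) = evalQ (\<phi> u + normsqQ) z"
      by (simp add: p evalQ_abs[OF p(2) z])
    ultimately show "u \<bullet> \<zeta> z + (norm (fst z))\<^sup>2 * (norm (snd z))\<^sup>2 = (\<Sum>i<k. (bilin (A i) z)\<^sup>2)"
      by (simp add: evalQ_add evalQ_normsqQ z evalQ_fn fn_inner)
  qed
qed

lemma Sos_subset_Pos: "\<phi> -` SosTilde \<sigma> \<subseteq> \<phi> -` PosTilde \<sigma>"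
proof
  fix u assume "u \<in> \<phi> -` SosTilde \<sigma>"
  then have u: "\<phi> u \<in> SosTilde \<sigma>" by simp
  show "u \<in> \<phi> -` PosTilde \<sigma>"
    by (rule Sos_decomposition[OF u]) (auto simp: Pos_preimage intro!: sum_nonneg)
qed

lemma \<beta>_hull:
  assumes A: "A \<in> convex hull F" and B: "B \<in> convex hull F"
  shows "\<beta> A B \<in> convex hull ((\<lambda>(a, b). \<beta> a b) ` (F \<times> F))"
proof -
  let ?G = "(\<lambda>(a, b). \<beta> a b) ` (F \<times> F)"
  have 1: "\<beta> a C \<in> convex hull ?G" if "a \<in> F" "C \<in> convex hull F" for a C
  proof -
    have "\<beta> a C \<in> convex hull (\<beta> a ` F)"
      using that(2) convex_hull_linear_image[OF \<beta>_linear[of a], of F] by blast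
    moreover have "\<beta> a ` F \<subseteq> ?G" using that(1) by auto
    ultimately show ?thesis using hull_mono by blast
  qed
  have "\<beta> B A \<in> convex hull (\<beta> B ` F)"
    using A convex_hull_linear_image[OF \<beta>_linear[of B], of F] by blast
  also have "\<dots> \<subseteq> convex hull ?G"
    by (rule hull_minimal) (use 1[OF _ B] in \<open>auto simp: \<beta>_commute[of B] convex_convex_hull\<close>)
  finally show ?thesis by (simp add: \<beta>_commute[of A])
qed

text \<open>
  The matrices are rescaled by the means \<open>l i\<close> of the squares, which sum up to \<open>1\<close>. The second moment
  bound places the rescaled matrices in the ball of radius \<open>\<rho>\<close>, hence in the hull of \<open>F\<close>, and \<open>\<beta>\<close>
  is linear in each argument. The constant term \<open>1\<close> does not contribute to coordinates in \<open>M\<close>.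
\<close>

lemma Sos_subset_hull:
  defines "\<rho> \<equiv> sqrt ((real CARD('n) - 1) * (real CARD('n) + 2))"
  assumes F: "\<And>A. norm A \<le> \<rho> \<Longrightarrow> A \<in> convex hull F"
  shows "\<phi> -` SosTilde \<sigma> \<subseteq> convex hull ((\<lambda>(a, b). \<beta> a b) ` (F \<times> F))"
proof
  let ?G = "(\<lambda>(a, b). \<beta> a b) ` (F \<times> F)"
  fix u assume "u \<in> \<phi> -` SosTilde \<sigma>"
  then have u: "\<phi> u \<in> SosTilde \<sigma>" by simp
  obtain k :: nat and A :: "nat \<Rightarrow> real^'n^'n" where tr: "\<And>i. i < k \<Longrightarrow> trace (A i) = 0"
    and dec: "\<And>z. z \<in> varietyI \<Longrightarrow> u \<bullet> \<zeta> z + (norm (fst z))\<^sup>2 * (norm (snd z))\<^sup>2 = (\<Sum>i<k. (bilin (A i) z)\<^sup>2)"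
    by (rule Sos_decomposition[OF u]) (rule that)
  have decT: "fn u z + 1 = (\<Sum>i<k. bilin (A i) z * bilin (A i) z)" if z: "z \<in> setT" for z
    using dec[OF setT_subset_variety[OF z]] fn_inner[OF setT_subset_variety[OF z], of u] z
    by (simp add: setT_iff power2_eq_square)
  define l where "l i = (\<integral>z. (bilin (A i) z)\<^sup>2 \<partial>\<sigma>)" for i
  have l0: "l i \<ge> 0" for i by (simp add: l_def)
  have "sum l {..<k} = (\<integral>z. (\<Sum>i<k. (bilin (A i) z)\<^sup>2) \<partial>\<sigma>)"
    unfolding l_def
    by (intro Bochner_Integration.integral_sum[symmetric] integrable_continuous continuous_intros bilin_continuous)
  also have "\<dots> = (\<integral>z. fn u z + 1 \<partial>\<sigma>)"
    by (rule integral_cong_setT) (simp add: decT power2_eq_square)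
  also have "\<dots> = (\<integral>z. fn u z \<partial>\<sigma>) + (\<integral>z. 1 \<partial>\<sigma>)"
    by (intro Bochner_Integration.integral_add integrable_continuous fn_continuous continuous_on_const)
  finally have l1: "sum l {..<k} = 1" by (simp add: fn_mean measure_setT)
  have "u = (\<Sum>i<k. \<beta> (A i) (A i))"
  proof (rule vector_eq_ldot[THEN iffD1, rule_format])
    fix v
    have "(\<Sum>i<k. \<beta> (A i) (A i)) \<bullet> v = (\<Sum>i<k. ip (\<lambda>z. bilin (A i) z * bilin (A i) z) (fn v))"
      by (simp add: inner_sum_left \<beta>_inner)
    also have "\<dots> = ip (\<lambda>z. fn u z + 1) (fn v)"
      using ip_sum_left[of "{..<k}" "\<lambda>i z. bilin (A i) z * bilin (A i) z" "fn v" "\<lambda>z. fn u z + 1" "\<lambda>_. 1"]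
      by (simp add: bilin_prod_continuous fn_continuous decT)
    also have "\<dots> = ip (fn u) (fn v) + (\<integral>z. fn v z \<partial>\<sigma>)"
      unfolding ip_def distrib_right
      by (subst Bochner_Integration.integral_add) (auto intro!: fn_continuous integrable_continuous continuous_on_mult)
    finally show "v \<bullet> u = v \<bullet> (\<Sum>i<k. \<beta> (A i) (A i))"
      by (simp add: fn_ip fn_mean inner_commute)
  qed
  moreover have "\<exists>y\<in>convex hull ?G. \<beta> (A i) (A i) = l i *\<^sub>R y" if i: "i < k" for i
  proof -
    \<comment> \<open>if \<open>l i = 0\<close> then \<open>A i = 0\<close> by the second moment bound, and \<open>B = 0\<close>\<close>
    define B where "B = (1 / sqrt (l i)) *\<^sub>R A i"
    have nA: "(norm (A i))\<^sup>2 \<le> \<rho>\<^sup>2 * l i"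
      using bilin_second_moment[OF tr[OF i]] real_card_ge_3 by (simp add: l_def \<rho>_def)
    have AB: "A i = sqrt (l i) *\<^sub>R B" and nB: "norm B \<le> \<rho>"
    proof -
      have \<rho>0: "\<rho> \<ge> 0" using real_card_ge_3 by (simp add: \<rho>_def)
      show "A i = sqrt (l i) *\<^sub>R B"
        using nA by (cases "l i = 0") (auto simp: B_def)
      have "norm (A i) \<le> \<rho> * sqrt (l i)"
        by (rule power2_le_imp_le) (use nA \<rho>0 l0 in \<open>auto simp: power_mult_distrib\<close>)
      then show "norm B \<le> \<rho>"
        using l0[of i] \<rho>0 by (cases "l i = 0") (auto simp: B_def divide_simps mult.commute)
    qed
    have "\<beta> (A i) (A i) = l i *\<^sub>R \<beta> B B"
      using l0[of i] unfolding AB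
      by (simp add: linear_scale[OF \<beta>_linear] \<beta>_commute[of "sqrt (l i) *\<^sub>R B"])
    moreover have "\<beta> B B \<in> convex hull ?G" by (intro \<beta>_hull F nB)
    ultimately show ?thesis by blast
  qed
  then obtain y where y: "\<And>i. i < k \<Longrightarrow> y i \<in> convex hull ?G" "\<And>i. i < k \<Longrightarrow> \<beta> (A i) (A i) = l i *\<^sub>R y i"
    by metis
  ultimately have "u = (\<Sum>i<k. l i *\<^sub>R y i)" by simp
  also have "\<dots> \<in> convex hull ?G"
    using l0 l1 y(1) by (intro convex_sum convex_convex_hull) auto
  finally show "u \<in> convex hull ?G" .
qed

lemma Sos_volume:
  assumes m: "m > 0"
  shows "volM \<phi> (SosTilde \<sigma>) \<le> (11 ^ (2 * (CARD('n) * CARD('n)))) ^ m *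
     (unit_ball_vol (real CARD('d)) * (75 / 16 / sqrt (real m)) ^ CARD('d))"
proof -
  define \<rho> where "\<rho> = sqrt ((real CARD('n) - 1) * (real CARD('n) + 2))"
  have \<rho>: "\<rho> > 0" using real_card_ge_3 by (simp add: \<rho>_def)
  \<comment> \<open>A net of mesh \<open>1 / 5\<close> in the ball of radius \<open>5 / 4 * \<rho>\<close> has the ball of radius \<open>\<rho>\<close> in its hull.
    It has at most \<open>(1 + 2 * 5)\<close> to the power \<open>n\<^sup>2\<close> points.\<close>
  have R: "5 / 4 * \<rho> > 0" using \<rho> by simp
  obtain F :: "(real^'n^'n) set" where F: "finite F" "F \<subseteq> cball 0 (5 / 4 * \<rho>)"
    "real (card F) \<le> (1 + 2 / (1 / 5)) ^ DIM(real^'n^'n)"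
    "\<And>x. x \<in> cball 0 (5 / 4 * \<rho>) \<Longrightarrow> \<exists>y\<in>F. dist x y \<le> 1 / 5 * (5 / 4 * \<rho>)"
    using ball_net[OF R, of "1 / 5", where 'a = "real^'n^'n"] by auto
  let ?G = "(\<lambda>(a, b). \<beta> a b) ` (F \<times> F)"
  have sub: "\<phi> -` SosTilde \<sigma> \<subseteq> convex hull ?G"
  proof (rule Sos_subset_hull)
    fix A :: "real^'n^'n"
    assume "norm A \<le> sqrt ((real CARD('n) - 1) * (real CARD('n) + 2))"
    then show "A \<in> convex hull F"
      by (intro net_hull_contains_ball[OF R F(1,4)]) (auto simp: \<rho>_def)
  qed
  have nG: "norm g \<le> 75 / 16" if "g \<in> ?G" for g
  proof -
    obtain a b where ab: "a \<in> F" "b \<in> F" "g = \<beta> a b" using \<open>g \<in> ?G\<close> by auto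
    have "norm a \<le> 5 / 4 * \<rho>" "norm b \<le> 5 / 4 * \<rho>" using ab F(2) by auto
    then have "3 * norm a * norm b \<le> 3 * (5 / 4 * \<rho>) * (5 / 4 * \<rho>)"
      using \<rho> by (intro mult_mono) auto
    moreover have "\<rho>\<^sup>2 * norm g \<le> 3 * norm a * norm b"
      using norm_\<beta>[of a b] real_card_ge_3 by (simp add: ab(3) \<rho>_def)
    ultimately have "\<rho>\<^sup>2 * norm g \<le> \<rho>\<^sup>2 * (75 / 16)" by (simp add: power2_eq_square)
    then show ?thesis using \<rho> by simp
  qed
  have "card ?G \<le> card F * card F"
    using card_image_le[of "F \<times> F" "\<lambda>(a, b). \<beta> a b"] F(1) by (simp add: card_cartesian_product)
  then have "real (card ?G) \<le> real (card F) * real (card F)"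
    by (metis of_nat_le_iff of_nat_mult)
  also have "\<dots> \<le> 11 ^ (CARD('n) * CARD('n)) * 11 ^ (CARD('n) * CARD('n))"
    using F(3) by (intro mult_mono) auto
  also have "\<dots> = 11 ^ (2 * (CARD('n) * CARD('n)))"
    by (simp flip: power_add)
  finally have cG: "real (card ?G) \<le> 11 ^ (2 * (CARD('n) * CARD('n)))" .
  have "volM \<phi> (SosTilde \<sigma>) \<le> real (card ?G) ^ m * (unit_ball_vol (real DIM(real^'d)) * (75 / 16 / sqrt (real m)) ^ DIM(real^'d))"
    unfolding volM_def using F(1) nG m by (intro hull_volume_le sub) auto
  also have "\<dots> \<le> (11 ^ (2 * (CARD('n) * CARD('n)))) ^ m * (unit_ball_vol (real CARD('d)) * (75 / 16 / sqrt (real m)) ^ CARD('d))"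
    using cG by (simp del: of_nat_le_iff) (intro mult_right_mono power_mono; simp)
  finally show ?thesis .
qed

end

section \<open>Comparison of the volumes\<close>

text \<open>
  The subtractions in the definition do not truncate, because already \<open>n\<^sup>4 / 4\<close> plus the subtracted
  terms is at most the square of the binomial coefficient.
\<close>

lemma dimM_ge:
  assumes "n \<ge> 3" shows "n ^ 4 \<le> 4 * dimM n"
proof -
  let ?c = "(n + 1) choose 2"
  have "2 * ?c = n * (n + 1)"
    by (simp add: choose_two)
  then have "(2 * ?c)\<^sup>2 = (n * (n + 1))\<^sup>2" by (rule arg_cong)
  moreover have "4 * ?c\<^sup>2 = (2 * ?c)\<^sup>2" by (simp only: power_mult_distrib) simp
  ultimately have "4 * ?c\<^sup>2 = (n * (n + 1))\<^sup>2" by simp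
  also have "\<dots> = n ^ 4 + (2 * n ^ 3 + n\<^sup>2)"
    by (simp add: power2_eq_square power3_eq_cube power4_eq_xxxx algebra_simps)
  finally have c: "4 * ?c\<^sup>2 = n ^ 4 + (2 * n ^ 3 + n\<^sup>2)" .
  have "6 * n\<^sup>2 \<le> 2 * n ^ 3"
    using mult_right_mono[OF assms, of "2 * n\<^sup>2"] by (simp add: power2_eq_square power3_eq_cube)
  moreover have "9 \<le> n\<^sup>2"
    using power_mono[OF assms, of 2] by simp
  ultimately have "n ^ 4 + 4 * n\<^sup>2 + 4 \<le> 4 * ?c\<^sup>2" unfolding c by linarith
  then show ?thesis by (simp add: dimM_def)
qed

lemma bound_constant:
  "344 \<le> (2 ^ 5 * 2 powr (1 / 2) * 5\<^sup>2 * 10 powr (2 / 9)) / (3 powr (3 / 2) :: real)"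
proof -
  have s2: "1.4 \<le> (2 :: real) powr (1 / 2)"
    unfolding powr_half_sqrt[OF zero_le_numeral] by (rule real_le_rsqrt) (simp add: power2_eq_square)
  have t: "1.6 \<le> (10 :: real) powr (2 / 9)"
  proof -
    let ?x = "(10 :: real) powr (2 / 9)"
    have "?x ^ 9 = ?x powr real 9" by (rule powr_realpow[symmetric]) simp
    also have "\<dots> = 100" by (simp only: powr_powr) simp
    finally have "1.6 ^ 9 \<le> ?x ^ 9" by (simp add: power_divide)
    then show ?thesis by (subst (asm) power_mono_iff) auto
  qed
  have s3: "(3 :: real) powr (3 / 2) \<le> 5.2"
  proof -
    have "(3 :: real) powr (3 / 2) = 3 powr (1 + 1 / 2)" by simp
    also have "\<dots> = 3 * sqrt 3" by (simp only: powr_add powr_half_sqrt) simp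
    also have "sqrt (3 :: real) \<le> 1.733" by (rule real_le_lsqrt) (simp_all add: power2_eq_square)
    finally show ?thesis by simp
  qed
  have "(344 :: real) * 5.2 \<le> 2 ^ 5 * 1.4 * 5\<^sup>2 * 1.6" by simp
  also have "\<dots> \<le> 2 ^ 5 * 2 powr (1 / 2) * 5\<^sup>2 * 10 powr (2 / 9)"
    using s2 t by (intro mult_mono) auto
  finally have "344 * 3 powr (3 / 2) \<le> (2 ^ 5 * 2 powr (1 / 2) * 5\<^sup>2 * 10 powr (2 / 9) :: real)"
    using s3 by linarith
  then show ?thesis by (simp add: pos_le_divide_eq)
qed

text \<open>
  The fifth root of \<open>11\<close> is below \<open>1.62\<close>, and the slack up to \<open>1.7\<close> absorbs the factor \<open>2\<close>.
\<close>

lemma entropy_numeric: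
  fixes e D :: nat
  assumes "5 * e \<le> D" "D \<ge> 21"
  shows "2 * 11 ^ e \<le> (17 / 10 :: real) ^ D"
proof -
  have "(11 :: real) ^ e \<le> ((162 / 100) ^ 5) ^ e" by (rule power_mono) (simp_all add: power_divide)
  also have "\<dots> = (162 / 100) ^ (5 * e)" by (rule power_mult[symmetric])
  also have "\<dots> \<le> (162 / 100) ^ D" using assms(1) by (rule power_increasing) simp
  finally have 1: "(11 :: real) ^ e \<le> (162 / 100) ^ D" .
  have "2 \<le> 1 + real D * (8 / 162)" using assms(2) by simp
  also have "\<dots> \<le> (1 + 8 / 162) ^ D" by (rule Bernoulli_inequality) simp
  finally have "2 * 11 ^ e \<le> (1 + 8 / 162 :: real) ^ D * (162 / 100) ^ D"
    using 1 by (intro mult_mono) auto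
  also have "\<dots> = ((1 + 8 / 162) * (162 / 100)) ^ D" by (rule power_mult_distrib[symmetric])
  finally show ?thesis by simp
qed

context stiefel_isometry
begin

text \<open>
  If the larger set had infinite volume, or the smaller one were not measurable, the ratio would be
  \<open>0\<close> by convention.
\<close>

lemma volume_ratio_le_1: "volM \<phi> (SosTilde \<sigma>) / volM \<phi> (PosTilde \<sigma>) \<le> 1"
proof (cases "emeasure lebesgue (\<phi> -` PosTilde \<sigma>) < \<infinity> \<and> \<phi> -` SosTilde \<sigma> \<in> sets lebesgue")
  case True
  have "\<phi> -` PosTilde \<sigma> \<in> sets lebesgue" using Pos_preimage_closed by auto
  then have "volM \<phi> (SosTilde \<sigma>) \<le> volM \<phi> (PosTilde \<sigma>)"
    unfolding volM_def using True Sos_subset_Pos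
    by (intro measure_mono_fmeasurable fmeasurableI) auto
  then show ?thesis by (simp add: volM_def divide_le_eq_1 less_le)
next
  case False
  then have "volM \<phi> (PosTilde \<sigma>) = 0 \<or> volM \<phi> (SosTilde \<sigma>) = 0"
    by (auto simp: volM_def measure_notin_sets measure_def[of _ "\<phi> -` PosTilde \<sigma>"] not_less top_unique)
  then show ?thesis by auto
qed

text \<open>
  The number of averages is \<open>11\<close> to the power \<open>2 n\<^sup>2 m\<close>, and \<open>2 n\<^sup>2 m \<le> D / 5\<close> when \<open>m \<le> n\<^sup>2 / 40\<close>. For
  \<open>n \<ge> 41\<close> rounding leaves \<open>m \<ge> n\<^sup>2 / 41\<close>, which bounds the radius of the covering balls.
\<close>

lemma volume_ratio_le:
  assumes D: "CARD('d) = dimM CARD('n)" and n: "CARD('n) \<ge> 41"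
  shows "(volM \<phi> (SosTilde \<sigma>) / volM \<phi> (PosTilde \<sigma>)) powr (1 / real (dimM CARD('n)))
     \<le> 344 / sqrt (real CARD('n))"
proof -
  define n D where "n = CARD('n)" and "D = CARD('d)"
  have n41: "n \<ge> 41" using n by (simp add: n_def)
  have D4: "n ^ 4 \<le> 4 * D" using dimM_ge[of n] n41 D by (simp add: D_def n_def)
  define m where "m = n\<^sup>2 div 40"
  have m_le: "40 * m \<le> n\<^sup>2" by (simp add: m_def)
  have "n\<^sup>2 < 40 * m + 40" unfolding m_def by presburger
  moreover have "41\<^sup>2 \<le> n\<^sup>2" using n41 by (rule power_mono) simp
  ultimately have m_ge: "n\<^sup>2 \<le> 41 * m" by simp
  have "1681 \<le> n\<^sup>2" using \<open>41\<^sup>2 \<le> n\<^sup>2\<close> by simp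
  then have m0: "m > 0" using m_ge by (cases m) auto
  have "5 * (2 * (n * n) * m) * 4 = n\<^sup>2 * (40 * m)" by (simp add: power2_eq_square)
  also have "\<dots> \<le> n\<^sup>2 * n\<^sup>2" using m_le by (rule mult_left_mono) simp
  also have "\<dots> = n ^ 4" by (simp flip: power_add)
  finally have e: "5 * (2 * (n * n) * m) \<le> D" using D4 by linarith
  have "1681 * 1681 \<le> n\<^sup>2 * n\<^sup>2" using \<open>1681 \<le> n\<^sup>2\<close> by (intro mult_mono) auto
  also have "n\<^sup>2 * n\<^sup>2 = n ^ 4" by (simp flip: power_add)
  finally have D21: "D \<ge> 21" using D4 by linarith
  let ?v = "unit_ball_vol (real D)" and ?R = "volM \<phi> (SosTilde \<sigma>) / volM \<phi> (PosTilde \<sigma>)"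
  have v: "?v > 0" by simp
  have R0: "?R \<ge> 0" by (simp add: volM_def)
  define Y where "Y = 17 / 10 * (75 / 16 / sqrt (real m)) * (6 * sqrt (real n))"
  have Y0: "Y > 0" using m0 n41 by (simp add: Y_def)
  have R: "?R \<le> Y ^ D"
  proof (cases "emeasure lborel (\<phi> -` PosTilde \<sigma>) < \<infinity>")
    case False
    then have "volM \<phi> (PosTilde \<sigma>) = 0"
      using Pos_preimage_closed
      by (simp add: volM_def measure_def not_less top_unique)
    then show ?thesis using Y0 by simp
  next
    case True
    define P where "P = ?v * (1 / (6 * sqrt (real n))) ^ D / 2"
    have P0: "P > 0" using n41 by (simp add: P_def)
    have "volM \<phi> (PosTilde \<sigma>) \<ge> P" using Pos_volume[OF True] by (simp add: P_def n_def D_def)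
    then have "?R \<le> volM \<phi> (SosTilde \<sigma>) / P"
      using P0 by (intro divide_left_mono) (auto simp: volM_def)
    also have "\<dots> \<le> ((11 ^ (2 * (n * n))) ^ m * (?v * (75 / 16 / sqrt (real m)) ^ D)) / P"
      using Sos_volume[OF m0] P0 by (intro divide_right_mono) (auto simp: n_def D_def)
    also have "\<dots> = (2 * 11 ^ (2 * (n * n) * m)) * ((75 / 16 / sqrt (real m)) ^ D * (6 * sqrt (real n)) ^ D)"
    proof -
      have "X * (w * a) / (w * (1 / s) ^ D / 2) = (2 * X) * (a * s ^ D)" if "w > 0" "s > 0" for X w a s :: real
        using that by (simp add: power_one_over)
      note ratio = this
      have s: "6 * sqrt (real n) > 0" using n41 by simp
      show ?thesis
        unfolding P_def power_mult[of "11 :: real" "2 * (n * n)" m] by (rule ratio[OF v s])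
    qed
    also have "\<dots> \<le> (17 / 10) ^ D * ((75 / 16 / sqrt (real m)) ^ D * (6 * sqrt (real n)) ^ D)"
      by (intro mult_right_mono entropy_numeric e D21) auto
    also have "\<dots> = Y ^ D"
      unfolding Y_def power_mult_distrib by (simp only: mult.assoc)
    finally show ?thesis .
  qed
  have "?R powr (1 / real D) \<le> (Y ^ D) powr (1 / real D)"
    using R R0 by (intro powr_mono2) auto
  also have "\<dots> = Y"
    using Y0 D21 by (simp add: powr_powr flip: powr_realpow)
  also have "Y \<le> 344 / sqrt (real n)"
  proof -
    have "sqrt (real (n\<^sup>2)) \<le> sqrt (real (41 * m))" using m_ge by (simp only: real_sqrt_le_iff of_nat_le_iff)
    then have "real n \<le> sqrt 41 * sqrt (real m)" by (simp add: real_sqrt_mult)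
    also have "\<dots> \<le> 6.41 * sqrt (real m)"
      by (intro mult_right_mono real_le_lsqrt) (simp_all add: power2_eq_square)
    finally have nm: "sqrt (real n) * sqrt (real n) \<le> 6.41 * sqrt (real m)" by simp
    have "Y * sqrt (real n) = 765 / 16 * (sqrt (real n) * sqrt (real n) / sqrt (real m))"
      by (simp add: Y_def)
    also have "\<dots> \<le> 765 / 16 * 6.41"
      using nm m0 by (intro mult_left_mono) (simp_all add: pos_divide_le_eq)
    also have "\<dots> \<le> 344" by simp
    finally show ?thesis using n41 by (simp add: pos_le_divide_eq)
  qed
  finally show ?thesis using D by (simp add: n_def D_def)
qed

end

theorem corollary4p7:
  fixes \<sigma> :: "((real^'n::finite) \<times> (real^'n)) measure"
    and \<phi> :: "real^'d::finite \<Rightarrow> 'n quotQ"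
  assumes "CARD('n) \<ge> 3"
    and "invariant_measure_T \<sigma>"
    and "CARD('d) = dimM CARD('n)"
    and "isometry_onto_M \<sigma> \<phi>"
  shows "(volM \<phi> (SosTilde \<sigma>) / volM \<phi> (PosTilde \<sigma>)) powr (1 / real (dimM CARD('n)))
     \<le> (2 ^ 5 * 2 powr (1 / 2) * 5\<^sup>2 * 10 powr (2 / 9)) / (3 powr (3 / 2) * sqrt (real CARD('n)))"
proof -
  interpret stiefel_isometry \<sigma> \<phi>
    by unfold_locales (use assms in auto)
  let ?R = "volM \<phi> (SosTilde \<sigma>) / volM \<phi> (PosTilde \<sigma>)" and ?n = "real CARD('n)"
  have n: "?n > 0" using assms(1) by simp
  have "?R powr (1 / real (dimM CARD('n))) \<le> 344 / sqrt ?n"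
  proof (cases "CARD('n) \<ge> 41")
    case True
    then show ?thesis by (rule volume_ratio_le[OF assms(3)])
  next
    case False
    have "?R powr (1 / real (dimM CARD('n))) \<le> 1 powr (1 / real (dimM CARD('n)))"
      using volume_ratio_le_1 by (intro powr_mono2) (auto simp: volM_def)
    moreover have "sqrt ?n \<le> 344"
      using False by (intro real_le_lsqrt) (simp_all add: power2_eq_square)
    then have "1 \<le> 344 / sqrt ?n" using n by (simp add: pos_le_divide_eq)
    ultimately show ?thesis unfolding powr_one_eq_one by linarith
  qed
  also have "\<dots> \<le> (2 ^ 5 * 2 powr (1 / 2) * 5\<^sup>2 * 10 powr (2 / 9)) / 3 powr (3 / 2) / sqrt ?n"
    using n by (intro divide_right_mono bound_constant) simp
  finally show ?thesis by simp
qed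

end
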